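(* Let $\Lambda\subset\mathbb{R}^{24}$ denote the set of the $196560$ shortest vectors of the Leech lattice (scaled so that each has squared length 32), as described explicitly in the context. Put $\omega_h=24-8h$ for $1\le h\le5$, so $\{\omega_1,\ldots,\omega_5\}=\{16,8,0,-8,-16\}$. For each antipodal pair $\pm a$ of vectors in $\Lambda$ choose one representative $a$, extend $\{a\}$ to an orthogonal basis $\{a,c^{(1)}(a),\ldots,c^{(23)}(a)\}$ of $\mathbb{R}^{24}$, and for $1\le i\le 23$ let $$S_{a,i}(Y)=\left(c^{(i)}(a)\cdot Y\right)\prod_{h=1}^{5}(a\cdot Y-\omega_h)\in\mathbb{C}[Y_1,\ldots,Y_{24}].$$ Let $\mathrm{Nm}=\sum_{i=1}^{24}Y_i^2-32$, let $\mathcal{G}$ be the set consisting of $\mathrm{Nm}$ and all the polynomials $S_{a,i}$ (with $\pm a$ ranging over the antipodal pairs in $\Lambda$ and $1\le i\le 23$), and let $I=\langle\mathcal{G}\rangle\subseteq\mathbb{C}[Y_1,\ldots,Y_{24}]$. Then: (i) $\mathcal{Z}(I)=\Lambda$ in $\mathbb{C}^{24}$; (ii) each zero of $I$ is simple, so $I$ is a radical ideal; (iii) the smallest degree of a non-trivial polynomial in $\mathcal{I}(\Lambda)$ is six; (iv) $\mathcal{I}(\Lambda)$ is generated by a set of polynomials all having degree six or less.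
   Context: Let $\mathsf{G}$ be the extended binary Golay code of length 24; for instance, it may be taken to be the binary row space of the $12\times24$ matrix $[I\mid J-A]$, where $I$ is the identity matrix, $A$ is the adjacency matrix of the icosahedron graph and $J$ is the all-ones matrix. The set $\Lambda$ consists of the following vectors: (1) the $2^7\cdot759$ vectors of shape $(\pm2^8,0^{16})$, i.e. with eight entries equal to $\pm2$ and all others $0$, whose support equals the support of some weight-8 codeword of $\mathsf{G}$ and which have an even number of minus signs; (2) the $24\cdot2^{12}$ vectors of shape $(\mp3,\pm1^{23})$, where the upper signs appear exactly on the support of some codeword of $\mathsf{G}$; that is, for a coordinate position $i$ and a codeword with support $C$, entry $i$ is $-3$ if $i\in C$ and $+3$ if $i\notin C$, while each entry $j\ne i$ is $+1$ if $j\in C$ and $-1$ if $j\notin C$; (3) the $4\binom{24}{2}$ vectors of shape $(\pm4^2,0^{22})$, i.e. with any two entries equal to $\pm4$ (arbitrary signs) and all others $0$. Notation: $a\cdot Y=a_1Y_1+\cdots+a_{24}Y_{24}$. For a set $X\subseteq\mathbb{C}^m$, $\mathcal{I}(X)$ is the ideal of all polynomials in $\mathbb{C}[Y_1,\ldots,Y_m]$ vanishing at every point of $X$. For a set (or ideal) $S$ of polynomials, $\mathcal{Z}(S)$ is the set of all common zeros of $S$ in $\mathbb{C}^m$. A polynomial is trivial if it is divisible by $\mathrm{Nm}$, and non-trivial otherwise. Degree means total degree. A zero $p$ of an ideal generated by $F_1,\ldots,F_n\in\mathbb{C}[Y_1,\ldots,Y_m]$ is simple if the Jacobian matrix $\left(\partial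 F_i/\partial Y_j\big|_p\right)$ has rank $m$ (equivalently, the Zariski tangent space of the ideal at $p$ is zero-dimensional). *)

theory Defs
  imports "HOL-Analysis.Analysis" "HOL-Library.Poly_Mapping" "HOL-Library.Z2"
begin

section \<open>Polynomials in finitely many variables\<close>

text \<open>
  A polynomial in variables indexed by \<open>'n\<close> maps each exponent vector, with finitely many
  exceptions, to the coefficient \<open>0\<close>. The multiplication on \<open>poly_mapping\<close> is convolution, which
  makes the type the usual polynomial ring over \<open>'a\<close>.
\<close>

type_synonym ('n, 'a) mpoly = "('n \<Rightarrow>\<^sub>0 nat) \<Rightarrow>\<^sub>0 'a"

definition Const :: "'a::comm_ring_1 \<Rightarrow> ('n, 'a) mpoly" where
  "Const a = Poly_Mapping.single 0 a"

definition Var :: "'n \<Rightarrow> ('n, 'a::comm_ring_1) mpoly" where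
  "Var j = Poly_Mapping.single (Poly_Mapping.single j 1) 1"

definition poly_eval :: "'a ^ 'n \<Rightarrow> ('n::finite, 'a::comm_ring_1) mpoly \<Rightarrow> 'a" where
  "poly_eval p f =
     (\<Sum>m\<in>Poly_Mapping.keys f. Poly_Mapping.lookup f m *
        (\<Prod>j\<in>UNIV. (p $ j) ^ Poly_Mapping.lookup m j))"

text \<open>The total degree; by convention the zero polynomial has degree \<open>0\<close>.\<close>

definition total_degree :: "('n::finite, 'a::comm_ring_1) mpoly \<Rightarrow> nat" where
  "total_degree f =
     Max (insert 0 ((\<lambda>m. \<Sum>j\<in>UNIV. Poly_Mapping.lookup m j) ` Poly_Mapping.keys f))"

text \<open>
  The formal partial derivative. If the exponent of variable \<open>j\<close> in \<open>m\<close> is \<open>0\<close>, the truncated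
  subtraction \<open>m - single j 1\<close> is harmless since the coefficient is then \<open>0\<close>.
\<close>

definition partial_deriv :: "'n \<Rightarrow> ('n, 'a::comm_ring_1) mpoly \<Rightarrow> ('n, 'a) mpoly" where
  "partial_deriv j f =
     (\<Sum>m\<in>Poly_Mapping.keys f.
        Poly_Mapping.single (m - Poly_Mapping.single j 1)
          (of_nat (Poly_Mapping.lookup m j) * Poly_Mapping.lookup f m))"


section \<open>Ideals and zero sets\<close>

text \<open>An ideal is a submodule of the ring regarded as a module over itself.\<close>

lemma module_times: "module ((*) :: 'a::comm_ring_1 \<Rightarrow> 'a \<Rightarrow> 'a)"
  by unfold_locales (simp_all add: algebra_simps)

definition ideal_generated :: "'a::comm_ring_1 set \<Rightarrow> 'a set" where
  "ideal_generated S = module.span (*) S"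

lemma ideal_generated_explicit:
  "ideal_generated S = {(\<Sum>f\<in>T. r f * f) | T r. finite T \<and> T \<subseteq> S}"
  unfolding ideal_generated_def by (rule module.span_explicit[OF module_times])

definition is_radical :: "'a::comm_ring_1 set \<Rightarrow> bool" where
  "is_radical J \<longleftrightarrow> (\<forall>f n. f ^ n \<in> J \<longrightarrow> f \<in> J)"

definition vanishing_ideal :: "('a ^ 'n) set \<Rightarrow> ('n::finite, 'a::comm_ring_1) mpoly set" where
  "vanishing_ideal X = {f. \<forall>p\<in>X. poly_eval p f = 0}"

definition zero_set :: "('n::finite, 'a::comm_ring_1) mpoly set \<Rightarrow> ('a ^ 'n) set" where
  "zero_set S = {p. \<forall>f\<in>S. poly_eval p f = 0}"

text \<open>
  A zero of the ideal generated by \<open>F\<close> is simple if the Jacobian matrix of \<open>F\<close> at that point has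
  rank equal to the number of variables. The rows of that matrix are indexed by \<open>F\<close>, which is a set
  and not a type, so its rank is written as the dimension of the span of its rows, as in the
  definition of \<open>rank\<close>.
\<close>

definition jacobian_row :: "'a ^ 'n \<Rightarrow> ('n::finite, 'a::field) mpoly \<Rightarrow> 'a ^ 'n" where
  "jacobian_row p f = (\<chi> j. poly_eval p (partial_deriv j f))"

definition simple_zero :: "('n::finite, 'a::field) mpoly set \<Rightarrow> 'a ^ 'n \<Rightarrow> bool" where
  "simple_zero F p \<longleftrightarrow>
     p \<in> zero_set (ideal_generated F) \<and> vec.dim (jacobian_row p ` F) = CARD('n)"


section \<open>The extended binary Golay code\<close>

text \<open>
  Vertices \<open>0\<close> and \<open>11\<close> are opposite; their neighbours form the pentagons \<open>1,\<dots>,5\<close> and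
  \<open>6,\<dots>,10\<close>.
\<close>

definition icosahedron_edges :: "12 set set" where
  "icosahedron_edges =
     {{0,1}, {0,2}, {0,3}, {0,4}, {0,5},
      {1,2}, {2,3}, {3,4}, {4,5}, {5,1},
      {1,6}, {1,7}, {2,7}, {2,8}, {3,8}, {3,9}, {4,9}, {4,10}, {5,10}, {5,6},
      {6,7}, {7,8}, {8,9}, {9,10}, {10,6},
      {11,6}, {11,7}, {11,8}, {11,9}, {11,10}}"

definition icosahedron_adjacency :: "bit ^ 12 ^ 12" where
  "icosahedron_adjacency = (\<chi> i j. if {i, j} \<in> icosahedron_edges then 1 else 0)"

text \<open>The block matrix \<open>[I | J - A]\<close>; the two summands of \<open>12 + 12\<close> index its two blocks.\<close>

definition golay_matrix :: "bit ^ (12 + 12) ^ 12" where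
  "golay_matrix =
     (\<chi> i k. case k of Inl j \<Rightarrow> mat 1 $ i $ j | Inr j \<Rightarrow> 1 - icosahedron_adjacency $ i $ j)"

text \<open>
  The extended binary Golay code is unique up to the order of its coordinates, so every row space
  of \<open>golay_matrix\<close>, for any arrangement \<open>\<pi>\<close> of the columns, is admitted.
\<close>

definition extended_golay_code :: "(bit ^ 24) set \<Rightarrow> bool" where
  "extended_golay_code C \<longleftrightarrow>
     (\<exists>\<pi> :: 24 \<Rightarrow> 12 + 12. bij \<pi> \<and>
        C = (\<lambda>w. \<chi> k. w $ \<pi> k) ` vec.span (rows golay_matrix))"

definition codeword_support :: "bit ^ 'n \<Rightarrow> 'n set" where
  "codeword_support w = {i. w $ i \<noteq> 0}"


section \<open>The shortest vectors of the Leech lattice\<close>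

definition leech_shape2 :: "(bit ^ 24) set \<Rightarrow> (real ^ 24) set" where
  "leech_shape2 C =
     {v. \<exists>w\<in>C. card (codeword_support w) = 8 \<and>
           (\<forall>i\<in>codeword_support w. v $ i \<in> {2, -2}) \<and>
           (\<forall>i. i \<notin> codeword_support w \<longrightarrow> v $ i = 0) \<and>
           even (card {i. v $ i < 0})}"

definition leech_shape3 :: "(bit ^ 24) set \<Rightarrow> (real ^ 24) set" where
  "leech_shape3 C =
     {(\<chi> j. if j = i then (if j \<in> codeword_support w then -3 else 3)
            else (if j \<in> codeword_support w then 1 else -1)) | i w. w \<in> C}"

definition leech_shape4 :: "(real ^ 24) set" where
  "leech_shape4 =
     {v. \<exists>i j. i \<noteq> j \<and> v $ i \<in> {4, -4} \<and> v $ j \<in> {4, -4} \<and>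
           (\<forall>k. k \<noteq> i \<and> k \<noteq> j \<longrightarrow> v $ k = 0)}"

definition leech_min_vectors :: "(bit ^ 24) set \<Rightarrow> (real ^ 24) set" where
  "leech_min_vectors C = leech_shape2 C \<union> leech_shape3 C \<union> leech_shape4"

definition complex_vec :: "real ^ 'n \<Rightarrow> complex ^ 'n" where
  "complex_vec v = (\<chi> i. complex_of_real (v $ i))"


section \<open>The generating polynomials\<close>

definition antipodal_representatives :: "(real ^ 'n) set \<Rightarrow> (real ^ 'n) set \<Rightarrow> bool" where
  "antipodal_representatives X R \<longleftrightarrow> R \<subseteq> X \<and> (\<forall>a\<in>X. \<exists>!b. b \<in> R \<and> (b = a \<or> b = - a))"

definition orthogonal_basis :: "('a::euclidean_space) set \<Rightarrow> bool" where
  "orthogonal_basis B \<longleftrightarrow> pairwise orthogonal B \<and> independent B \<and> span B = UNIV"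

definition linear_form :: "real ^ 'n::finite \<Rightarrow> ('n, complex) mpoly" where
  "linear_form a = (\<Sum>j\<in>UNIV. Const (complex_of_real (a $ j)) * Var j)"

definition omega :: "nat \<Rightarrow> real" where
  "omega h = 24 - 8 * real h"

definition S_poly :: "real ^ 24 \<Rightarrow> real ^ 24 \<Rightarrow> (24, complex) mpoly" where
  "S_poly a c =
     linear_form c * (\<Prod>h = 1..5. linear_form a - Const (complex_of_real (omega h)))"

definition Nm :: "(24, complex) mpoly" where
  "Nm = (\<Sum>i\<in>UNIV. Var i ^ 2) - Const 32"

definition generators ::
  "(real ^ 24) set \<Rightarrow> (real ^ 24 \<Rightarrow> nat \<Rightarrow> real ^ 24) \<Rightarrow> (24, complex) mpoly set" where
  "generators R c = insert Nm {S_poly a (c a i) | a i. a \<in> R \<and> i \<in> {1..23}}"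

definition trivial_poly :: "(24, complex) mpoly \<Rightarrow> bool" where
  "trivial_poly f \<longleftrightarrow> Nm dvd f"

end

theory Submission
  imports Defs
begin

text \<open>
  Write \<open>\<Lambda>\<close> for the set of shortest vectors and \<open>J\<close> for the ideal generated by \<open>Nm\<close> and the \<open>S\<^sub>a\<^sub>,\<^sub>i\<close>.

  The zeros. The vectors of \<open>\<Lambda>\<close> lie in a lattice in which every squared length is a multiple of 16
  and none equals 16. Applied to sums and differences of two vectors of \<open>\<Lambda>\<close>, this leaves only the
  inner products \<open>0\<close>, \<open>\<plusminus>8\<close>, \<open>\<plusminus>16\<close> and, for \<open>v = \<plusminus>w\<close>, \<open>\<plusminus>32\<close> (\<open>inner_minimal_vectors\<close>), so all
  generators vanish on \<open>\<Lambda>\<close>. Conversely, let \<open>p\<close> be a complex zero. If \<open>a \<cdot> p\<close> is not among the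
  \<open>\<omega>\<^sub>h\<close> for some \<open>a\<close>, then \<open>p\<close> is orthogonal to all \<open>c\<^sub>i(a)\<close>, hence \<open>p = \<plusminus>a\<close>. Otherwise all inner
  products of \<open>p\<close> with \<open>\<Lambda>\<close> are multiples of 8; the lattice is self-dual for this scaling, because the
  Golay code is self-dual, and its vectors of squared length 32 are exactly those of \<open>\<Lambda>\<close>
  (\<open>minimal_if_inner_products_integral\<close>).

  Simplicity and radicality. At \<open>p = \<plusminus>a\<close> the gradients of \<open>Nm\<close> and of the \<open>S\<^sub>a\<^sub>,\<^sub>i\<close> are non-zero
  multiples of the chosen orthogonal basis. That \<open>J\<close> is the full vanishing ideal of \<open>\<Lambda>\<close> does not
  require the Nullstellensatz: each form \<open>a \<cdot> Y\<close> satisfies modulo \<open>J\<close> a polynomial equation with the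
  seven simple roots \<open>0, \<plusminus>8, \<plusminus>16, \<plusminus>32\<close> (\<open>linear_form_annihilator\<close>), and 24 of these forms are
  linear coordinates. The quotient by \<open>J\<close> is thus a quotient of a finite power of the complex
  numbers, where every ideal is determined by its zeros (\<open>vanishing_on_zero_set_imp_in_ideal\<close>). As
  the generators have degree at most 6, so does a generating set of the vanishing ideal.

  Degrees. It remains to see that a polynomial \<open>f\<close> of degree at most 5 that vanishes on \<open>\<Lambda>\<close> is
  divisible by \<open>Nm\<close>. Since \<open>\<Lambda> = -\<Lambda>\<close> and \<open>\<Sum>Y\<^sub>i\<^sup>2 = 32\<close> modulo \<open>Nm\<close>, one may assume that \<open>f\<close> is a form
  of degree 5, and must show \<open>f = 0\<close> (\<open>quintic_eq_0\<close>). This is usually derived from the spherical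
  11-design property of \<open>\<Lambda>\<close>; here it is a direct computation. Each of the three shapes in \<open>\<Lambda>\<close> is
  invariant under a group of sign changes: all of them on two coordinates, the even ones on an octad,
  and the code itself on all coordinates. Averaging against the characters of these groups splits
  \<open>f\<close> by the set \<open>U\<close> of coordinates with odd exponent. Each part is a monomial times a quadratic,
  linear or constant form in the squares of the coordinates, for \<open>U\<close> of size 1, 3 or 5. The vanishing
  conditions become linear equations for the coefficients of these forms, and they have only the
  zero solution because the octads form a Steiner system: each \<open>k \<le> 5\<close> points lie in a number of
  octads that depends only on \<open>k\<close>, namely 253, 77, 21, 5, 1 for \<open>k = 1, \<dots>, 5\<close>
  (\<open>linear_octad_system\<close>, \<open>quadratic_octad_system\<close>).
\<close>


section \<open>Evaluation, degree and derivative of polynomials\<close>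

abbreviation (input) lookup where "lookup \<equiv> Poly_Mapping.lookup"
abbreviation (input) keys where "keys \<equiv> Poly_Mapping.keys"
abbreviation (input) single where "single \<equiv> Poly_Mapping.single"

definition monomial_value :: "'a::comm_ring_1 ^ 'n::finite \<Rightarrow> ('n \<Rightarrow>\<^sub>0 nat) \<Rightarrow> 'a" where
  "monomial_value p m = (\<Prod>j\<in>UNIV. (p $ j) ^ lookup m j)"

definition exponent_sum :: "('n::finite \<Rightarrow>\<^sub>0 nat) \<Rightarrow> nat" where
  "exponent_sum m = (\<Sum>j\<in>UNIV. lookup m j)"

lemma monomial_value_0 [simp]: "monomial_value p 0 = 1"
  by (simp add: monomial_value_def)

lemma monomial_value_add: "monomial_value p (m + n) = monomial_value p m * monomial_value p n"
  by (simp add: monomial_value_def lookup_add power_add prod.distrib)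

lemma monomial_value_sum:
  "finite A \<Longrightarrow> monomial_value p (sum h A) = (\<Prod>x\<in>A. monomial_value p (h x))"
  by (induction A rule: finite_induct) (auto simp: monomial_value_add)

lemma monomial_value_single [simp]: "monomial_value p (single j k) = p $ j ^ k"
proof -
  have "monomial_value p (single j k) = (\<Prod>i\<in>UNIV. if i = j then p $ j ^ k else 1)"
    unfolding monomial_value_def by (intro prod.cong) (auto simp: lookup_single when_def)
  then show ?thesis by simp
qed

lemma exponent_sum_0 [simp]: "exponent_sum 0 = 0"
  by (simp add: exponent_sum_def)

lemma exponent_sum_add: "exponent_sum (m + n) = exponent_sum m + exponent_sum n"
  by (simp add: exponent_sum_def lookup_add sum.distrib)

lemma exponent_sum_single [simp]: "exponent_sum (single j k) = k"
  by (simp add: exponent_sum_def lookup_single when_def)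

lemma exponent_sum_eq_0_iff: "exponent_sum m = 0 \<longleftrightarrow> m = 0"
proof
  assume "exponent_sum m = 0"
  then show "m = 0" by (intro poly_mapping_eqI) (simp add: exponent_sum_def)
qed simp

lemma monomial_value_scale:
  "monomial_value (c *s p) m = c ^ exponent_sum m * monomial_value p m"
  by (simp add: monomial_value_def exponent_sum_def power_mult_distrib prod.distrib power_sum)

lemma poly_eval_superset:
  assumes "finite K" "keys f \<subseteq> K"
  shows "poly_eval p f = (\<Sum>m\<in>K. lookup f m * monomial_value p m)"
  unfolding poly_eval_def monomial_value_def using assms
  by (intro sum.mono_neutral_left) (auto simp: in_keys_iff)

lemma poly_eval_add [simp]: "poly_eval p (f + g) = poly_eval p f + poly_eval p g"
proof -
  let ?K = "keys f \<union> keys g"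
  have "keys (f + g) \<subseteq> ?K" by (rule keys_add)
  then show ?thesis
    by (simp add: poly_eval_superset[of ?K] lookup_add algebra_simps sum.distrib)
qed

lemma poly_eval_single [simp]:
  "poly_eval p (single m c) = c * monomial_value p m"
  by (subst poly_eval_superset[of "{m}"]) auto

lemma poly_eval_0 [simp]: "poly_eval p 0 = 0"
  by (simp add: poly_eval_def)

lemma poly_eval_sum [simp]: "poly_eval p (sum h A) = (\<Sum>x\<in>A. poly_eval p (h x))"
  by (induction A rule: infinite_finite_induct) auto

lemma poly_mapping_sum_singles:
  "f = (\<Sum>m\<in>keys f. single m (lookup f m))"
  by (rule poly_mapping_eqI)
     (auto simp: lookup_sum lookup_single when_def in_keys_iff)

text \<open>Evaluation is multiplicative on single terms, and both sides are additive in \<open>f\<close> and \<open>g\<close>.\<close>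

lemma poly_eval_mult [simp]: "poly_eval p (f * g) = poly_eval p f * poly_eval p g"
proof -
  let ?s = "\<lambda>f m. single m (lookup f m)"
  have "f * g = (\<Sum>m\<in>keys f. \<Sum>n\<in>keys g. ?s f m * ?s g n)"
    unfolding sum_product[symmetric] poly_mapping_sum_singles[symmetric] ..
  also have "poly_eval p \<dots> = (\<Sum>m\<in>keys f. \<Sum>n\<in>keys g.
      poly_eval p (?s f m) * poly_eval p (?s g n))"
    by (simp add: mult_single monomial_value_add algebra_simps)
  also have "\<dots> = (\<Sum>m\<in>keys f. poly_eval p (?s f m)) * (\<Sum>n\<in>keys g. poly_eval p (?s g n))"
    by (simp add: sum_product)
  also have "\<dots> = poly_eval p f * poly_eval p g"
    unfolding poly_eval_sum[symmetric] poly_mapping_sum_singles[symmetric] ..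
  finally show ?thesis .
qed

lemma poly_eval_Const [simp]: "poly_eval p (Const a) = a"
  by (simp add: Const_def)

lemma poly_eval_Var [simp]: "poly_eval p (Var j) = p $ j"
  by (simp add: Var_def)

lemma Const_1 [simp]: "Const 1 = 1" by (simp add: Const_def)
lemma Const_0 [simp]: "Const 0 = 0" by (simp add: Const_def)
lemma Const_add: "Const (a + b) = Const a + Const b" by (simp add: Const_def single_add)
lemma Const_uminus: "Const (- a) = - Const a" by (simp add: Const_def single_uminus)
lemma Const_diff: "Const (a - b) = Const a - Const b" by (simp add: Const_def single_diff)
lemma Const_mult: "Const (a * b) = Const a * Const b" by (simp add: Const_def mult_single)
lemma Const_sum: "Const (sum h A) = (\<Sum>x\<in>A. Const (h x))"
  by (induction A rule: infinite_finite_induct) (auto simp: Const_add)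

lemma poly_eval_1 [simp]: "poly_eval p 1 = 1"
  by (metis Const_1 poly_eval_Const)

lemma poly_eval_uminus [simp]: "poly_eval p (- f) = - poly_eval p f"
proof -
  have "poly_eval p (- f) + poly_eval p f = poly_eval p (- f + f)" by (simp only: poly_eval_add)
  then show ?thesis by (simp add: eq_neg_iff_add_eq_0)
qed

lemma poly_eval_diff [simp]: "poly_eval p (f - g) = poly_eval p f - poly_eval p g"
  using poly_eval_add[of p f "- g"] by simp

lemma poly_eval_power [simp]: "poly_eval p (f ^ n) = poly_eval p f ^ n"
  by (induction n) auto

lemma poly_eval_prod [simp]: "poly_eval p (prod h A) = (\<Prod>x\<in>A. poly_eval p (h x))"
  by (induction A rule: infinite_finite_induct) auto

lemma single_conv_Const_Var:
  "single m a =
     Const a * (\<Prod>j\<in>UNIV. Var j ^ lookup m j :: ('n::finite, 'a::comm_ring_1) mpoly)"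
proof -
  have pow: "(Var j :: ('n, 'a) mpoly) ^ k = single (single j k) 1" for j k
    by (induction k) (simp_all add: Var_def mult_single single_add[symmetric])
  have pr: "(\<Prod>j\<in>A. single (h j) (1::'a)) = single (sum h A) 1"
    if "finite A" for A :: "'n set" and h :: "'n \<Rightarrow> ('n \<Rightarrow>\<^sub>0 nat)"
    using that by (induction A rule: finite_induct) (auto simp: mult_single)
  have m: "(\<Sum>j\<in>UNIV. single j (lookup m j)) = m"
    by (rule poly_mapping_eqI) (simp add: lookup_sum lookup_single when_def)
  show ?thesis
    by (simp add: pow pr m Const_def mult_single)
qed

text \<open>Constants and variables generate the polynomial ring, since every term is a product of them.\<close>

lemma mpoly_induct [case_names Const Var add mult]:
  fixes f :: "('n::finite, 'a::comm_ring_1) mpoly"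
  assumes "\<And>a. P (Const a)" "\<And>j. P (Var j)"
    and "\<And>f g. P f \<Longrightarrow> P g \<Longrightarrow> P (f + g)" "\<And>f g. P f \<Longrightarrow> P g \<Longrightarrow> P (f * g)"
  shows "P f"
proof -
  have one: "P 1" using assms(1)[of 1] by simp
  have pow: "P (g ^ k)" if "P g" for g :: "('n, 'a) mpoly" and k
    by (induction k) (auto simp: one assms(4) that)
  have pr: "P (prod h A)" if "\<And>x. x \<in> A \<Longrightarrow> P (h x)" for A :: "'n set" and h :: "'n \<Rightarrow> ('n, 'a) mpoly"
    using that by (induction A rule: infinite_finite_induct) (auto simp: one assms(4))
  have single: "P (single m a)" for m and a :: 'a
    unfolding single_conv_Const_Var by (intro assms(4) assms(1) pr pow assms(2))
  have *: "P (sum h A)" if "\<And>x. x \<in> A \<Longrightarrow> P (h x)" "finite A"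
    for A :: "('n \<Rightarrow>\<^sub>0 nat) set" and h :: "('n \<Rightarrow>\<^sub>0 nat) \<Rightarrow> ('n, 'a) mpoly"
    using that(2,1) assms(1)[of 0] by (induction A rule: finite_induct) (auto simp: assms(3))
  then show ?thesis
    by (subst poly_mapping_sum_singles) (rule *, auto intro: single)
qed


lemma total_degree_le_iff:
  "total_degree f \<le> d \<longleftrightarrow> (\<forall>m\<in>keys f. exponent_sum m \<le> d)"
  by (auto simp: total_degree_def exponent_sum_def)

lemma total_degree_mult_le: "total_degree (f * g) \<le> total_degree f + total_degree g"
  unfolding total_degree_le_iff
proof
  fix m assume "m \<in> keys (f * g)"
  then obtain a b where "a \<in> keys f" "b \<in> keys g" "m = a + b"
    using keys_mult[of f g] by auto
  moreover from this have "exponent_sum a \<le> total_degree f" "exponent_sum b \<le> total_degree g"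
    using total_degree_le_iff by blast+
  ultimately show "exponent_sum m \<le> total_degree f + total_degree g"
    by (simp add: exponent_sum_add)
qed

lemma total_degree_add_le:
  "total_degree f \<le> d \<Longrightarrow> total_degree g \<le> d \<Longrightarrow> total_degree (f + g) \<le> d"
  unfolding total_degree_le_iff using keys_add[of f g] by blast

lemma total_degree_Const [simp]: "total_degree (Const a) = 0"
  using total_degree_le_iff[of "Const a" 0] by (auto simp: Const_def split: if_splits)

lemma total_degree_Var_le: "total_degree (Var j) \<le> 1"
  by (auto simp: total_degree_le_iff Var_def)

lemma total_degree_sum_le:
  "(\<And>x. x \<in> A \<Longrightarrow> total_degree (h x) \<le> d) \<Longrightarrow> total_degree (sum h A) \<le> d"
proof (induction A rule: infinite_finite_induct)
  case (insert x F)
  then show ?case by (simp add: total_degree_add_le)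
qed (auto simp: total_degree_def)

lemma total_degree_uminus [simp]: "total_degree (- f) = total_degree f"
  by (simp add: total_degree_def keys_minus)

lemma total_degree_diff_le:
  "total_degree f \<le> d \<Longrightarrow> total_degree g \<le> d \<Longrightarrow> total_degree (f - g) \<le> d"
  using total_degree_add_le[of f d "- g"] by simp

definition homogeneous :: "nat \<Rightarrow> ('n::finite, 'a::comm_ring_1) mpoly \<Rightarrow> bool" where
  "homogeneous d f \<longleftrightarrow> (\<forall>m\<in>keys f. exponent_sum m = d)"

lemma homogeneous_sum:
  "(\<And>x. x \<in> A \<Longrightarrow> homogeneous d (h x)) \<Longrightarrow> homogeneous d (sum h A)"
proof (induction A rule: infinite_finite_induct)
  case (insert x F)
  then show ?case using keys_add[of "h x" "sum h F"] by (auto simp: homogeneous_def)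
qed (auto simp: homogeneous_def)

lemma homogeneous_mult:
  "homogeneous d f \<Longrightarrow> homogeneous e g \<Longrightarrow> homogeneous (d + e) (f * g)"
  using keys_mult[of f g] by (fastforce simp: homogeneous_def exponent_sum_add)

lemma homogeneous_power: "homogeneous d f \<Longrightarrow> homogeneous (d * n) (f ^ n)"
proof (induction n)
  case 0
  show ?case by (simp add: homogeneous_def)
next
  case (Suc n)
  then show ?case using homogeneous_mult[of d f "d * n" "f ^ n"] by simp
qed

lemma homogeneous_single: "homogeneous (exponent_sum m) (single m a)"
  by (simp add: homogeneous_def)

lemma homogeneous_Var: "homogeneous 1 (Var j)"
  using homogeneous_single[of "single j 1"] by (simp add: Var_def)

lemma homogeneous_Const: "homogeneous 0 (Const a)"
  using homogeneous_single[of 0] by (simp add: Const_def)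


text \<open>
  The formal derivative computes the analytic derivative along a coordinate line, so that Jacobian
  entries can be found with the usual calculus rules.
\<close>

lemma partial_deriv_has_field_derivative:
  fixes f :: "('n::finite, complex) mpoly"
  shows "((\<lambda>t. poly_eval (p + t *s axis j 1) f) has_field_derivative
           poly_eval p (partial_deriv j f)) (at 0)"
proof -
  let ?e = "\<lambda>m. lookup m j"
  let ?R = "\<lambda>m. \<Prod>i\<in>UNIV - {j}. (p $ i) ^ lookup m i"
  have split: "monomial_value q m = (q $ j) ^ ?e m * (\<Prod>i\<in>UNIV - {j}. (q $ i) ^ lookup m i)"
    for q :: "complex ^ 'n" and m
    unfolding monomial_value_def by (rule prod.remove) auto
  have line: "monomial_value (p + t *s axis j 1) m = (p $ j + t) ^ ?e m * ?R m" for t m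
  proof -
    have "(\<Prod>i\<in>UNIV - {j}. ((p + t *s axis j 1) $ i) ^ lookup m i) = ?R m"
      by (rule prod.cong) (auto simp: axis_def)
    moreover have "(p + t *s axis j 1) $ j = p $ j + t" by (simp add: axis_def)
    ultimately show ?thesis by (simp add: split[of "p + t *s axis j 1"])
  qed
  have d: "of_nat (?e m) * monomial_value p (m - single j 1) =
      of_nat (?e m) * ((p $ j) ^ (?e m - 1) * ?R m)" for m
  proof -
    have "(\<Prod>i\<in>UNIV - {j}. (p $ i) ^ lookup (m - single j 1) i) = ?R m"
      by (rule prod.cong) (auto simp: lookup_minus lookup_single when_def)
    then show ?thesis by (simp add: split[of p] lookup_minus)
  qed
  have "poly_eval p (partial_deriv j f) =
      (\<Sum>m\<in>keys f. lookup f m * (of_nat (?e m) * ((p $ j) ^ (?e m - 1) * ?R m)))"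
    unfolding partial_deriv_def poly_eval_sum poly_eval_single
    by (intro sum.cong refl) (simp only: d[symmetric] ac_simps)
  moreover have pow: "((\<lambda>t. (p $ j + t) ^ n) has_field_derivative of_nat n * (p $ j) ^ (n - 1)) (at 0)" for n
    using DERIV_power[OF DERIV_add[OF DERIV_const[of "p $ j"] DERIV_ident], where n = n and x = 0 and s = UNIV]
    by simp
  moreover have "((\<lambda>t. \<Sum>m\<in>keys f. lookup f m * ((p $ j + t) ^ ?e m * ?R m))
     has_field_derivative (\<Sum>m\<in>keys f. lookup f m *
       (of_nat (?e m) * ((p $ j) ^ (?e m - 1) * ?R m)))) (at 0)"
    unfolding mult.assoc[symmetric, of "of_nat _"]
    by (intro DERIV_sum DERIV_cmult DERIV_cmult_right pow)
  ultimately show ?thesis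
    by (simp only: poly_eval_superset[OF finite_keys order_refl] line)
qed

lemma poly_eval_partial_deriv_eqI:
  fixes f :: "('n::finite, complex) mpoly"
  assumes "((\<lambda>t. poly_eval (p + t *s axis j 1) f) has_field_derivative D) (at 0)"
  shows "poly_eval p (partial_deriv j f) = D"
  using DERIV_unique[OF partial_deriv_has_field_derivative assms] .


section \<open>Ideals that are determined by their zeros\<close>

lemma ideal_generated_base: "f \<in> S \<Longrightarrow> f \<in> ideal_generated S"
  unfolding ideal_generated_def by (rule module.span_base[OF module_times])

lemma ideal_generated_0: "0 \<in> ideal_generated S"
  unfolding ideal_generated_def by (rule module.span_zero[OF module_times])

lemma ideal_generated_add:
  "f \<in> ideal_generated S \<Longrightarrow> g \<in> ideal_generated S \<Longrightarrow> f + g \<in> ideal_generated S"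
  unfolding ideal_generated_def by (rule module.span_add[OF module_times])

lemma ideal_generated_diff:
  "f \<in> ideal_generated S \<Longrightarrow> g \<in> ideal_generated S \<Longrightarrow> f - g \<in> ideal_generated S"
  unfolding ideal_generated_def by (rule module.span_diff[OF module_times])

lemma ideal_generated_mult: "f \<in> ideal_generated S \<Longrightarrow> r * f \<in> ideal_generated S"
  unfolding ideal_generated_def by (rule module.span_scale[OF module_times])

lemma ideal_generated_sum:
  "(\<And>x. x \<in> A \<Longrightarrow> h x \<in> ideal_generated S) \<Longrightarrow> sum h A \<in> ideal_generated S"
  unfolding ideal_generated_def by (rule module.span_sum[OF module_times])

lemma ideal_generated_induct [consumes 1, case_names zero add mult]:
  assumes "f \<in> ideal_generated S"
    and "P 0" "\<And>f g. P f \<Longrightarrow> P g \<Longrightarrow> P (f + g)" "\<And>r f. f \<in> S \<Longrightarrow> P (r * f)"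
  shows "P f"
  using assms(1) unfolding ideal_generated_def
  by (rule module.span_induct_alt[OF module_times]) (use assms in \<open>auto\<close>)

lemma zero_set_ideal_generated: "zero_set (ideal_generated S) = zero_set S"
proof
  show "zero_set (ideal_generated S) \<subseteq> zero_set S"
    using ideal_generated_base by (auto simp: zero_set_def)
  have "poly_eval p f = 0" if "p \<in> zero_set S" "f \<in> ideal_generated S" for p f
    using that(2)
    by (induction rule: ideal_generated_induct) (use that(1) in \<open>auto simp: zero_set_def\<close>)
  then show "zero_set S \<subseteq> zero_set (ideal_generated S)"
    by (auto simp: zero_set_def)
qed

text \<open>
  This is Lagrange interpolation at the nodes \<open>W\<close>, read in an arbitrary polynomial \<open>t\<close>. The
  summands become orthogonal idempotents modulo the product of all \<open>t - r\<close>.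
\<close>

lemma lagrange_partition_of_unity:
  fixes t :: "('n::finite, 'a::field) mpoly"
  assumes "finite W" "W \<noteq> {}"
  shows "\<exists>k. (\<Sum>r\<in>W. Const (k r) * (\<Prod>s\<in>W - {r}. t - Const s)) = 1"
  using assms
proof (induction W rule: finite_ne_induct)
  case (singleton r)
  show ?case by (rule exI[of _ "\<lambda>_. 1"]) simp
next
  case (insert r0 W)
  then obtain k where k: "(\<Sum>r\<in>W. Const (k r) * (\<Prod>s\<in>W - {r}. t - Const s)) = 1" by blast
  let ?W = "insert r0 W"
  let ?P = "\<lambda>r. \<Prod>s\<in>?W - {r}. t - Const s"
  \<comment> \<open>The difference of two linear factors is a constant, which expresses a product over \<open>W - {r}\<close>
     by the two products over \<open>?W - {r}\<close> and \<open>?W - {r0}\<close>.\<close>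
  have step: "Const (k r) * (\<Prod>s\<in>W - {r}. t - Const s) =
      Const (k r / (r - r0)) * ?P r - Const (k r / (r - r0)) * ?P r0" if r: "r \<in> W" for r
  proof -
    let ?Q = "\<Prod>s\<in>W - {r}. t - Const s"
    have ne: "r \<noteq> r0" using r insert by auto
    have 1: "?P r = (t - Const r0) * ?Q"
      using ne insert r by (subst insert_Diff_if) auto
    have "?P r0 = (\<Prod>s\<in>W. t - Const s)" using insert by simp
    also have "\<dots> = (t - Const r) * ?Q" using r insert by (intro prod.remove) auto
    finally have 2: "?P r0 = (t - Const r) * ?Q" .
    have "Const (k r / (r - r0)) * ?P r - Const (k r / (r - r0)) * ?P r0
        = Const (k r / (r - r0)) * (Const r - Const r0) * ?Q"
      unfolding 1 2 by (simp add: algebra_simps)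
    also have "Const (k r / (r - r0)) * (Const r - Const r0) = (Const (k r) :: ('n, 'a) mpoly)"
      using ne by (simp flip: Const_diff Const_mult)
    finally show ?thesis by simp
  qed
  define k' where "k' = (\<lambda>r. if r = r0 then - (\<Sum>r\<in>W. k r / (r - r0)) else k r / (r - r0))"
  have W: "(\<Sum>r\<in>W. Const (k' r) * ?P r) = (\<Sum>r\<in>W. Const (k r / (r - r0)) * ?P r)"
    using insert by (intro sum.cong) (auto simp: k'_def)
  have "(\<Sum>r\<in>?W. Const (k' r) * ?P r) = Const (k' r0) * ?P r0 + (\<Sum>r\<in>W. Const (k' r) * ?P r)"
    using insert by (intro sum.insert) auto
  also have "\<dots> = (\<Sum>r\<in>W. Const (k r / (r - r0)) * ?P r - Const (k r / (r - r0)) * ?P r0)"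
    unfolding W by (simp add: k'_def Const_uminus Const_sum sum_subtractf sum_distrib_right)
  also have "\<dots> = (\<Sum>r\<in>W. Const (k r) * (\<Prod>s\<in>W - {r}. t - Const s))"
    by (intro sum.cong refl step[symmetric])
  finally show ?case unfolding k by blast
qed

text \<open>
  Suppose that each member of a system of polynomials \<open>t b\<close> takes, modulo the ideal, finitely many
  values in \<open>W\<close>, without multiplicity, and that fixing all these values fixes a point. The products
  of the Lagrange idempotents of the \<open>t b\<close> then cut the quotient ring into pieces, on each of which
  every polynomial \<open>f\<close> is the constant \<open>f(p)\<close>. A piece survives only if \<open>p\<close> is a zero of the ideal,
  so a polynomial that vanishes at all zeros vanishes on every piece.
\<close>

lemma vanishing_on_zero_set_imp_in_ideal:
  fixes t :: "'b \<Rightarrow> ('n::finite, 'a::field) mpoly" and S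
  defines "J \<equiv> ideal_generated S"
  assumes B: "finite B" and W: "finite W" "W \<noteq> {}"
    and split: "\<And>b. b \<in> B \<Longrightarrow> (\<Prod>r\<in>W. t b - Const r) \<in> J"
    and separating: "\<And>g. g \<in> B \<rightarrow>\<^sub>E W \<Longrightarrow>
          \<exists>p. \<forall>j. Var j - Const (p $ j) \<in> ideal_generated ((\<lambda>b. t b - Const (g b)) ` B)"
    and f: "\<And>p. p \<in> zero_set J \<Longrightarrow> poly_eval p f = 0"
  shows "f \<in> J"
proof -
  have "\<forall>b. \<exists>k. (\<Sum>r\<in>W. Const (k r) * (\<Prod>s\<in>W - {r}. t b - Const s)) = 1"
    using lagrange_partition_of_unity[OF W] by blast
  from choice[OF this] obtain k
    where k: "\<And>b. (\<Sum>r\<in>W. Const (k b r) * (\<Prod>s\<in>W - {r}. t b - Const s)) = 1"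
    by blast
  define e where "e b r = Const (k b r) * (\<Prod>s\<in>W - {r}. t b - Const s)" for b r
  define E where "E g = (\<Prod>b\<in>B. e b (g b))" for g
  have "(1 :: ('n, 'a) mpoly) = (\<Prod>b\<in>B. \<Sum>r\<in>W. e b r)"
    by (simp add: e_def k)
  also have "\<dots> = (\<Sum>g\<in>B \<rightarrow>\<^sub>E W. E g)"
    unfolding E_def using B W by (intro prod_sum_PiE) auto
  finally have unity: "(\<Sum>g\<in>B \<rightarrow>\<^sub>E W. E g) = 1" ..
  have piece: "E g * f \<in> J" if g: "g \<in> B \<rightarrow>\<^sub>E W" for g
  proof -
    have Et: "E g * (t b - Const (g b)) \<in> J" if b: "b \<in> B" for b
    proof -
      have "E g * (t b - Const (g b)) =
          (\<Prod>b\<in>B - {b}. e b (g b)) * Const (k b (g b)) *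
          ((t b - Const (g b)) * (\<Prod>s\<in>W - {g b}. t b - Const s))"
        unfolding E_def prod.remove[OF B b] by (simp add: e_def mult_ac)
      also have "(t b - Const (g b)) * (\<Prod>s\<in>W - {g b}. t b - Const s) = (\<Prod>r\<in>W. t b - Const r)"
        using g b W by (intro prod.remove[symmetric]) auto
      finally show ?thesis unfolding J_def using split[OF b, unfolded J_def]
        by (simp add: ideal_generated_mult)
    qed
    have E: "E g * h \<in> J" if "h \<in> ideal_generated ((\<lambda>b. t b - Const (g b)) ` B)" for h
      using that
    proof (induction rule: ideal_generated_induct)
      case (mult r f)
      then obtain b where "b \<in> B" "f = t b - Const (g b)" by auto
      then have "r * (E g * f) \<in> J" using Et unfolding J_def by (auto intro: ideal_generated_mult)
      then show ?case by (simp add: mult_ac)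
    next
      case zero
      then show ?case by (simp add: J_def ideal_generated_0)
    next
      case (add f g)
      then show ?case unfolding J_def distrib_left by (rule ideal_generated_add)
    qed
    \<comment> \<open>On this piece every polynomial is congruent to its value at the point \<open>p\<close> fixed by \<open>g\<close>.\<close>
    obtain p where p: "\<And>j. Var j - Const (p $ j) \<in> ideal_generated ((\<lambda>b. t b - Const (g b)) ` B)"
      using separating[OF g] by blast
    have const: "E g * (h - Const (poly_eval p h)) \<in> J" for h
    proof (induction h rule: mpoly_induct)
      case (Const a)
      then show ?case by (simp add: J_def ideal_generated_0)
    next
      case (Var j)
      then show ?case using E[OF p[of j]] by simp
    next
      case (add f h)
      have "E g * (f + h - Const (poly_eval p (f + h))) =
          E g * (f - Const (poly_eval p f)) + E g * (h - Const (poly_eval p h))"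
        by (simp add: Const_add algebra_simps)
      then show ?case using add unfolding J_def by (simp only: ideal_generated_add)
    next
      case (mult f h)
      have "E g * (f * h - Const (poly_eval p (f * h))) =
          h * (E g * (f - Const (poly_eval p f))) +
          Const (poly_eval p f) * (E g * (h - Const (poly_eval p h)))"
        by (simp add: Const_mult algebra_simps)
      then show ?case using mult unfolding J_def
        by (simp only: ideal_generated_add ideal_generated_mult)
    qed
    show ?thesis
    proof (cases "p \<in> zero_set J")
      case True
      then show ?thesis using const[of f] f by simp
    next
      case False
      then obtain h where h: "h \<in> J" "poly_eval p h \<noteq> 0" by (auto simp: zero_set_def)
      have "E g * h - E g * (h - Const (poly_eval p h)) \<in> J"
        using const[of h] h(1) unfolding J_def
        by (intro ideal_generated_diff[OF ideal_generated_mult])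
      also have "E g * h - E g * (h - Const (poly_eval p h)) = E g * Const (poly_eval p h)"
        by (simp add: right_diff_distrib)
      finally have "(f * Const (inverse (poly_eval p h))) * (E g * Const (poly_eval p h)) \<in> J"
        unfolding J_def by (rule ideal_generated_mult)
      moreover have "Const (inverse (poly_eval p h)) * Const (poly_eval p h) = (1 :: ('n, 'a) mpoly)"
        using h(2) by (simp flip: Const_mult)
      then have "(f * Const (inverse (poly_eval p h))) * (E g * Const (poly_eval p h)) = E g * f"
        by (simp add: mult_ac)
      ultimately show ?thesis by simp
    qed
  qed
  have "(\<Sum>g\<in>B \<rightarrow>\<^sub>E W. E g * f) \<in> J"
    using piece unfolding J_def by (rule ideal_generated_sum)
  then show ?thesis by (simp flip: sum_distrib_right add: unity)
qed

lemma vanishing_ideal_is_radical: "is_radical (vanishing_ideal X :: ('n::finite, 'a::field) mpoly set)"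
  by (auto simp: is_radical_def vanishing_ideal_def)


section \<open>The Golay code as a family of sets\<close>

lemma card_sym_diff:
  assumes "finite A" "finite B"
  shows "card (sym_diff A B) + 2 * card (A \<inter> B) = card A + card B"
proof -
  have "card (sym_diff A B) = card (A - B) + card (B - A)"
    using assms by (intro card_Un_disjoint) auto
  moreover have "card A = card (A - B) + card (A \<inter> B)"
    using assms card_Int_Diff[of A B] by simp
  moreover have "card B = card (B - A) + card (A \<inter> B)"
    using assms card_Int_Diff[of B A] by (simp add: Int_commute)
  ultimately show ?thesis by simp
qed

text \<open>Toggling a fixed point exchanges the subsets of odd and of even size.\<close>

lemma card_odd_subsets:
  fixes x :: "'a::finite"
  shows "2 * card {U :: 'a set. odd (card U)} = 2 ^ CARD('a)"
proof -
  let ?t = "\<lambda>U. sym_diff U {x}"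
  have invol: "?t (?t U) = U" for U by auto
  have par: "odd (card (?t U)) \<longleftrightarrow> even (card U)" for U
  proof -
    have "card (?t U) + 2 * card (U \<inter> {x}) = card U + 1" using card_sym_diff[of U "{x}"] by simp
    then show ?thesis by presburger
  qed
  have "bij_betw ?t {U. odd (card U)} {U. even (card U)}"
    by (rule bij_betw_byWitness[where f' = ?t]) (use invol par in \<open>auto simp: image_subset_iff\<close>)
  then have eq: "card {U :: 'a set. odd (card U)} = card {U :: 'a set. even (card U)}"
    by (rule bij_betw_same_card)
  have "card (UNIV :: 'a set set) = card ({U :: 'a set. odd (card U)} \<union> {U. even (card U)})"
    by (rule arg_cong[of _ _ card]) auto
  also have "\<dots> = card {U :: 'a set. odd (card U)} + card {U :: 'a set. even (card U)}"
    by (rule card_Un_disjoint) auto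
  finally show ?thesis using eq by (simp add: card_UNIV_set)
qed

text \<open>
  These properties of the supports of the codewords are all that is used about the Golay code. The
  duality axiom quantifies over octads alone, because among the codewords it is the octads for which
  the shortest vectors supply congruences.
\<close>

locale golay_sets =
  fixes D :: "24 set set"
  assumes sym_diff_closed: "S \<in> D \<Longrightarrow> T \<in> D \<Longrightarrow> sym_diff S T \<in> D"
    and doubly_even: "S \<in> D \<Longrightarrow> 4 dvd card S"
    and card_neq_4: "S \<in> D \<Longrightarrow> card S \<noteq> 4"
    and dual: "(\<And>S. S \<in> D \<Longrightarrow> card S = 8 \<Longrightarrow> even (card (S \<inter> U))) \<Longrightarrow> U \<in> D"
    and card_code: "card D = 4096"
begin

definition octads :: "24 set set" where
  "octads = {S \<in> D. card S = 8}"

lemma even_card_Int: "S \<in> D \<Longrightarrow> T \<in> D \<Longrightarrow> even (card (S \<inter> T))"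
proof -
  assume "S \<in> D" "T \<in> D"
  then have "4 dvd card S" "4 dvd card T" "4 dvd card (sym_diff S T)"
    using doubly_even sym_diff_closed by auto
  then show "even (card (S \<inter> T))" using card_sym_diff[of S T] by simp presburger
qed

lemma empty_in: "{} \<in> D" by (rule dual) simp

lemma UNIV_in: "UNIV \<in> D" by (rule dual) simp

lemma card_less_8_imp_empty: "S \<in> D \<Longrightarrow> card S < 8 \<Longrightarrow> S = {}"
proof -
  assume "S \<in> D" "card S < 8"
  then have "4 dvd card S" "card S \<noteq> 4" "card S < 8" using doubly_even card_neq_4 by auto
  then have "card S = 0" by presburger
  then show "S = {}" by simp
qed

text \<open>
  Sets of size 1 and 3 lie in different cosets of the code. There are \<open>24 + 2024 = 2048\<close> of them,
  which accounts for all \<open>2 ^ 23 = 4096 * 2048\<close> sets of odd size, so every set of odd size is a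
  codeword plus such a small set.
\<close>

lemma odd_set_decomposition:
  assumes "odd (card U)"
  shows "\<exists>t. sym_diff U t \<in> D \<and> (card t = 1 \<or> card t = 3)"
proof -
  define T where "T = {t :: 24 set. card t = 1} \<union> {t. card t = 3}"
  have "card {t :: 24 set. card t = k} = 24 choose k" for k
    using n_subsets[of "UNIV :: 24 set" k] by simp
  then have "card T = 2048"
    unfolding T_def by (subst card_Un_disjoint) (auto simp: numeral_eq_Suc)
  let ?f = "\<lambda>(S, t). sym_diff S t"
  have small: "card t \<le> 3" if "t \<in> T" for t using that by (auto simp: T_def)
  have "inj_on ?f (D \<times> T)"
  proof (rule inj_onI, clarify)
    fix S t S' t'
    assume *: "S \<in> D" "t \<in> T" "S' \<in> D" "t' \<in> T" "sym_diff S t = sym_diff S' t'"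
    have "sym_diff S S' = sym_diff t t'" using *(5) by blast
    moreover have "card (sym_diff t t') \<le> card t + card t'"
      using card_sym_diff[of t t'] by simp
    ultimately have "sym_diff S S' = {}" using sym_diff_closed[OF *(1,3)] small[OF *(2)] small[OF *(4)]
      by (intro card_less_8_imp_empty) auto
    then show "S = S' \<and> t = t'" using *(5) by blast
  qed
  then have "card (?f ` (D \<times> T)) = 4096 * 2048"
    by (simp add: card_image card_cartesian_product card_code \<open>card T = 2048\<close>)
  moreover have "card {U :: 24 set. odd (card U)} = 4096 * 2048"
    using card_odd_subsets[where 'a = 24] by simp
  moreover have "?f ` (D \<times> T) \<subseteq> {U. odd (card U)}"
  proof clarify
    fix S t assume *: "S \<in> D" "t \<in> T" "even (card (sym_diff S t))"
    then have "odd (card t)" by (auto simp: T_def)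
    then show False using card_sym_diff[of S t] doubly_even[OF *(1)] *(3) by simp presburger
  qed
  ultimately have "?f ` (D \<times> T) = {U. odd (card U)}"
    by (intro card_subset_eq) auto
  then have "U \<in> ?f ` (D \<times> T)" using assms by simp
  then obtain S t where *: "S \<in> D" "t \<in> T" "U = sym_diff S t" by force
  then have "sym_diff U t = S" by auto
  then have "sym_diff U t \<in> D" using *(1) by simp
  then show ?thesis using *(2) unfolding T_def by blast
qed

lemma octads_meet_in_4:
  assumes "P \<in> octads" "Q \<in> octads" "P \<noteq> Q"
  shows "card (P \<inter> Q) \<le> 4"
proof (rule ccontr)
  assume "\<not> card (P \<inter> Q) \<le> 4"
  then have "sym_diff P Q = {}"
    using assms card_sym_diff[of P Q] sym_diff_closed[of P Q]
    by (intro card_less_8_imp_empty) (auto simp: octads_def)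
  then show False using assms(3) by blast
qed

text \<open>
  In the decomposition of a 5-set as a codeword plus a set \<open>t\<close>, the codeword has weight 8 only if \<open>t\<close>
  consists of three further points, and every other weight is excluded.
\<close>

lemma octad_through_5:
  assumes "card A = 5"
  shows "\<exists>!Q. Q \<in> octads \<and> A \<subseteq> Q"
proof -
  obtain t where t: "sym_diff A t \<in> D" "card t = 1 \<or> card t = 3"
    using odd_set_decomposition[of A] assms by auto
  have c: "card (sym_diff A t) + 2 * card (A \<inter> t) = 5 + card t"
    using card_sym_diff[of A t] assms by simp
  moreover have "4 dvd card (sym_diff A t)" "card (sym_diff A t) \<noteq> 4"
    using t doubly_even card_neq_4 by auto
  moreover have "card (A \<inter> t) \<le> card t" by (simp add: card_mono)
  ultimately have "card (A \<inter> t) = 0 \<and> card (sym_diff A t) = 8"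
    using t(2) by presburger
  then have "sym_diff A t \<in> octads" "A \<subseteq> sym_diff A t" using t by (auto simp: octads_def)
  moreover have "P = Q" if "P \<in> octads" "A \<subseteq> P" "Q \<in> octads" "A \<subseteq> Q" for P Q
  proof (rule ccontr)
    assume "P \<noteq> Q"
    then have "card (P \<inter> Q) \<le> 4" using octads_meet_in_4 that by blast
    moreover have "card A \<le> card (P \<inter> Q)" using that by (intro card_mono) auto
    ultimately show False using assms by simp
  qed
  ultimately show ?thesis by blast
qed

definition octads_through :: "24 set \<Rightarrow> 24 set set" where
  "octads_through A = {Q \<in> octads. A \<subseteq> Q}"

text \<open>
  Both sides count the pairs of an octad through \<open>A\<close> and one of its points outside \<open>A\<close>.
\<close>

lemma card_octads_through_step:
  assumes A: "card A < 8" and n: "\<And>x. x \<notin> A \<Longrightarrow> card (octads_through (insert x A)) = n"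
  shows "card (octads_through A) * (8 - card A) = (24 - card A) * n"
proof -
  have "(\<Sum>Q\<in>octads_through A. card {x. x \<notin> A \<and> x \<in> Q}) =
      (\<Sum>x\<in>-A. card {Q \<in> octads_through A. x \<in> Q})"
  proof -
    have "(\<Sum>Q\<in>octads_through A. card {x. x \<notin> A \<and> x \<in> Q}) =
        (\<Sum>Q\<in>octads_through A. \<Sum>x\<in>-A. if x \<in> Q then 1 else 0)"
      by (intro sum.cong refl) (simp add: sum.If_cases Int_def)
    also have "\<dots> = (\<Sum>x\<in>-A. \<Sum>Q\<in>octads_through A. if x \<in> Q then 1 else 0)"
      by (rule sum.swap)
    also have "\<dots> = (\<Sum>x\<in>-A. card {Q \<in> octads_through A. x \<in> Q})"
      by (intro sum.cong refl) (simp add: sum.If_cases Int_def)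
    finally show ?thesis .
  qed
  moreover have "card {x. x \<notin> A \<and> x \<in> Q} = 8 - card A" if "Q \<in> octads_through A" for Q
  proof -
    have "{x. x \<notin> A \<and> x \<in> Q} = Q - A" by auto
    then show ?thesis using that by (simp add: card_Diff_subset octads_through_def octads_def)
  qed
  moreover have "card {Q \<in> octads_through A. x \<in> Q} = n" if "x \<in> -A" for x
  proof -
    have "{Q \<in> octads_through A. x \<in> Q} = octads_through (insert x A)"
      by (auto simp: octads_through_def)
    then show ?thesis using n that by simp
  qed
  moreover have "card (-A) = 24 - card A" by (simp add: Compl_eq_Diff_UNIV card_Diff_subset)
  ultimately show ?thesis by simp
qed

lemma card_octads_through_5: "card A = 5 \<Longrightarrow> card (octads_through A) = 1"
  using octad_through_5[of A] by (auto simp: octads_through_def card_1_singleton_iff)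

lemma card_octads_through_4: "card A = 4 \<Longrightarrow> card (octads_through A) = 5"
  using card_octads_through_step[of A 1] by (simp add: card_octads_through_5)

lemma card_octads_through_3: "card A = 3 \<Longrightarrow> card (octads_through A) = 21"
  using card_octads_through_step[of A 5] by (simp add: card_octads_through_4)

lemma card_octads_through_2: "card A = 2 \<Longrightarrow> card (octads_through A) = 77"
  using card_octads_through_step[of A 21] by (simp add: card_octads_through_3)

lemma card_octads_through_1: "card A = 1 \<Longrightarrow> card (octads_through A) = 253"
  using card_octads_through_step[of A 77] by (simp add: card_octads_through_2)

end


subsection \<open>The row space of the generator matrix\<close>

definition neighbours :: "12 \<Rightarrow> 12 set" where
  "neighbours i = {j. {i, j} \<in> icosahedron_edges}"

lemma UNIV_12: "(UNIV :: 12 set) = {0, 1, 2, 3, 4, 5, 6, 7, 8, 9, 10, 11}"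
  by (rule card_subset_eq[symmetric]) auto

lemma neighbours_simps:
  "neighbours 0 = {1, 2, 3, 4, 5}"
  "neighbours 1 = {0, 2, 5, 6, 7}"
  "neighbours 2 = {0, 1, 3, 7, 8}"
  "neighbours 3 = {0, 2, 4, 8, 9}"
  "neighbours 4 = {0, 3, 5, 9, 10}"
  "neighbours 5 = {0, 1, 4, 6, 10}"
  "neighbours 6 = {1, 5, 7, 10, 11}"
  "neighbours 7 = {1, 2, 6, 8, 11}"
  "neighbours 8 = {2, 3, 7, 9, 11}"
  "neighbours 9 = {3, 4, 8, 10, 11}"
  "neighbours 10 = {4, 5, 6, 9, 11}"
  "neighbours 11 = {6, 7, 8, 9, 10}"
  unfolding neighbours_def icosahedron_edges_def
  by (auto simp: doubleton_eq_iff)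

lemma card_neighbours: "card (neighbours i) = 5"
proof -
  have "i \<in> {0, 1, 2, 3, 4, 5, 6, 7, 8, 9, 10, 11}" using UNIV_12 by blast
  then show ?thesis by (auto simp: neighbours_simps)
qed

lemma card_common_neighbours:
  assumes "i \<noteq> j"
  shows "card (neighbours i \<inter> neighbours j) \<in> {0, 2}"
proof -
  have "i \<in> {0, 1, 2, 3, 4, 5, 6, 7, 8, 9, 10, 11}" "j \<in> {0, 1, 2, 3, 4, 5, 6, 7, 8, 9, 10, 11}"
    using UNIV_12 by blast+
  then show ?thesis using assms
    by (elim insertE emptyE; hypsubst; simp add: neighbours_simps)
qed


(* Arithmetic on bit stays in ring form instead of turning into bit operations. *)
declare add_bit_eq_xor [simp del] mult_bit_eq_and [simp del]

text \<open>The block \<open>J - A\<close> of the generator matrix.\<close>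

definition golay_block :: "12 \<Rightarrow> 12 \<Rightarrow> bit" where
  "golay_block i j = (if j \<in> neighbours i then 0 else 1)"

definition golay_encode :: "bit ^ 12 \<Rightarrow> bit ^ (12 + 12)" where
  "golay_encode x = (\<chi> k. case k of Inl j \<Rightarrow> x $ j | Inr j \<Rightarrow> \<Sum>i\<in>UNIV. x $ i * golay_block i j)"

lemma golay_encode_Inl [simp]: "golay_encode x $ Inl j = x $ j"
  and golay_encode_Inr [simp]: "golay_encode x $ Inr j = (\<Sum>i\<in>UNIV. x $ i * golay_block i j)"
  by (simp_all add: golay_encode_def)

lemma golay_matrix_nth [simp]:
  "golay_matrix $ i $ Inl j = (if i = j then 1 else 0)"
  "golay_matrix $ i $ Inr j = golay_block i j"
  by (auto simp: golay_matrix_def mat_def golay_block_def icosahedron_adjacency_def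
      neighbours_def)

lemma golay_block_sym: "golay_block i j = golay_block j i"
  by (simp add: golay_block_def neighbours_def insert_commute)

lemma of_nat_bit_eq_0_iff: "(of_nat n :: bit) = 0 \<longleftrightarrow> even n"
proof -
  have "(of_nat n :: bit) = (if even n then 0 else 1)" by (induction n) auto
  then show ?thesis by simp
qed

lemma card_golay_block_row: "card {j. golay_block i j \<noteq> 0} = 7"
proof -
  have "{j. golay_block i j \<noteq> 0} = - neighbours i" by (auto simp: golay_block_def)
  then show ?thesis by (simp add: Compl_eq_Diff_UNIV card_Diff_subset card_neighbours)
qed

lemma card_golay_block_common:
  assumes "i \<noteq> k"
  shows "card {j. golay_block i j \<noteq> 0 \<and> golay_block k j \<noteq> 0} \<in> {2, 4}"
proof -
  let ?N = neighbours
  have "{j. golay_block i j \<noteq> 0 \<and> golay_block k j \<noteq> 0} = - (?N i \<union> ?N k)"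
    by (auto simp: golay_block_def)
  moreover have "card (?N i \<union> ?N k) + card (?N i \<inter> ?N k) = 10"
    using card_Un_Int[of "?N i" "?N k"] by (simp add: card_neighbours)
  ultimately show ?thesis using card_common_neighbours[OF assms]
    by (auto simp: Compl_eq_Diff_UNIV card_Diff_subset)
qed

lemma bit_inner_eq: "(\<Sum>k\<in>UNIV. v $ k * w $ k) = (of_nat (card {k. v $ k \<noteq> 0 \<and> w $ k \<noteq> 0}) :: bit)"
  for v w :: "bit ^ 'n::finite"
proof -
  have "(\<Sum>k\<in>UNIV. v $ k * w $ k) = (\<Sum>k\<in>UNIV. if v $ k \<noteq> 0 \<and> w $ k \<noteq> 0 then 1 else 0)"
    by (intro sum.cong) auto
  then show ?thesis by (simp add: sum.If_cases)
qed

text \<open>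
  A row of \<open>J - A\<close> has 7 ones, and two different rows share 2 or 4 of them, because two vertices of
  the icosahedron have 2 or 0 common neighbours. Hence \<open>J - A\<close> squares to the identity modulo 2.
\<close>

lemma golay_block_involution:
  "(\<Sum>j\<in>UNIV. golay_block i j * golay_block j k) = (if i = k then 1 else 0)"
proof -
  have "(\<Sum>j\<in>UNIV. golay_block i j * golay_block j k) =
      of_nat (card {j. golay_block i j \<noteq> 0 \<and> golay_block k j \<noteq> 0})"
    using bit_inner_eq[of "\<chi> j. golay_block i j" "\<chi> j. golay_block k j"]
    by (simp add: golay_block_sym[of _ k])
  then show ?thesis
    using card_golay_block_row[of i] card_golay_block_common[of i k]
    by (cases "i = k") auto
qed

lemma golay_block_twice:
  "(\<Sum>j\<in>UNIV. (\<Sum>i\<in>UNIV. x i * golay_block i j) * golay_block j k) = x k"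
proof -
  have "(\<Sum>j\<in>UNIV. (\<Sum>i\<in>UNIV. x i * golay_block i j) * golay_block j k) =
      (\<Sum>i\<in>UNIV. x i * (\<Sum>j\<in>UNIV. golay_block i j * golay_block j k))"
    by (simp add: sum_distrib_right sum_distrib_left mult.assoc) (rule sum.swap)
  also have "\<dots> = x k"
    by (simp add: golay_block_involution if_distrib[of "\<lambda>c. _ * c"] cong: if_cong)
  finally show ?thesis .
qed

lemma golay_encode_eq_sum: "golay_encode x = (\<Sum>i\<in>UNIV. x $ i *s row i golay_matrix)"
proof (rule vec_eq_iff[THEN iffD2, rule_format])
  fix k
  show "golay_encode x $ k = (\<Sum>i\<in>UNIV. x $ i *s row i golay_matrix) $ k"
    by (cases k) (simp_all add: row_def if_distrib[of "\<lambda>c. _ * c"] cong: if_cong)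
qed

lemma vec_all_sum_iff: "(\<forall>k :: 'a::finite + 'b::finite. P k) \<longleftrightarrow> (\<forall>i. P (Inl i)) \<and> (\<forall>j. P (Inr j))"
  by (metis sum.exhaust)

lemma golay_encode_add: "golay_encode (x + y) = golay_encode x + golay_encode y"
  by (simp add: vec_eq_iff vec_all_sum_iff distrib_right sum.distrib)

lemma golay_encode_axis: "golay_encode (axis i 1) = row i golay_matrix"
  by (simp add: golay_encode_eq_sum axis_def if_distrib[of "\<lambda>c. c *s _"] cong: if_cong)

lemma golay_span: "vec.span (rows golay_matrix) = range golay_encode"
proof
  have "vec.subspace (range golay_encode)"
    unfolding vec.subspace_def
  proof (intro conjI ballI allI)
    show "0 \<in> range golay_encode"
      by (rule range_eqI[of _ _ 0]) (simp add: golay_encode_eq_sum)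
  next
    fix v w assume "v \<in> range golay_encode" "w \<in> range golay_encode"
    then show "v + w \<in> range golay_encode" by (auto simp flip: golay_encode_add)
  next
    fix c v assume "v \<in> range golay_encode"
    then obtain x where "v = golay_encode x" by auto
    then have "c *s v = golay_encode (c *s x)"
      by (simp add: golay_encode_eq_sum vec.scale_sum_right)
    then show "c *s v \<in> range golay_encode" by blast
  qed
  moreover have "rows golay_matrix \<subseteq> range golay_encode"
    unfolding rows_def golay_encode_axis[symmetric] by blast
  ultimately show "vec.span (rows golay_matrix) \<subseteq> range golay_encode"
    by (rule vec.span_minimal[rotated])
  show "range golay_encode \<subseteq> vec.span (rows golay_matrix)"
  proof (rule image_subsetI)
    fix x show "golay_encode x \<in> vec.span (rows golay_matrix)"
      unfolding golay_encode_eq_sum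
      by (intro vec.span_sum vec.span_scale vec.span_base) (auto simp: rows_def)
  qed
qed

lemma codeword_support_add:
  "codeword_support (v + w) = sym_diff (codeword_support v) (codeword_support w)"
  for v w :: "bit ^ 'n"
  by (auto simp: codeword_support_def)

lemma even_card_support_Int_iff:
  "even (card (codeword_support v \<inter> codeword_support w)) \<longleftrightarrow> (\<Sum>k\<in>UNIV. v $ k * w $ k) = (0 :: bit)"
  for v w :: "bit ^ 'n::finite"
  by (simp add: bit_inner_eq of_nat_bit_eq_0_iff codeword_support_def Int_def)

lemma sum_UNIV_sum:
  "(\<Sum>k\<in>(UNIV :: ('a::finite + 'b::finite) set). h k) = (\<Sum>i\<in>UNIV. h (Inl i)) + (\<Sum>j\<in>UNIV. h (Inr j))"
  unfolding UNIV_Plus_UNIV[symmetric] by (subst sum.Plus) auto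

lemma golay_inner_row:
  "(\<Sum>k\<in>UNIV. v $ k * row i golay_matrix $ k) = v $ Inl i + (\<Sum>j\<in>UNIV. v $ Inr j * golay_block i j)"
  by (simp add: sum_UNIV_sum row_def if_distrib[of "\<lambda>c. _ * c"] cong: if_cong)

lemma golay_self_orthogonal:
  "(\<Sum>k\<in>UNIV. golay_encode x $ k * golay_encode y $ k) = 0"
proof -
  have r: "(\<Sum>k\<in>UNIV. golay_encode x $ k * row i golay_matrix $ k) = 0" for i
    unfolding golay_inner_row
    using golay_block_twice[of "\<lambda>i. x $ i" i] by (simp add: golay_block_sym[of i])
  have "(\<Sum>k\<in>UNIV. golay_encode x $ k * golay_encode y $ k) =
      (\<Sum>k\<in>UNIV. \<Sum>i\<in>UNIV. y $ i * (golay_encode x $ k * row i golay_matrix $ k))"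
    unfolding golay_encode_eq_sum[of y] by (simp add: sum_distrib_left mult_ac)
  also have "\<dots> = (\<Sum>i\<in>UNIV. y $ i * (\<Sum>k\<in>UNIV. golay_encode x $ k * row i golay_matrix $ k))"
    by (subst sum.swap) (simp add: sum_distrib_left)
  finally show ?thesis by (simp only: r) simp
qed

text \<open>
  Orthogonality to the rows says \<open>l = (J - A) r\<close> for the halves \<open>l\<close>, \<open>r\<close> of \<open>v\<close>; multiplying by
  \<open>J - A\<close> gives \<open>r = (J - A) l\<close>, so \<open>v\<close> is the encoding of \<open>l\<close>.
\<close>

lemma golay_dual:
  assumes "\<And>i. (\<Sum>k\<in>UNIV. v $ k * row i golay_matrix $ k) = 0"
  shows "v \<in> range golay_encode"
proof -
  have b: "a = b" if "a + b = 0" for a b :: bit using that by (cases a; cases b) auto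
  have l: "v $ Inl i = (\<Sum>j\<in>UNIV. v $ Inr j * golay_block j i)" for i
    using assms[of i] unfolding golay_inner_row golay_block_sym[of i] by (rule b)
  have "v = golay_encode (\<chi> i. v $ Inl i)"
    unfolding vec_eq_iff vec_all_sum_iff
    by (simp add: l golay_block_twice[of "\<lambda>j. v $ Inr j"])
  then show ?thesis by blast
qed

lemma card_support_golay_encode:
  "card (codeword_support (golay_encode x)) =
     card (codeword_support x) + card {j. (\<Sum>i\<in>UNIV. x $ i * golay_block i j) \<noteq> 0}"
proof -
  have "codeword_support (golay_encode x) =
      codeword_support x <+> {j. (\<Sum>i\<in>UNIV. x $ i * golay_block i j) \<noteq> 0}"
  proof (rule set_eqI)
    fix k show "k \<in> codeword_support (golay_encode x) \<longleftrightarrow>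
        k \<in> codeword_support x <+> {j. (\<Sum>i\<in>UNIV. x $ i * golay_block i j) \<noteq> 0}"
      by (cases k) (auto simp: codeword_support_def)
  qed
  then show ?thesis by (simp add: card_Plus)
qed

lemma sum_axis_codeword_support: "(\<Sum>i\<in>codeword_support x. axis i 1) = x" for x :: "bit ^ 'n::finite"
  by (auto simp: vec_eq_iff codeword_support_def axis_def)

lemma card_support_row: "card (codeword_support (row i golay_matrix)) = 8"
proof -
  have "codeword_support (axis i (1::bit)) = {i}" by (auto simp: codeword_support_def axis_def)
  moreover have "(\<Sum>l\<in>UNIV. axis i (1::bit) $ l * golay_block l j) = golay_block i j" for j
    by (simp add: axis_def if_distrib[of "\<lambda>c. c * _"] cong: if_cong)
  ultimately show ?thesis
    using card_support_golay_encode[of "axis i 1"] card_golay_block_row[of i]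
    by (simp add: golay_encode_axis)
qed

text \<open>
  All rows have weight 8, and adding a row changes the weight by \<open>8 - 2k\<close>, where the overlap \<open>k\<close> is
  even by self-orthogonality.
\<close>

lemma golay_doubly_even: "4 dvd card (codeword_support (golay_encode x))"
proof -
  have "4 dvd card (codeword_support (golay_encode (\<Sum>i\<in>A. axis i 1)))" if "finite A" for A :: "12 set"
    using that
  proof (induction A rule: finite_induct)
    case empty
    then show ?case by (simp add: golay_encode_eq_sum codeword_support_def)
  next
    case (insert i A)
    let ?v = "golay_encode (axis i 1)" and ?w = "golay_encode (\<Sum>i\<in>A. axis i 1)"
    have "even (card (codeword_support ?v \<inter> codeword_support ?w))"
      unfolding even_card_support_Int_iff by (rule golay_self_orthogonal)
    moreover have "card (codeword_support ?v) = 8" by (simp add: golay_encode_axis card_support_row)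
    moreover note insert.IH card_sym_diff[of "codeword_support ?v" "codeword_support ?w"]
    moreover have "golay_encode (\<Sum>i\<in>insert i A. axis i 1) = ?v + ?w"
      using insert by (simp add: golay_encode_add)
    ultimately show ?case by (simp add: codeword_support_add) presburger
  qed
  from this[of "codeword_support x"] show ?thesis unfolding sum_axis_codeword_support by simp
qed

text \<open>
  One half of a word of weight 4 would have weight at most 2. Since \<open>J - A\<close> is its own inverse, the
  two halves determine each other in the same way, and it suffices to look at sums of at most two
  rows.
\<close>

lemma golay_no_weight_4: "card (codeword_support (golay_encode x)) \<noteq> 4"
proof
  assume 4: "card (codeword_support (golay_encode x)) = 4"
  define y where "y = (\<chi> j. \<Sum>i\<in>UNIV. x $ i * golay_block i j)"
  have sy: "codeword_support y = {j. (\<Sum>i\<in>UNIV. x $ i * golay_block i j) \<noteq> 0}"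
    by (simp add: codeword_support_def y_def)
  have s: "card (codeword_support x) + card (codeword_support y) = 4"
    using 4 unfolding card_support_golay_encode sy .
  have yx: "card (codeword_support (golay_encode y)) = 4"
    unfolding card_support_golay_encode
    using s by (simp add: y_def golay_block_twice[of "\<lambda>i. x $ i"] codeword_support_def add.commute)
  have no: "card (codeword_support (golay_encode z)) \<noteq> 4" if z: "card (codeword_support z) \<le> 2" for z
  proof -
    have "card (codeword_support z) = 0 \<or> card (codeword_support z) = 1 \<or> card (codeword_support z) = 2"
      using z by arith
    then show ?thesis
    proof (elim disjE)
      assume 1: "card (codeword_support z) = 0"
      then have "z = 0" by (auto simp: codeword_support_def vec_eq_iff)
      then have "golay_encode z = 0" by (simp add: golay_encode_eq_sum)
      then show ?thesis by (simp add: codeword_support_def)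
    next
      assume 2: "card (codeword_support z) = 1"
      then obtain i where "codeword_support z = {i}" by (auto simp: card_1_singleton_iff)
      then have "z = axis i 1" using sum_axis_codeword_support[of z] by simp
      then show ?thesis by (simp add: golay_encode_axis card_support_row)
    next
      assume 3: "card (codeword_support z) = 2"
      then obtain i k where ik: "codeword_support z = {i, k}" "i \<noteq> k" by (auto simp: card_2_iff)
      then have "z = axis i 1 + axis k 1" using sum_axis_codeword_support[of z] by simp
      let ?I = "codeword_support (row i golay_matrix)" and ?K = "codeword_support (row k golay_matrix)"
      have "golay_encode z = row i golay_matrix + row k golay_matrix"
        using \<open>z = _\<close> by (simp add: golay_encode_add golay_encode_axis)
      then have "card (codeword_support (golay_encode z)) +
          2 * card (?I \<inter> ?K) = 16"
        using card_sym_diff[of "?I" "?K"]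
        by (simp add: codeword_support_add card_support_row)
      moreover have "card (?I \<inter> ?K) \<le> 4"
      proof -
        define X :: "(12 + 12) set" where "X = Inr ` {j. golay_block i j \<noteq> 0 \<and> golay_block k j \<noteq> 0}"
        have "?I \<inter> ?K \<subseteq> X"
        proof
          fix l assume "l \<in> ?I \<inter> ?K"
          then show "l \<in> X"
            using ik(2) by (cases l) (auto simp: codeword_support_def row_def X_def split: if_splits)
        qed
        then have "card (?I \<inter> ?K) \<le> card X"
          by (intro card_mono) auto
        also have "card X \<le> 4"
          using card_golay_block_common[OF ik(2)] unfolding X_def by (subst card_image) auto
        finally show ?thesis .
      qed
      ultimately show ?thesis by linarith
    qed
  qed
  show False using no[of x] no[of y] 4 yx s by linarith
qed

text \<open>Permuting the coordinates preserves all the properties in \<^locale>\<open>golay_sets\<close>.\<close>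

theorem golay_sets_of_extended_golay_code:
  assumes "extended_golay_code C"
  shows "golay_sets (codeword_support ` C)"
proof -
  obtain \<pi> :: "24 \<Rightarrow> 12 + 12" where \<pi>: "bij \<pi>"
    and C: "C = (\<lambda>w. \<chi> k. w $ \<pi> k) ` range golay_encode"
    using assms unfolding extended_golay_code_def golay_span by auto
  have supp: "codeword_support (\<chi> k. w $ \<pi> k) = \<pi> -` codeword_support w" for w :: "bit ^ (12 + 12)"
    by (auto simp: codeword_support_def)
  define D where "D = (\<lambda>w. \<pi> -` codeword_support w) ` range golay_encode"
  have CD: "codeword_support ` C = D" unfolding C D_def image_image supp ..
  have card: "card (\<pi> -` X) = card X" for X
    using \<pi> by (intro card_vimage_inj) (auto simp: bij_def inj_on_def)
  show ?thesis unfolding CD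
  proof
    fix S T assume "S \<in> D" "T \<in> D"
    then obtain x y where "S = \<pi> -` codeword_support (golay_encode x)"
      "T = \<pi> -` codeword_support (golay_encode y)" by (auto simp: D_def)
    then have "sym_diff S T = \<pi> -` codeword_support (golay_encode (x + y))"
      by (auto simp: golay_encode_add codeword_support_add)
    then show "sym_diff S T \<in> D" by (auto simp: D_def)
  next
    fix S assume "S \<in> D"
    then show "4 dvd card S" "card S \<noteq> 4"
      by (auto simp: D_def card golay_doubly_even golay_no_weight_4)
  next
    fix U assume U: "\<And>S. S \<in> D \<Longrightarrow> card S = 8 \<Longrightarrow> even (card (S \<inter> U))"
    define v :: "bit ^ (12 + 12)" where "v = (\<chi> k. if k \<in> \<pi> ` U then 1 else 0)"
    have v: "codeword_support v = \<pi> ` U" by (auto simp: v_def codeword_support_def)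
    have vU: "\<pi> -` codeword_support v = U" using \<pi> v by (simp add: bij_def inj_vimage_image_eq)
    have "(\<Sum>k\<in>UNIV. v $ k * row i golay_matrix $ k) = 0" for i
    proof -
      let ?S = "\<pi> -` codeword_support (row i golay_matrix)"
      have "?S \<in> D" unfolding D_def golay_encode_axis[symmetric] by blast
      moreover have "card ?S = 8" by (simp add: card card_support_row)
      ultimately have "even (card (?S \<inter> U))" by (rule U)
      also have "?S \<inter> U = \<pi> -` (codeword_support v \<inter> codeword_support (row i golay_matrix))"
        using vU by auto
      finally show ?thesis unfolding card even_card_support_Int_iff .
    qed
    then have "v \<in> range golay_encode" by (rule golay_dual)
    then show "U \<in> D" unfolding D_def using vU by (auto intro!: rev_image_eqI)
  next
    have "inj (\<lambda>x. \<pi> -` codeword_support (golay_encode x))"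
    proof (rule injI)
      fix x y assume "\<pi> -` codeword_support (golay_encode x) = \<pi> -` codeword_support (golay_encode y)"
      then have "codeword_support (golay_encode x) = codeword_support (golay_encode y)"
        using \<pi> by (metis bij_def surj_image_vimage_eq)
      then have eq: "golay_encode x $ k \<noteq> 0 \<longleftrightarrow> golay_encode y $ k \<noteq> 0" for k
        by (auto simp: codeword_support_def)
      have b: "a = b" if "a \<noteq> 0 \<longleftrightarrow> b \<noteq> 0" for a b :: bit using that by (cases a; cases b) auto
      have "x $ j = y $ j" for j using b[OF eq[of "Inl j"]] by simp
      then show "x = y" by (simp add: vec_eq_iff)
    qed
    then have "card D = CARD(bit ^ 12)"
      unfolding D_def image_image by (rule card_image)
    moreover have "UNIV = {0, 1 :: bit}" using bit_not_zero_iff by blast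
    then have "CARD(bit) = card {0, 1 :: bit}" by simp
    then have "CARD(bit) = 2" by (simp only:) simp
    then have "CARD(bit ^ 12) = 4096" unfolding CARD_vec by simp
    ultimately show "card D = 4096" by (simp only:)
  qed
qed


section \<open>Quintic forms under sign changes\<close>

definition odd_support :: "('n \<Rightarrow>\<^sub>0 nat) \<Rightarrow> 'n set" where
  "odd_support m = {j. odd (lookup m j)}"

text \<open>
  The group of all sign changes of coordinates acts on the terms with odd support \<open>U\<close> by the same
  character, so that \<open>odd_part f U\<close> is an isotypic component of \<open>f\<close>, here as a function.
\<close>

definition odd_part ::
  "('n::finite, 'a::comm_ring_1) mpoly \<Rightarrow> 'n set \<Rightarrow> 'a ^ 'n \<Rightarrow> 'a" where
  "odd_part f U v =
     (\<Sum>m | m \<in> keys f \<and> odd_support m = U. lookup f m * monomial_value v m)"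

definition flip_signs :: "'n set \<Rightarrow> 'a::comm_ring_1 ^ 'n \<Rightarrow> 'a ^ 'n" where
  "flip_signs S v = (\<chi> j. if j \<in> S then - v $ j else v $ j)"

lemma minus_one_power_card:
  "finite S \<Longrightarrow> (\<Prod>j\<in>S. (-1 :: 'a::comm_ring_1) ^ h j) = (-1) ^ card {j \<in> S. odd (h j)}"
proof (induction S rule: finite_induct)
  case (insert x S)
  have "{j \<in> insert x S. odd (h j)} = (if odd (h x) then insert x {j \<in> S. odd (h j)} else {j \<in> S. odd (h j)})"
    by auto
  then show ?case using insert by (cases "odd (h x)") auto
qed simp

lemma monomial_value_flip_signs:
  "monomial_value (flip_signs S v) m = (-1) ^ card (S \<inter> odd_support m) * monomial_value v m"
proof -
  have "monomial_value (flip_signs S v) m =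
      (\<Prod>j\<in>UNIV. (if j \<in> S then (-1) ^ lookup m j else 1) * (v $ j) ^ lookup m j)"
    unfolding monomial_value_def flip_signs_def
    by (intro prod.cong) (auto simp: power_minus[of "v $ _"])
  also have "\<dots> = (\<Prod>j\<in>S. (-1) ^ lookup m j) * monomial_value v m"
    by (simp add: prod.distrib prod.If_cases monomial_value_def)
  finally show ?thesis
    by (simp add: minus_one_power_card odd_support_def Int_def)
qed

lemma poly_eval_flip_signs:
  "poly_eval (flip_signs S v) f = (\<Sum>U\<in>UNIV. (-1) ^ card (S \<inter> U) * odd_part f U v)"
proof -
  have "poly_eval (flip_signs S v) f =
      (\<Sum>m\<in>keys f. (-1) ^ card (S \<inter> odd_support m) * (lookup f m * monomial_value v m))"
    by (simp add: poly_eval_superset[OF finite_keys order_refl] monomial_value_flip_signs mult_ac)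
  also have "\<dots> = (\<Sum>U\<in>UNIV. \<Sum>m | m \<in> keys f \<and> odd_support m = U.
      (-1) ^ card (S \<inter> odd_support m) * (lookup f m * monomial_value v m))"
    by (rule sum.group[symmetric]) auto
  also have "\<dots> = (\<Sum>U\<in>UNIV. (-1) ^ card (S \<inter> U) * odd_part f U v)"
    unfolding odd_part_def sum_distrib_left by (intro sum.cong refl) auto
  finally show ?thesis .
qed

lemma minus_one_power_sym_diff:
  fixes S :: "'n::finite set"
  shows "(-1 :: 'a::comm_ring_1) ^ card (S \<inter> sym_diff U T) = (-1) ^ card (S \<inter> U) * (-1) ^ card (S \<inter> T)"
proof -
  have "card (sym_diff (S \<inter> U) (S \<inter> T)) + 2 * card (S \<inter> U \<inter> (S \<inter> T)) = card (S \<inter> U) + card (S \<inter> T)"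
    by (rule card_sym_diff) auto
  moreover have "sym_diff (S \<inter> U) (S \<inter> T) = S \<inter> sym_diff U T" by auto
  ultimately have "(-1 :: 'a) ^ (card (S \<inter> sym_diff U T) + 2 * card (S \<inter> U \<inter> (S \<inter> T))) =
      (-1) ^ (card (S \<inter> U) + card (S \<inter> T))" by simp
  then show ?thesis by (simp add: power_add power_mult)
qed

text \<open>Orthogonality of the characters of a group \<open>G\<close> of sign changes.\<close>

lemma sum_minus_one_power_group:
  fixes G :: "'n::finite set set"
  assumes G: "\<And>S T. S \<in> G \<Longrightarrow> T \<in> G \<Longrightarrow> sym_diff S T \<in> G"
  shows "(\<Sum>S\<in>G. (-1) ^ card (S \<inter> U)) =
    (if \<forall>S\<in>G. even (card (S \<inter> U)) then of_nat (card G) else (0 :: 'a::{idom, ring_char_0}))"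
proof (cases "\<forall>S\<in>G. even (card (S \<inter> U))")
  case False
  then obtain S0 where S0: "S0 \<in> G" "odd (card (S0 \<inter> U))" by blast
  have invol: "sym_diff (sym_diff S S0) S0 = S" for S by auto
  have "bij_betw (\<lambda>S. sym_diff S S0) G G"
    by (rule bij_betw_byWitness[where f' = "\<lambda>S. sym_diff S S0"])
       (use invol G S0(1) in \<open>auto simp: image_subset_iff\<close>)
  then have "(\<Sum>S\<in>G. (-1 :: 'a) ^ card (S \<inter> U)) = (\<Sum>S\<in>G. (-1) ^ card (sym_diff S S0 \<inter> U))"
    by (rule sum.reindex_bij_betw[symmetric])
  also have "\<dots> = (\<Sum>S\<in>G. - ((-1) ^ card (S \<inter> U)))"
    using S0(2) minus_one_power_sym_diff[of U _ S0, where 'a = 'a]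
    by (intro sum.cong refl) (simp add: Int_commute[of U])
  finally have "(\<Sum>S\<in>G. (-1 :: 'a) ^ card (S \<inter> U)) = 0"
    by (simp add: sum_negf eq_neg_iff_add_eq_0 flip: mult_2)
  then show ?thesis unfolding if_not_P[OF False] .
qed simp

text \<open>
  If \<open>f\<close> vanishes on the orbit of \<open>v\<close> under \<open>G\<close>, pairing with a character isolates the parts of \<open>f\<close>
  that belong to it. Restricted to \<open>G\<close>, the characters of \<open>U\<close> and \<open>T\<close> coincide if and only if
  their symmetric difference meets every member of \<open>G\<close> evenly.
\<close>

lemma sum_odd_parts_eq_0:
  fixes f :: "('n::finite, 'a::{idom, ring_char_0}) mpoly"
  assumes "\<And>S T. S \<in> G \<Longrightarrow> T \<in> G \<Longrightarrow> sym_diff S T \<in> G" "G \<noteq> {}"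
    and zero: "\<And>S. S \<in> G \<Longrightarrow> poly_eval (flip_signs S v) f = 0"
  shows "(\<Sum>U | \<forall>S\<in>G. even (card (S \<inter> sym_diff U T)). odd_part f U v) = 0"
proof -
  have char: "(\<Sum>S\<in>G. (-1) ^ card (S \<inter> U)) =
      (if \<forall>S\<in>G. even (card (S \<inter> U)) then of_nat (card G) else (0 :: 'a))" for U
    by (rule sum_minus_one_power_group) (rule assms(1))
  have "0 = (\<Sum>S\<in>G. (-1) ^ card (S \<inter> T) * poly_eval (flip_signs S v) f)"
    using zero by simp
  also have "\<dots> = (\<Sum>S\<in>G. \<Sum>U\<in>UNIV. (-1) ^ card (S \<inter> sym_diff U T) * odd_part f U v)"
    unfolding poly_eval_flip_signs sum_distrib_left minus_one_power_sym_diff by (simp add: mult_ac)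
  also have "\<dots> = (\<Sum>U\<in>UNIV. (\<Sum>S\<in>G. (-1) ^ card (S \<inter> sym_diff U T)) * odd_part f U v)"
    by (subst sum.swap) (simp add: sum_distrib_right)
  also have "\<dots> = (\<Sum>U\<in>UNIV. if \<forall>S\<in>G. even (card (S \<inter> sym_diff U T))
      then of_nat (card G) * odd_part f U v else 0)"
    unfolding char
    by (simp only: if_distrib[of "\<lambda>c. c * _"] mult_zero_left)
  also have "\<dots> = of_nat (card G) * (\<Sum>U | \<forall>S\<in>G. even (card (S \<inter> sym_diff U T)). odd_part f U v)"
    by (simp add: sum.If_cases sum_distrib_left)
  finally show ?thesis using assms(2) by simp
qed


definition exponent_of_set :: "'n set \<Rightarrow> ('n::finite \<Rightarrow>\<^sub>0 nat)" where
  "exponent_of_set U = (\<Sum>j\<in>U. single j 1)"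

lemma lookup_exponent_of_set [simp]:
  "lookup (exponent_of_set U) j = (if j \<in> U then 1 else 0)"
  by (simp add: exponent_of_set_def lookup_sum lookup_single when_def)

lemma monomial_value_exponent_of_set: "monomial_value v (exponent_of_set U) = (\<Prod>j\<in>U. v $ j)"
  by (simp add: exponent_of_set_def monomial_value_sum)

lemma exponent_sum_exponent_of_set: "exponent_sum (exponent_of_set U) = card U"
  by (simp add: exponent_sum_def sum.If_cases)

lemma odd_support_add_double: "odd_support (exponent_of_set U + (n + n)) = U"
  by (auto simp: odd_support_def lookup_add)

lemma exponent_decomposition:
  "\<exists>n. m = exponent_of_set (odd_support m) + (n + n)"
proof
  show "m = exponent_of_set (odd_support m) +
      (Poly_Mapping.map (\<lambda>k. k div 2) m + Poly_Mapping.map (\<lambda>k. k div 2) m)"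
    by (rule poly_mapping_eqI)
       (auto simp: lookup_add odd_support_def Poly_Mapping.map.rep_eq when_def elim!: oddE evenE)
qed

lemma exponent_sum_SucE:
  assumes "exponent_sum n = Suc d"
  obtains j n' where "n = single j 1 + n'" "exponent_sum n' = d"
proof -
  have "n \<noteq> 0" using assms by auto
  then obtain j where j: "lookup n j \<noteq> 0"
    by (metis lookup_zero poly_mapping_eqI)
  define n' where "n' = n - single j 1"
  have n: "n = single j 1 + n'"
    using j unfolding n'_def by (intro poly_mapping_eqI) (auto simp: lookup_add lookup_minus lookup_single when_def)
  then have "exponent_sum n = 1 + exponent_sum n'"
    by (simp only: exponent_sum_add exponent_sum_single)
  then show ?thesis using that[OF n] assms by simp
qed

lemma exponent_sum_1E:
  assumes "exponent_sum n = 1"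
  obtains j where "n = single j 1"
proof -
  from assms have "exponent_sum n = Suc 0" by simp
  from exponent_sum_SucE[OF this] obtain j n' where "n = single j 1 + n'" "exponent_sum n' = 0" .
  then show ?thesis using that[of j] by (simp add: exponent_sum_eq_0_iff)
qed

lemma exponent_sum_2E:
  assumes "exponent_sum n = 2"
  obtains j l where "n = single j 1 + single l 1"
proof -
  from assms have "exponent_sum n = Suc 1" by simp
  from exponent_sum_SucE[OF this] obtain j n' where n: "n = single j 1 + n'" "exponent_sum n' = 1" .
  from exponent_sum_1E[OF n(2)] obtain l where "n' = single l 1" .
  then show ?thesis using that[of j l] n by simp
qed

text \<open>
  Different index pairs can give the same exponent vector; the weights compensate for the sizes of
  the fibres.
\<close>

lemma sum_image_eq_weighted_sum:
  fixes F :: "'b \<Rightarrow> 'a::field_char_0"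
  assumes "finite A"
  shows "(\<Sum>m\<in>h ` A. F m) = (\<Sum>a\<in>A. F (h a) / of_nat (card {a' \<in> A. h a' = h a}))"
proof -
  have "(\<Sum>a\<in>A. F (h a) / of_nat (card {a' \<in> A. h a' = h a})) =
      (\<Sum>m\<in>h ` A. \<Sum>a | a \<in> A \<and> h a = m. F (h a) / of_nat (card {a' \<in> A. h a' = h a}))"
    using assms by (rule sum.image_gen)
  also have "\<dots> = (\<Sum>m\<in>h ` A. F m)"
  proof (rule sum.cong)
    fix m assume "m \<in> h ` A"
    then have "card {a \<in> A. h a = m} \<noteq> 0" using assms by auto
    moreover have "(\<Sum>a | a \<in> A \<and> h a = m. F (h a) / of_nat (card {a' \<in> A. h a' = h a})) =
        (\<Sum>a | a \<in> A \<and> h a = m. F m / of_nat (card {a' \<in> A. h a' = m}))"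
      by (rule sum.cong) auto
    ultimately show "(\<Sum>a | a \<in> A \<and> h a = m. F (h a) / of_nat (card {a' \<in> A. h a' = h a})) = F m"
      by simp
  qed simp
  finally show ?thesis ..
qed

lemma odd_part_superset:
  assumes "finite K" "\<And>m. m \<in> K \<Longrightarrow> odd_support m = U"
    and "\<And>m. m \<in> keys f \<Longrightarrow> odd_support m = U \<Longrightarrow> m \<in> K"
  shows "odd_part f U v = (\<Sum>m\<in>K. lookup f m * monomial_value v m)"
  unfolding odd_part_def using assms
  by (intro sum.mono_neutral_left) (auto simp: in_keys_iff)

lemma odd_part_eq_0_if_coordinate_0:
  assumes "j \<in> U" "v $ j = 0"
  shows "odd_part f U v = 0"
  unfolding odd_part_def
proof (rule sum.neutral, clarify)
  fix m assume "U = odd_support m"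
  then have "v $ j ^ lookup m j = 0" using assms by (auto simp: odd_support_def elim!: oddE)
  then have "monomial_value v m = 0" unfolding monomial_value_def by (intro prod_zero) auto
  then show "lookup f m * monomial_value v m = 0" by simp
qed

lemma homogeneous_exponentE:
  assumes "homogeneous 5 f" "m \<in> keys f" "odd_support m = U"
  obtains n where "m = exponent_of_set U + (n + n)" "card U + 2 * exponent_sum n = 5"
proof -
  obtain n where n: "m = exponent_of_set U + (n + n)" using exponent_decomposition[of m] assms(3) by blast
  have "exponent_sum m = 5" using assms by (auto simp: homogeneous_def)
  moreover have "exponent_sum m = card U + 2 * exponent_sum n"
    unfolding n by (simp add: exponent_sum_add exponent_sum_exponent_of_set)
  ultimately show ?thesis using that[OF n] by simp
qed

text \<open>
  A part with odd support \<open>U\<close> is the product of the coordinates in \<open>U\<close> and a form in the squares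
  of the coordinates, of degree 0, 1 or 2 as \<open>U\<close> has 5, 3 or 1 elements.
\<close>

lemma odd_part_eq_0_if_card:
  assumes "homogeneous 5 f" "card U \<noteq> 1" "card U \<noteq> 3" "card U \<noteq> 5"
  shows "odd_part f U v = 0"
proof -
  have False if m: "m \<in> keys f" "odd_support m = U" for m
  proof -
    from homogeneous_exponentE[OF assms(1) m] obtain n
      where "m = exponent_of_set U + (n + n)" "card U + 2 * exponent_sum n = 5" .
    then show False using assms(2-4) by presburger
  qed
  then show ?thesis unfolding odd_part_def by (intro sum.neutral) auto
qed

lemma odd_part_5:
  assumes "homogeneous 5 f" "card U = 5"
  shows "odd_part f U v = lookup f (exponent_of_set U) * (\<Prod>j\<in>U. v $ j)"
proof -
  have "m = exponent_of_set U" if m: "m \<in> keys f" "odd_support m = U" for m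
  proof -
    from homogeneous_exponentE[OF assms(1) m] obtain n
      where n: "m = exponent_of_set U + (n + n)" "card U + 2 * exponent_sum n = 5" .
    then have "n = 0" using assms(2) by (simp flip: exponent_sum_eq_0_iff)
    then show ?thesis using n(1) by simp
  qed
  then have "odd_part f U v =
      (\<Sum>m\<in>{exponent_of_set U}. lookup f m * monomial_value v m)"
    using odd_support_add_double[of U 0] by (intro odd_part_superset) auto
  then show ?thesis by (simp add: monomial_value_exponent_of_set)
qed

lemma odd_part_3:
  fixes f :: "('n::finite, 'a::field_char_0) mpoly"
  assumes "homogeneous 5 f" "card U = 3"
  obtains L where "\<And>v. odd_part f U v = (\<Prod>j\<in>U. v $ j) * (\<Sum>l\<in>UNIV. L l * (v $ l)\<^sup>2)"
    and "(\<forall>l. L l = 0) \<longrightarrow> (\<forall>m. odd_support m = U \<longrightarrow> m \<notin> keys f)"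
proof -
  define h where "h l = exponent_of_set U + (single l 1 + single l (1 :: nat))" for l
  define L where "L l = lookup f (h l) / of_nat (card {l' \<in> UNIV. h l' = h l})" for l
  have sub: "m \<in> range h" if m: "m \<in> keys f" "odd_support m = U" for m
  proof -
    from homogeneous_exponentE[OF assms(1) m] obtain n
      where n: "m = exponent_of_set U + (n + n)" "card U + 2 * exponent_sum n = 5" .
    then have "exponent_sum n = 1" using assms(2) by simp
    from exponent_sum_1E[OF this] obtain l where "n = single l 1" .
    then have "m = h l" using n by (simp add: h_def)
    then show ?thesis by blast
  qed
  have "odd_part f U v = (\<Sum>m\<in>range h. lookup f m * monomial_value v m)" for v
    using sub by (intro odd_part_superset) (auto simp: h_def odd_support_add_double)
  moreover have val: "monomial_value v (h l) = (\<Prod>j\<in>U. v $ j) * (v $ l)\<^sup>2" for v l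
    by (simp add: h_def monomial_value_add monomial_value_exponent_of_set power2_eq_square)
  ultimately have "odd_part f U v = (\<Prod>j\<in>U. v $ j) * (\<Sum>l\<in>UNIV. L l * (v $ l)\<^sup>2)" for v
    unfolding sum_image_eq_weighted_sum[OF finite] val sum_distrib_left L_def
    by (simp only: times_divide_eq_left times_divide_eq_right mult_ac)
  moreover have "m \<notin> keys f" if L: "\<And>l. L l = 0" and m: "odd_support m = U" for m
  proof
    assume k: "m \<in> keys f"
    then obtain l where l: "m = h l" using sub m by blast
    have "card {l' \<in> UNIV. h l' = h l} \<noteq> 0" by auto
    then have "lookup f m = 0" using L[of l] l by (auto simp: L_def)
    then show False using k by (simp add: in_keys_iff)
  qed
  ultimately show ?thesis using that by blast
qed

lemma odd_part_1:
  fixes f :: "('n::finite, 'a::field_char_0) mpoly"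
  assumes "homogeneous 5 f"
  obtains M where "\<And>j l. M j l = M l j"
    and "\<And>v. odd_part f {k} v = v $ k * (\<Sum>j\<in>UNIV. \<Sum>l\<in>UNIV. M j l * (v $ j)\<^sup>2 * (v $ l)\<^sup>2)"
    and "(\<forall>j l. M j l = 0) \<longrightarrow> (\<forall>m. odd_support m = {k} \<longrightarrow> m \<notin> keys f)"
proof -
  define e where "e j l = single j 1 + single l (1 :: nat)" for j l :: 'n
  define h where "h p = exponent_of_set {k} + (e (fst p) (snd p) + e (fst p) (snd p))" for p
  define M where "M j l = lookup f (h (j, l)) / of_nat (card {p \<in> UNIV. h p = h (j, l)})" for j l
  have sub: "m \<in> range h" if m: "m \<in> keys f" "odd_support m = {k}" for m
  proof -
    from homogeneous_exponentE[OF assms(1) m] obtain n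
      where n: "m = exponent_of_set {k} + (n + n)" "card {k} + 2 * exponent_sum n = 5" .
    then have "exponent_sum n = 2" by simp
    from exponent_sum_2E[OF this] obtain j l where "n = e j l" unfolding e_def .
    then have "m = h (j, l)" using n by (simp add: h_def)
    then show ?thesis by blast
  qed
  have "odd_part f {k} v = (\<Sum>m\<in>range h. lookup f m * monomial_value v m)" for v
    using sub by (intro odd_part_superset) (auto simp: h_def odd_support_add_double)
  moreover have val: "monomial_value v (h p) = v $ k * ((v $ fst p)\<^sup>2 * (v $ snd p)\<^sup>2)" for v p
    by (simp add: h_def e_def monomial_value_add monomial_value_exponent_of_set power2_eq_square mult_ac)
  ultimately have "odd_part f {k} v =
      (\<Sum>p\<in>UNIV. v $ k * (M (fst p) (snd p) * (v $ fst p)\<^sup>2 * (v $ snd p)\<^sup>2))" for v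
    unfolding sum_image_eq_weighted_sum[OF finite] val M_def prod.collapse
    by (simp only: times_divide_eq_left times_divide_eq_right mult_ac)
  then have "odd_part f {k} v = v $ k * (\<Sum>j\<in>UNIV. \<Sum>l\<in>UNIV. M j l * (v $ j)\<^sup>2 * (v $ l)\<^sup>2)" for v
    by (simp add: sum.cartesian_product sum_distrib_left case_prod_unfold)
  moreover have "M j l = M l j" for j l
    by (simp add: M_def h_def e_def add.commute)
  moreover have "m \<notin> keys f" if M: "\<And>j l. M j l = 0" and m: "odd_support m = {k}" for m
  proof
    assume k: "m \<in> keys f"
    then obtain j l where l: "m = h (j, l)" using sub[OF k m] by auto
    have "card {p \<in> UNIV. h p = h (j, l)} \<noteq> 0" by auto
    then have "lookup f m = 0" using M[of j l] l by (auto simp: M_def)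
    then show False using k by (simp add: in_keys_iff)
  qed
  ultimately show ?thesis using that by blast
qed


section \<open>Systems of linear equations indexed by octads\<close>

context golay_sets
begin

lemma sum_octads_through_swap:
  fixes L :: "24 \<Rightarrow> 'a::comm_ring_1"
  shows "(\<Sum>Q\<in>octads_through A. sum L Q) = (\<Sum>l\<in>UNIV. of_nat (card (octads_through (insert l A))) * L l)"
proof -
  have "(\<Sum>Q\<in>octads_through A. sum L Q) = (\<Sum>Q\<in>octads_through A. \<Sum>l\<in>UNIV. if l \<in> Q then L l else 0)"
    by (simp add: sum.If_cases)
  also have "\<dots> = (\<Sum>l\<in>UNIV. \<Sum>Q\<in>octads_through A. if l \<in> Q then L l else 0)"
    by (rule sum.swap)
  also have "\<dots> = (\<Sum>l\<in>UNIV. of_nat (card (octads_through (insert l A))) * L l)"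
  proof (intro sum.cong refl)
    fix l
    have "{Q \<in> octads_through A. l \<in> Q} = octads_through (insert l A)"
      by (auto simp: octads_through_def)
    then show "(\<Sum>Q\<in>octads_through A. if l \<in> Q then L l else 0) = of_nat (card (octads_through (insert l A))) * L l"
      by (simp add: sum.If_cases Int_def)
  qed
  finally show ?thesis .
qed

lemma sum_indicator: "(\<Sum>l\<in>UNIV. (if l \<in> A then 1 else 0) * h l) = (\<Sum>l\<in>A. h l :: 'a::comm_ring_1)"
  for A :: "'n::finite set"
  by (simp add: if_distrib[of "\<lambda>c. c * _"] sum.If_cases cong: if_cong)

text \<open>
  Eliminating \<open>d\<close> by means of the equations \<open>oct\<close> leaves sums over octads through \<open>T\<close>, and through
  \<open>T\<close> and \<open>i\<close>, which are known from the numbers 21, 5 and 1 of octads through 3, 4 and 5 points.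
  Then \<open>outside\<close> becomes \<open>- 24 L\<^sub>i = 0\<close>, and \<open>inside\<close> says that \<open>- L\<^sub>i\<close> is the sum of \<open>L\<close> over \<open>T\<close>.
\<close>

lemma linear_octad_system:
  fixes L :: "24 \<Rightarrow> 'a::field_char_0" and d :: "24 set \<Rightarrow> 'a"
  assumes T: "card T = 3"
    and oct: "\<And>Q. Q \<in> octads_through T \<Longrightarrow> (sum L Q) + d Q = 0"
    and inside: "\<And>i. i \<in> T \<Longrightarrow> 3 * ((sum L UNIV) + 8 * L i) - (\<Sum>Q\<in>octads_through T. d Q) = 0"
    and outside: "\<And>i. i \<notin> T \<Longrightarrow> - ((sum L UNIV) + 8 * L i)
       + (\<Sum>Q\<in>octads_through T. d Q * (if i \<in> Q then 3 else - 1)) = 0"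
  shows "L i = 0"
proof -
  let ?s = "sum L UNIV" and ?t = "sum L T"
  have d: "d Q = - (sum L Q)" if "Q \<in> octads_through T" for Q
    using oct[OF that] by (simp add: eq_neg_iff_add_eq_0 add.commute)
  have sd: "(\<Sum>Q\<in>octads_through T. d Q) = - (5 * ?s + 16 * ?t)"
  proof -
    have "(\<Sum>Q\<in>octads_through T. d Q) = - (\<Sum>Q\<in>octads_through T. sum L Q)"
      by (simp add: d sum_negf)
    also have "(\<Sum>Q\<in>octads_through T. sum L Q) = (\<Sum>l\<in>UNIV. 5 * L l + (if l \<in> T then 1 else 0) * (16 * L l))"
      unfolding sum_octads_through_swap
    proof (intro sum.cong refl)
      fix l show "of_nat (card (octads_through (insert l T))) * L l = 5 * L l + (if l \<in> T then 1 else 0) * (16 * L l)"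
        using T by (cases "l \<in> T") (simp_all add: insert_absorb card_octads_through_3 card_octads_through_4)
    qed
    also have "\<dots> = 5 * ?s + 16 * ?t"
      by (simp add: sum.distrib sum_indicator flip: sum_distrib_left)
    finally show ?thesis .
  qed
  have sdi: "(\<Sum>Q\<in>octads_through (insert i T). d Q) = - (?s + 4 * (?t + L i))" if i: "i \<notin> T" for i
  proof -
    have "octads_through (insert i T) \<subseteq> octads_through T" by (auto simp: octads_through_def)
    then have "(\<Sum>Q\<in>octads_through (insert i T). d Q) = - (\<Sum>Q\<in>octads_through (insert i T). sum L Q)"
      using d by (simp add: sum_negf subset_iff)
    also have "(\<Sum>Q\<in>octads_through (insert i T). sum L Q) =
        (\<Sum>l\<in>UNIV. L l + (if l \<in> insert i T then 1 else 0) * (4 * L l))"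
      unfolding sum_octads_through_swap
    proof (intro sum.cong refl)
      fix l
      have c: "card (insert i T) = 4" using i T by simp
      show "of_nat (card (octads_through (insert l (insert i T)))) * L l =
          L l + (if l \<in> insert i T then 1 else 0) * (4 * L l)"
      proof (cases "l \<in> insert i T")
        case True
        then show ?thesis using c by (simp add: insert_absorb card_octads_through_4 del: insert_iff)
      next
        case False
        then have "card (insert l (insert i T)) = 5" using c by (simp del: insert_iff)
        then show ?thesis using False by (simp only: card_octads_through_5) simp
      qed
    qed
    also have "\<dots> = ?s + 4 * (?t + L i)"
      using i by (simp add: sum.distrib sum_indicator add.commute flip: sum_distrib_left del: insert_iff)
    finally show ?thesis .
  qed
  have out0: "L i = 0" if i: "i \<notin> T" for i
  proof -
    have "(\<Sum>Q\<in>octads_through T. d Q * (if i \<in> Q then 3 else - 1)) =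
        (\<Sum>Q\<in>octads_through T. 4 * (if i \<in> Q then d Q else 0) - d Q)"
      by (intro sum.cong) auto
    also have "\<dots> = 4 * (\<Sum>Q\<in>octads_through (insert i T). d Q) - (\<Sum>Q\<in>octads_through T. d Q)"
    proof -
      have "octads_through (insert i T) = octads_through T \<inter> {Q. i \<in> Q}" by (auto simp: octads_through_def)
      then show ?thesis by (simp add: sum_subtractf sum.If_cases flip: sum_distrib_left)
    qed
    also have "\<dots> = ?s - 16 * L i" unfolding sd sdi[OF i] by (simp add: algebra_simps)
    finally have "- (?s + 8 * L i) + (?s - 16 * L i) = 0" using outside[OF i] by simp
    then show ?thesis by (simp add: algebra_simps)
  qed
  then have st: "?s = ?t" by (intro sum.mono_neutral_right) auto
  have in0: "L i + ?t = 0" if "i \<in> T" for i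
  proof -
    have "24 * (L i + ?t) = 3 * (?s + 8 * L i) - (\<Sum>Q\<in>octads_through T. d Q)"
      unfolding sd st by (simp add: algebra_simps)
    then have "24 * (L i + ?t) = 0" using inside[OF that] by (simp only:)
    then show ?thesis unfolding mult_eq_0_iff by simp
  qed
  have "?t = (\<Sum>l\<in>T. - ?t)" using in0 by (intro sum.cong) (auto simp: eq_neg_iff_add_eq_0)
  then have "?t = - 3 * ?t" using T by simp
  then have "?t = 0" by (simp add: eq_neg_iff_add_eq_0)
  then show ?thesis using in0[of i] out0[of i] by (cases "i \<in> T") auto
qed

text \<open>
  The number of octads through \<open>A\<close>, \<open>j\<close> and \<open>l\<close> depends only on the number of different points
  outside \<open>A\<close>, so the sum of a quadratic form over the octads through \<open>A\<close> involves only the total,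
  the trace and the row sums of its matrix, besides the entries with both indices in \<open>A\<close>.
\<close>

lemma sum_quadratic_octads_through:
  fixes M :: "24 \<Rightarrow> 24 \<Rightarrow> 'a::comm_ring_1"
  assumes sym: "\<And>j l. M j l = M l j"
    and p: "of_nat (card (octads_through A)) = p"
    and q: "\<And>j. j \<notin> A \<Longrightarrow> of_nat (card (octads_through (insert j A))) = q"
    and r: "\<And>j l. j \<notin> A \<Longrightarrow> l \<notin> A \<Longrightarrow> j \<noteq> l \<Longrightarrow> of_nat (card (octads_through (insert j (insert l A)))) = r"
  shows "(\<Sum>Q\<in>octads_through A. \<Sum>j\<in>Q. \<Sum>l\<in>Q. M j l) =
      r * (\<Sum>j\<in>UNIV. sum (M j) UNIV) + 2 * (q - r) * (\<Sum>j\<in>A. sum (M j) UNIV)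
      + (p - 2 * q + r) * (\<Sum>j\<in>A. \<Sum>l\<in>A. M j l)
      + (q - r) * ((\<Sum>j\<in>UNIV. M j j) - (\<Sum>j\<in>A. M j j))"
proof -
  define x where "x j = (if j \<in> A then 1 else 0 :: 'a)" for j
  have "(\<Sum>Q\<in>octads_through A. \<Sum>j\<in>Q. \<Sum>l\<in>Q. M j l) =
      (\<Sum>Q\<in>octads_through A. \<Sum>j\<in>UNIV. \<Sum>l\<in>UNIV. if j \<in> Q \<and> l \<in> Q then M j l else 0)"
  proof (rule sum.cong[OF refl])
    fix Q :: "24 set"
    have "(\<Sum>j\<in>UNIV. \<Sum>l\<in>UNIV. if j \<in> Q \<and> l \<in> Q then M j l else 0) =
        (\<Sum>j\<in>UNIV. if j \<in> Q then \<Sum>l\<in>Q. M j l else 0)"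
      by (intro sum.cong refl) (simp add: sum.If_cases)
    then show "(\<Sum>j\<in>Q. \<Sum>l\<in>Q. M j l) = (\<Sum>j\<in>UNIV. \<Sum>l\<in>UNIV. if j \<in> Q \<and> l \<in> Q then M j l else 0)"
      by (simp add: sum.If_cases)
  qed
  also have "\<dots> = (\<Sum>j\<in>UNIV. \<Sum>l\<in>UNIV. \<Sum>Q\<in>octads_through A. if j \<in> Q \<and> l \<in> Q then M j l else 0)"
    by (subst sum.swap) (intro sum.cong refl sum.swap)
  also have "\<dots> = (\<Sum>j\<in>UNIV. \<Sum>l\<in>UNIV. r * M j l + (q - r) * (x j * M j l) + (q - r) * (x l * M j l)
      + (p - 2 * q + r) * (x j * (x l * M j l)) + (if l = j then (q - r) * (M j j - x j * M j j) else 0))"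
  proof (intro sum.cong refl)
    fix j l
    have eq: "{Q \<in> octads_through A. j \<in> Q \<and> l \<in> Q} = octads_through (insert j (insert l A))"
      by (auto simp: octads_through_def)
    have "(\<Sum>Q\<in>octads_through A. if j \<in> Q \<and> l \<in> Q then M j l else 0) =
        of_nat (card (octads_through (insert j (insert l A)))) * M j l"
      by (simp add: sum.If_cases Int_def eq)
    moreover have "of_nat (card (octads_through (insert j (insert l A)))) =
        r + (q - r) * x j + (q - r) * x l + (p - 2 * q + r) * x j * x l + (if l = j then (q - r) * (1 - x j) else 0)"
    proof (cases "j \<in> A \<or> l \<in> A \<or> j = l")
      case True
      then show ?thesis
        by (cases "j \<in> A"; cases "l \<in> A") (auto simp: x_def insert_absorb p q algebra_simps)
    next
      case False
      then show ?thesis by (auto simp: x_def r)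
    qed
    ultimately show "(\<Sum>Q\<in>octads_through A. if j \<in> Q \<and> l \<in> Q then M j l else 0) =
        r * M j l + (q - r) * (x j * M j l) + (q - r) * (x l * M j l)
        + (p - 2 * q + r) * (x j * (x l * M j l)) + (if l = j then (q - r) * (M j j - x j * M j j) else 0)"
      by (simp add: algebra_simps)
  qed
  also have "\<dots> = r * (\<Sum>j\<in>UNIV. sum (M j) UNIV) + (q - r) * (\<Sum>j\<in>UNIV. x j * (sum (M j) UNIV))
      + (q - r) * (\<Sum>j\<in>UNIV. \<Sum>l\<in>UNIV. x l * M j l)
      + (p - 2 * q + r) * (\<Sum>j\<in>UNIV. x j * (\<Sum>l\<in>UNIV. x l * M j l))
      + (q - r) * ((\<Sum>j\<in>UNIV. M j j) - (\<Sum>j\<in>UNIV. x j * M j j))"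
    by (simp add: sum.distrib sum_subtractf right_diff_distrib flip: sum_distrib_left)
  also have "(\<Sum>j\<in>UNIV. \<Sum>l\<in>UNIV. x l * M j l) = (\<Sum>j\<in>UNIV. x j * (sum (M j) UNIV))"
    by (subst sum.swap) (simp add: sum_distrib_left sym)
  finally show ?thesis
    unfolding x_def sum_indicator by (simp add: algebra_simps)
qed

text \<open>
  Summing the quadratic form \<open>M\<close> over the octads through \<open>k\<close> and one further point \<open>j\<close> shows that
  everything that depends on \<open>j\<close> alone is constant. The few constants satisfy a regular system of
  linear equations. The remaining entries \<open>M i j\<close> come from the octads through \<open>k\<close>, \<open>i\<close> and \<open>j\<close>.
\<close>

lemma quadratic_octad_system:
  fixes M :: "24 \<Rightarrow> 24 \<Rightarrow> 'a::field_char_0"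
  assumes sym: "\<And>j l. M j l = M l j"
    and pair: "\<And>j. j \<noteq> k \<Longrightarrow> M k k + 2 * M k j + M j j = 0"
    and oct: "\<And>Q. Q \<in> octads \<Longrightarrow> k \<in> Q \<Longrightarrow> (\<Sum>j\<in>Q. \<Sum>l\<in>Q. M j l) = 0"
    and full: "\<And>i. (\<Sum>j\<in>UNIV. sum (M j) UNIV) + 16 * (sum (M i) UNIV) + 64 * M i i = 0"
  shows "M i j = 0"
proof -
  define s where "s = (\<Sum>j\<in>UNIV. sum (M j) UNIV)"
  define r where "r j = (sum (M j) UNIV)" for j
  define t where "t = (\<Sum>j\<in>UNIV. M j j)"
  have zero: "(\<Sum>Q\<in>octads_through A. \<Sum>j\<in>Q. \<Sum>l\<in>Q. M j l) = 0" if "k \<in> A" for A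
    using that oct by (intro sum.neutral) (auto simp: octads_through_def)
  have full': "s + 16 * r i + 64 * M i i = 0" for i using full by (simp add: s_def r_def)
  have two: "5 * s + 32 * (r k + r j) + 16 * (t - M k k - M j j) = 0" if j: "j \<noteq> k" for j
  proof -
    let ?A = "{k, j}"
    have sum: "(\<Sum>Q\<in>octads_through ?A. \<Sum>j\<in>Q. \<Sum>l\<in>Q. M j l) = 5 * s + 2 * (21 - 5) * (\<Sum>j\<in>?A. r j)
      + (77 - 2 * 21 + 5) * (\<Sum>j\<in>?A. \<Sum>l\<in>?A. M j l) + (21 - 5) * (t - (\<Sum>j\<in>?A. M j j))"
      unfolding s_def r_def t_def
      by (rule sum_quadratic_octads_through[OF sym])
         (use j in \<open>auto simp: card_octads_through_2 card_octads_through_3 card_octads_through_4\<close>)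
    have mid: "(\<Sum>j\<in>?A. \<Sum>l\<in>?A. M j l) = 0"
      using j sym[of j k] pair[OF j] by (simp add: algebra_simps)
    show ?thesis using sum j unfolding mid zero[OF insertI1] by (simp add: algebra_simps)
  qed
  have one: "21 * s + 112 * r k + 64 * M k k + 56 * t = 0"
  proof -
    have "(\<Sum>Q\<in>octads_through {k}. \<Sum>j\<in>Q. \<Sum>l\<in>Q. M j l) = 21 * s + 2 * (77 - 21) * (\<Sum>j\<in>{k}. r j)
      + (253 - 2 * 77 + 21) * (\<Sum>j\<in>{k}. \<Sum>l\<in>{k}. M j l) + (77 - 21) * (t - (\<Sum>j\<in>{k}. M j j))"
      unfolding s_def r_def t_def
      by (rule sum_quadratic_octads_through[OF sym])
         (auto simp: card_octads_through_1 card_octads_through_2 card_octads_through_3)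
    then show ?thesis using zero[of "{k}"] by (simp add: algebra_simps)
  qed
  \<comment> \<open>Away from \<open>k\<close> the row sums, the diagonal and the entries in row \<open>k\<close> are constant.\<close>
  define \<rho> where "\<rho> = - (21 * s + 128 * r k + 64 * t - 64 * M k k) / 144"
  define \<mu> where "\<mu> = - (s + 16 * \<rho>) / 64"
  define \<nu> where "\<nu> = - (M k k + \<mu>) / 2"
  have r: "r j = \<rho>" if "j \<noteq> k" for j
  proof -
    have "144 * r j + (21 * s + 128 * r k + 64 * t - 64 * M k k) = 0"
      using two[OF that] full'[of j] by algebra
    then show ?thesis by (simp add: \<rho>_def field_simps eq_neg_iff_add_eq_0)
  qed
  have \<mu>: "M j j = \<mu>" if "j \<noteq> k" for j
    using full'[of j] r[OF that] by (simp add: \<mu>_def field_simps eq_neg_iff_add_eq_0)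
  have \<nu>: "M k j = \<nu>" if "j \<noteq> k" for j
    using pair[OF that] \<mu>[OF that] by (simp add: \<nu>_def field_simps eq_neg_iff_add_eq_0)
  have sum_k: "(\<Sum>j\<in>UNIV. h j) = h k + 23 * c" if "\<And>j. j \<noteq> k \<Longrightarrow> h j = c" for h :: "24 \<Rightarrow> 'a" and c
  proof -
    have "(\<Sum>j\<in>UNIV. h j) = h k + (\<Sum>j\<in>UNIV - {k}. h j)" by (rule sum.remove) auto
    also have "(\<Sum>j\<in>UNIV - {k}. h j) = (\<Sum>j\<in>UNIV - {k}. c)" by (rule sum.cong) (auto simp: that)
    finally show ?thesis by simp
  qed
  have s: "s = r k + 23 * \<rho>" unfolding s_def r_def[symmetric] by (rule sum_k) (rule r)
  have t: "t = M k k + 23 * \<mu>" unfolding t_def by (rule sum_k) (rule \<mu>)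
  have rk: "r k = M k k + 23 * \<nu>" unfolding r_def by (rule sum_k) (rule \<nu>)
  have \<rho>': "144 * \<rho> + (21 * s + 128 * r k + 64 * t - 64 * M k k) = 0"
  proof -
    have "144 * (- x / 144) + x = 0" for x :: 'a by simp
    then show ?thesis unfolding \<rho>_def .
  qed
  have \<mu>': "s + 16 * \<rho> + 64 * \<mu> = 0"
  proof -
    have "x + 64 * (- x / 64) = 0" for x :: 'a by simp
    then show ?thesis unfolding \<mu>_def .
  qed
  have \<nu>': "M k k + \<mu> + 2 * \<nu> = 0"
  proof -
    have "x + 2 * (- x / 2) = 0" for x :: 'a by simp
    then show ?thesis unfolding \<nu>_def .
  qed
  note eqs = s t rk \<rho>' \<mu>' \<nu>' one full'[of k]
  have s0: "s = 0" using eqs by algebra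
  have \<rho>0: "\<rho> = 0" using eqs by algebra
  have k0: "M k k = 0" using eqs by algebra
  have \<mu>0: "\<mu> = 0" using eqs by algebra
  have \<nu>0: "\<nu> = 0" using eqs by algebra
  have diag: "M j j = 0" for j using \<mu>[of j] \<mu>0 k0 by (cases "j = k") auto
  have rowk: "M k j = 0" for j using \<nu>[of j] \<nu>0 k0 by (cases "j = k") auto
  have r0: "r j = 0" for j using s s0 \<rho>0 r[of j] by (cases "j = k") auto
  show ?thesis
  proof (cases "i = k \<or> j = k \<or> i = j")
    case True
    then show ?thesis using rowk diag sym[of i j] by auto
  next
    case False
    let ?A = "{k, i, j}"
    have "(\<Sum>Q\<in>octads_through ?A. \<Sum>j\<in>Q. \<Sum>l\<in>Q. M j l) = 1 * s + 2 * (5 - 1) * (\<Sum>j\<in>?A. r j)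
      + (21 - 2 * 5 + 1) * (\<Sum>j\<in>?A. \<Sum>l\<in>?A. M j l) + (5 - 1) * (t - (\<Sum>j\<in>?A. M j j))"
      unfolding s_def r_def t_def
      by (rule sum_quadratic_octads_through[OF sym])
         (use False in \<open>auto simp: card_octads_through_3 card_octads_through_4 card_octads_through_5\<close>)
    moreover have "(\<Sum>j\<in>?A. \<Sum>l\<in>?A. M j l) = 2 * M i j"
      using False rowk diag sym[of j i] sym[of _ k] by auto
    moreover have "t = 0" by (simp add: t_def diag)
    ultimately show ?thesis using zero[of ?A] by (simp add: r0 s0 diag)
  qed
qed

end


section \<open>Quintics vanishing on the three shapes\<close>

definition char_vec :: "'n set \<Rightarrow> complex ^ 'n" where
  "char_vec A = (\<chi> j. if j \<in> A then 1 else 0)"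

definition shape3_base :: "'n \<Rightarrow> complex ^ 'n" where
  "shape3_base i = (\<chi> j. if j = i then 3 else -1)"

lemma odd_part_indicator_eq_0: "\<not> U \<subseteq> A \<Longrightarrow> odd_part f U (char_vec A) = 0"
proof -
  assume "\<not> U \<subseteq> A"
  then obtain j where "j \<in> U" "j \<notin> A" by blast
  then show ?thesis by (intro odd_part_eq_0_if_coordinate_0[of j]) (auto simp: char_vec_def)
qed

lemma prod_shape3_base:
  assumes "odd (card T)"
  shows "(\<Prod>j\<in>T. shape3_base i $ j) = (if i \<in> T then 3 else -1)"
proof (cases "i \<in> T")
  case True
  have "finite T" using assms by (metis card.infinite even_zero)
  then have "(\<Prod>j\<in>T. shape3_base i $ j) = shape3_base i $ i * (\<Prod>j\<in>T - {i}. shape3_base i $ j)"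
    using True by (rule prod.remove)
  also have "(\<Prod>j\<in>T - {i}. shape3_base i $ j) = (\<Prod>j\<in>T - {i}. -1)"
    by (intro prod.cong) (auto simp: shape3_base_def)
  finally show ?thesis using True assms \<open>finite T\<close> by (simp add: shape3_base_def)
next
  case False
  then have "(\<Prod>j\<in>T. shape3_base i $ j) = (\<Prod>j\<in>T. -1)"
    by (intro prod.cong) (auto simp: shape3_base_def)
  then show ?thesis using False assms by simp
qed

lemma sym_diff_orthogonal_Pow:
  assumes "\<forall>S\<in>Pow A. even (card (S \<inter> sym_diff U T))" "U \<subseteq> A" "T \<subseteq> A"
  shows "U = T"
proof (rule ccontr)
  assume "U \<noteq> T"
  then obtain x where x: "x \<in> sym_diff U T" by blast
  then have "{x} \<inter> sym_diff U T = {x}" by blast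
  moreover have "{x} \<in> Pow A" using x assms by blast
  ultimately show False using assms(1) by (metis card_1_singleton_iff odd_one One_nat_def)
qed

lemma sym_diff_orthogonal_even_subsets:
  assumes orth: "\<forall>S\<in>{S. S \<subseteq> A \<and> even (card S)}. even (card (S \<inter> sym_diff U T))"
    and "U \<subseteq> A" "T \<subseteq> A"
  shows "U = T \<or> U = A - T"
proof (rule ccontr)
  assume *: "\<not> (U = T \<or> U = A - T)"
  then obtain x where x: "x \<in> sym_diff U T" by blast
  have "sym_diff U T \<noteq> A" using * assms(2,3) by blast
  then obtain y where y: "y \<in> A" "y \<notin> sym_diff U T" using assms by blast
  then have "x \<noteq> y" using x by auto
  then have "{x, y} \<in> {S. S \<subseteq> A \<and> even (card S)}" using x y(1) assms by auto
  moreover have "{x, y} \<inter> sym_diff U T = {x}" using x y by auto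
  ultimately show False using orth by (metis card_1_singleton_iff odd_one One_nat_def)
qed

lemma even_card_sym_diff:
  "finite S \<Longrightarrow> finite T \<Longrightarrow> even (card S) \<Longrightarrow> even (card T) \<Longrightarrow> even (card (sym_diff S T))"
  using card_sym_diff[of S T] by presburger

context golay_sets
begin

text \<open>
  Consider the part of a quintic with odd support \<open>U\<close>. The sign changes fixing the shape of a vector
  of type 4, 2 or 3 form a group, and its characters separate these parts, up to the few coincidences
  recorded in the following four lemmas. Since \<open>U\<close> has at most five elements, coincidences come only
  from octads, split as \<open>3 + 5\<close>.
\<close>

lemma odd_part_pair:
  assumes f: "homogeneous 5 f" and "j \<noteq> k"
    and zero: "\<And>S. S \<subseteq> {k, j} \<Longrightarrow> poly_eval (flip_signs S (char_vec {k, j})) f = 0"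
  shows "odd_part f {k} (char_vec {k, j}) = 0"
proof -
  let ?A = "{k, j}"
  have "(\<Sum>U | \<forall>S\<in>Pow ?A. even (card (S \<inter> sym_diff U {k})). odd_part f U (char_vec ?A)) = 0"
    using zero by (intro sum_odd_parts_eq_0) auto
  also have "(\<Sum>U | \<forall>S\<in>Pow ?A. even (card (S \<inter> sym_diff U {k})). odd_part f U (char_vec ?A)) =
      (\<Sum>U\<in>{{k}}. odd_part f U (char_vec ?A))"
  proof (rule sum.mono_neutral_right)
    show "\<forall>U\<in>{U. \<forall>S\<in>Pow ?A. even (card (S \<inter> sym_diff U {k}))} - {{k}}.
        odd_part f U (char_vec ?A) = 0"
    proof
      fix U assume U: "U \<in> {U. \<forall>S\<in>Pow ?A. even (card (S \<inter> sym_diff U {k}))} - {{k}}"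
      then have "\<not> U \<subseteq> ?A" using sym_diff_orthogonal_Pow[of ?A U "{k}"] by blast
      then show "odd_part f U (char_vec ?A) = 0" by (rule odd_part_indicator_eq_0)
    qed
  qed auto
  finally show ?thesis by simp
qed

lemma odd_parts_octad:
  assumes f: "homogeneous 5 f" and "T \<subseteq> Q"
    and zero: "\<And>S. S \<subseteq> Q \<Longrightarrow> even (card S) \<Longrightarrow> poly_eval (flip_signs S (char_vec Q)) f = 0"
    and ne: "T \<noteq> Q - T"
    and even: "even (card Q)"
  shows "odd_part f T (char_vec Q) + odd_part f (Q - T) (char_vec Q) = 0"
proof -
  let ?G = "{S. S \<subseteq> Q \<and> even (card S)}"
  have "(\<Sum>U | \<forall>S\<in>?G. even (card (S \<inter> sym_diff U T)). odd_part f U (char_vec Q)) = 0"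
    using zero by (intro sum_odd_parts_eq_0) (auto intro!: even_card_sym_diff exI[of _ "{}"])
  also have "(\<Sum>U | \<forall>S\<in>?G. even (card (S \<inter> sym_diff U T)). odd_part f U (char_vec Q)) =
      (\<Sum>U\<in>{T, Q - T}. odd_part f U (char_vec Q))"
  proof (rule sum.mono_neutral_right)
    have "S \<inter> sym_diff (Q - T) T = S" if "S \<subseteq> Q" for S using that assms(2) by blast
    then show "{T, Q - T} \<subseteq> {U. \<forall>S\<in>?G. even (card (S \<inter> sym_diff U T))}" by simp
    show "\<forall>U\<in>{U. \<forall>S\<in>?G. even (card (S \<inter> sym_diff U T))} - {T, Q - T}.
        odd_part f U (char_vec Q) = 0"
    proof
      fix U assume U: "U \<in> {U. \<forall>S\<in>?G. even (card (S \<inter> sym_diff U T))} - {T, Q - T}"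
      then have "\<not> U \<subseteq> Q" using sym_diff_orthogonal_even_subsets[of Q U T] assms(2) by blast
      then show "odd_part f U (char_vec Q) = 0" by (rule odd_part_indicator_eq_0)
    qed
  qed auto
  finally show ?thesis using ne by simp
qed

lemma orthogonal_iff_in: "(\<forall>S\<in>D. even (card (S \<inter> X))) \<longleftrightarrow> X \<in> D"
  using even_card_Int dual by blast

lemma odd_part_shape3_single:
  fixes f :: "(24, complex) mpoly"
  assumes f: "homogeneous 5 f"
    and zero: "\<And>S. S \<in> D \<Longrightarrow> poly_eval (flip_signs S v) f = 0"
  shows "odd_part f {k} v = 0"
proof -
  have "(\<Sum>U | \<forall>S\<in>D. even (card (S \<inter> sym_diff U {k})). odd_part f U v) = 0"
    by (rule sum_odd_parts_eq_0) (use zero empty_in in \<open>auto intro: sym_diff_closed\<close>)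
  also have "(\<Sum>U | \<forall>S\<in>D. even (card (S \<inter> sym_diff U {k})). odd_part f U v) =
      (\<Sum>U\<in>{{k}}. odd_part f U v)"
    unfolding orthogonal_iff_in
  proof (rule sum.mono_neutral_right)
    show "\<forall>U\<in>{U. sym_diff U {k} \<in> D} - {{k}}. odd_part f U v = 0"
    proof (clarify, rule ccontr)
      fix U assume U: "sym_diff U {k} \<in> D" "U \<noteq> {k}" "odd_part f U v \<noteq> 0"
      then have "card U \<le> 5" using odd_part_eq_0_if_card[OF f, of U v] by linarith
      then have "card (sym_diff U {k}) < 8" using card_sym_diff[of U "{k}"] by simp
      then have "sym_diff U {k} = {}" using U(1) by (intro card_less_8_imp_empty)
      then show False using U(2) by blast
    qed
  qed (auto simp: empty_in)
  finally show ?thesis by simp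
qed

lemma odd_parts_shape3_triple:
  fixes f :: "(24, complex) mpoly"
  assumes f: "homogeneous 5 f" and T: "card T = 3"
    and zero: "\<And>S. S \<in> D \<Longrightarrow> poly_eval (flip_signs S v) f = 0"
  shows "odd_part f T v + (\<Sum>Q\<in>octads_through T. odd_part f (Q - T) v) = 0"
proof -
  let ?X = "(\<lambda>Q. Q - T) ` octads_through T"
  have "(\<Sum>U | \<forall>S\<in>D. even (card (S \<inter> sym_diff U T)). odd_part f U v) = 0"
    by (rule sum_odd_parts_eq_0) (use zero empty_in in \<open>auto intro: sym_diff_closed\<close>)
  also have "(\<Sum>U | \<forall>S\<in>D. even (card (S \<inter> sym_diff U T)). odd_part f U v) =
      (\<Sum>U\<in>insert T ?X. odd_part f U v)"
    unfolding orthogonal_iff_in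
  proof (rule sum.mono_neutral_right)
    have "sym_diff (Q - T) T = Q" if "Q \<in> octads_through T" for Q
      using that by (auto simp: octads_through_def)
    then show "insert T ?X \<subseteq> {U. sym_diff U T \<in> D}"
      by (auto simp: empty_in octads_through_def octads_def)
    show "\<forall>U\<in>{U. sym_diff U T \<in> D} - insert T ?X. odd_part f U v = 0"
    proof (rule ballI, rule ccontr)
      fix U assume "U \<in> {U. sym_diff U T \<in> D} - insert T ?X" "odd_part f U v \<noteq> 0"
      then have U: "sym_diff U T \<in> D" "U \<notin> insert T ?X" "odd_part f U v \<noteq> 0" by blast+
      then have "card U \<le> 5" using odd_part_eq_0_if_card[OF f, of U v] by linarith
      moreover have "sym_diff U T \<noteq> {}" using U(2) by blast
      then have "card (sym_diff U T) \<ge> 8" using card_less_8_imp_empty[OF U(1)] by linarith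
      moreover note card_sym_diff[OF finite finite, of U T]
      ultimately have "card (U \<inter> T) = 0 \<and> card (sym_diff U T) = 8" using T by arith
      then have "U \<inter> T = {}" "sym_diff U T \<in> octads" using U(1) by (auto simp: octads_def)
      moreover from this have "sym_diff U T = U \<union> T" by blast
      ultimately have "U \<union> T \<in> octads_through T" "U = (U \<union> T) - T" by (auto simp: octads_through_def)
      then show False using U(2) by blast
    qed
  qed auto
  also have "\<dots> = odd_part f T v + (\<Sum>U\<in>?X. odd_part f U v)"
  proof (rule sum.insert)
    show "T \<notin> ?X"
    proof
      assume "T \<in> ?X"
      then have "T = {}" by blast
      then show False using T by simp
    qed
  qed auto
  also have "(\<Sum>U\<in>?X. odd_part f U v) = (\<Sum>Q\<in>octads_through T. odd_part f (Q - T) v)"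
  proof (subst sum.reindex)
    show "inj_on (\<lambda>Q. Q - T) (octads_through T)" by (auto simp: inj_on_def octads_through_def)
  qed simp
  finally show ?thesis .
qed

lemma sum_shape3_base_squares:
  "(\<Sum>l\<in>UNIV. L l * (shape3_base i $ l)\<^sup>2) = (sum L UNIV) + 8 * L i" for L :: "'n::finite \<Rightarrow> complex"
proof -
  have "(\<Sum>l\<in>UNIV. L l * (shape3_base i $ l)\<^sup>2) = (\<Sum>l\<in>UNIV. L l + (if l = i then 8 * L i else 0))"
    by (intro sum.cong) (auto simp: shape3_base_def)
  then show ?thesis by (simp add: sum.distrib)
qed

lemma sum_indicator_squares:
  "(\<Sum>l\<in>UNIV. L l * (char_vec A $ l)\<^sup>2) = (\<Sum>l\<in>A. L l)" for L :: "'n::finite \<Rightarrow> complex"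
proof -
  have "(\<Sum>l\<in>UNIV. L l * (char_vec A $ l)\<^sup>2) = (\<Sum>l\<in>UNIV. if l \<in> A then L l else 0)"
    by (intro sum.cong) (auto simp: char_vec_def)
  then show ?thesis by (simp add: sum.If_cases)
qed

text \<open>
  The squares of the coordinates of the three shapes are, up to scaling, the vectors \<open>1\<^sub>k + 1\<^sub>j\<close>, the
  indicators of the octads, and \<open>1 + 8 e\<^sub>i\<close>. Evaluating the forms in the squares at these points
  gives the linear systems for octads.
\<close>

theorem quintic_eq_0:
  fixes f :: "(24, complex) mpoly"
  assumes f: "homogeneous 5 f"
    and pairs: "\<And>i j S. i \<noteq> j \<Longrightarrow> S \<subseteq> {i, j} \<Longrightarrow> poly_eval (flip_signs S (char_vec {i, j})) f = 0"
    and octs: "\<And>Q S. Q \<in> octads \<Longrightarrow> S \<subseteq> Q \<Longrightarrow> even (card S) \<Longrightarrow>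
                 poly_eval (flip_signs S (char_vec Q)) f = 0"
    and full: "\<And>i S. S \<in> D \<Longrightarrow> poly_eval (flip_signs S (shape3_base i)) f = 0"
  shows "f = 0"
proof -
  have single: "m \<notin> keys f" if m: "odd_support m = {k}" for k m
  proof -
    obtain M where sym: "\<And>j l. M j l = M l j"
      and val: "\<And>v. odd_part f {k} v = v $ k * (\<Sum>j\<in>UNIV. \<Sum>l\<in>UNIV. M j l * (v $ j)\<^sup>2 * (v $ l)\<^sup>2)"
      and keys: "(\<forall>j l. M j l = 0) \<longrightarrow> (\<forall>m. odd_support m = {k} \<longrightarrow> m \<notin> keys f)"
      using odd_part_1[OF f, of k] by blast
    have ind: "(\<Sum>j\<in>A. \<Sum>l\<in>A. M j l) = 0" if "k \<in> A" "odd_part f {k} (char_vec A) = 0" for A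
    proof -
      have "(\<Sum>j\<in>UNIV. \<Sum>l\<in>UNIV. M j l * (char_vec A $ j)\<^sup>2 * (char_vec A $ l)\<^sup>2) =
          (\<Sum>j\<in>UNIV. (\<Sum>l\<in>A. M j l) * (char_vec A $ j)\<^sup>2)"
      proof (rule sum.cong[OF refl])
        fix j
        have "(\<Sum>l\<in>UNIV. M j l * (char_vec A $ j)\<^sup>2 * (char_vec A $ l)\<^sup>2) =
            (char_vec A $ j)\<^sup>2 * (\<Sum>l\<in>UNIV. M j l * (char_vec A $ l)\<^sup>2)"
          by (simp add: sum_distrib_left mult_ac)
        then show "(\<Sum>l\<in>UNIV. M j l * (char_vec A $ j)\<^sup>2 * (char_vec A $ l)\<^sup>2) =
            (\<Sum>l\<in>A. M j l) * (char_vec A $ j)\<^sup>2"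
          by (simp only: sum_indicator_squares mult.commute)
      qed
      then show ?thesis
        using that val[of "char_vec A"] unfolding sum_indicator_squares
        by (simp add: char_vec_def)
    qed
    have "M i j = 0" for i j
    proof (rule quadratic_octad_system[where M = M and k = k])
      show "M j l = M l j" for j l by (rule sym)
    next
      fix j assume "j \<noteq> k"
      then have "odd_part f {k} (char_vec {k, j}) = 0"
        using pairs[of k j] by (intro odd_part_pair[OF f]) auto
      then have "(\<Sum>j'\<in>{k, j}. \<Sum>l\<in>{k, j}. M j' l) = 0" by (intro ind) auto
      then show "M k k + 2 * M k j + M j j = 0" using \<open>j \<noteq> k\<close> sym[of j k] by (simp add: algebra_simps)
    next
      fix Q assume Q: "Q \<in> octads" "k \<in> Q"
      then have "card (Q - {k}) = 7" "even (card Q)" by (auto simp: octads_def)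
      moreover from this have "{k} \<noteq> Q - {k}" by auto
      ultimately have "odd_part f {k} (char_vec Q) = 0"
        using odd_parts_octad[OF f, of "{k}" Q] octs[OF Q(1)] Q(2)
          odd_part_eq_0_if_card[OF f, of "Q - {k}" "char_vec Q"] by simp
      then show "(\<Sum>j\<in>Q. \<Sum>l\<in>Q. M j l) = 0" using Q(2) by (intro ind)
    next
      fix i
      let ?E = "\<Sum>j\<in>UNIV. \<Sum>l\<in>UNIV. M j l * (shape3_base i $ j)\<^sup>2 * (shape3_base i $ l)\<^sup>2"
      let ?F = "(\<Sum>j\<in>UNIV. sum (M j) UNIV) + 16 * (sum (M i) UNIV) + 64 * M i i"
      have "?E =
          (\<Sum>j\<in>UNIV. ((sum (M j) UNIV) + 8 * M j i) * (shape3_base i $ j)\<^sup>2)"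
      proof (rule sum.cong[OF refl])
        fix j
        have "(\<Sum>l\<in>UNIV. M j l * (shape3_base i $ j)\<^sup>2 * (shape3_base i $ l)\<^sup>2) =
            (shape3_base i $ j)\<^sup>2 * (\<Sum>l\<in>UNIV. M j l * (shape3_base i $ l)\<^sup>2)"
          by (simp add: sum_distrib_left mult_ac)
        then show "(\<Sum>l\<in>UNIV. M j l * (shape3_base i $ j)\<^sup>2 * (shape3_base i $ l)\<^sup>2) =
            ((sum (M j) UNIV) + 8 * M j i) * (shape3_base i $ j)\<^sup>2"
          by (simp only: sum_shape3_base_squares mult.commute)
      qed
      also have "\<dots> = ?F"
      proof -
        have "(\<Sum>j\<in>UNIV. M j i) = (sum (M i) UNIV)" by (intro sum.cong refl sym)
        then show ?thesis
          unfolding sum_shape3_base_squares sum.distrib sum_distrib_left[symmetric]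
          by (simp add: algebra_simps)
      qed
      finally have expand: "?E =
          ?F" .
      show "?F = 0"
      proof -
        have "shape3_base i $ k \<noteq> 0" by (simp add: shape3_base_def)
        then show ?thesis
          using odd_part_shape3_single[OF f full, of k i] expand unfolding val by simp
      qed
    qed
    then show ?thesis using keys m by blast
  qed
  have triple_part: "(\<forall>m. odd_support m = T \<longrightarrow> m \<notin> keys f) \<and>
      (\<forall>Q\<in>octads_through T. lookup f (exponent_of_set (Q - T)) = 0)"
    if T: "card T = 3" for T
  proof -
    obtain L where val: "\<And>v. odd_part f T v = (\<Prod>j\<in>T. v $ j) * (\<Sum>l\<in>UNIV. L l * (v $ l)\<^sup>2)"
      and keys: "(\<forall>l. L l = 0) \<longrightarrow> (\<forall>m. odd_support m = T \<longrightarrow> m \<notin> keys f)"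
      using odd_part_3[OF f T] by blast
    define d where "d Q = lookup f (exponent_of_set (Q - T))" for Q
    have Q5: "card (Q - T) = 5" if "Q \<in> octads_through T" for Q
      using that T by (simp add: octads_through_def octads_def card_Diff_subset)
    have val5: "odd_part f (Q - T) v = d Q * (\<Prod>j\<in>Q - T. v $ j)" if "Q \<in> octads_through T" for Q v
      using odd_part_5[OF f Q5[OF that]] by (simp add: d_def)
    have oct: "(sum L Q) + d Q = 0" if Q: "Q \<in> octads_through T" for Q
    proof -
      have TQ: "T \<subseteq> Q" "Q \<in> octads" using Q by (auto simp: octads_through_def)
      have "T \<noteq> Q - T" using Q5[OF Q] T by auto
      moreover have "even (card Q)" using TQ by (simp add: octads_def)
      ultimately have "odd_part f T (char_vec Q) + odd_part f (Q - T) (char_vec Q) = 0"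
        using octs[OF TQ(2)] TQ(1) by (intro odd_parts_octad[OF f]) auto
      moreover have "(\<Prod>j\<in>T. char_vec Q $ j) = 1" "(\<Prod>j\<in>Q - T. char_vec Q $ j) = 1"
        using TQ(1) by (auto simp: char_vec_def intro!: prod.neutral)
      ultimately show ?thesis unfolding val val5[OF Q] sum_indicator_squares by simp
    qed
    have shape3: "(if i \<in> T then 3 else -1) * ((sum L UNIV) + 8 * L i)
        + (\<Sum>Q\<in>octads_through T. d Q * (if i \<in> Q - T then 3 else -1)) = 0" for i
    proof -
      have "odd_part f T (shape3_base i) + (\<Sum>Q\<in>octads_through T. odd_part f (Q - T) (shape3_base i)) = 0"
        by (rule odd_parts_shape3_triple[OF f T full])
      moreover have "(\<Sum>Q\<in>octads_through T. odd_part f (Q - T) (shape3_base i)) =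
          (\<Sum>Q\<in>octads_through T. d Q * (if i \<in> Q - T then 3 else -1))"
        using Q5 by (intro sum.cong refl) (simp only: val5, subst prod_shape3_base, auto)
      ultimately show ?thesis unfolding val sum_shape3_base_squares using T prod_shape3_base[of T i] by simp
    qed
    have L: "L i = 0" for i
    proof (rule linear_octad_system[OF T oct])
      fix i assume "i \<in> T"
      then show "3 * ((sum L UNIV) + 8 * L i) - (\<Sum>Q\<in>octads_through T. d Q) = 0"
        using shape3[of i] by (simp add: sum_negf)
    next
      fix i assume "i \<notin> T"
      then show "- ((sum L UNIV) + 8 * L i) + (\<Sum>Q\<in>octads_through T. d Q * (if i \<in> Q then 3 else - 1)) = 0"
        using shape3[of i] by simp
    qed
    moreover have "d Q = 0" if "Q \<in> octads_through T" for Q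
      using oct[OF that] L by simp
    ultimately show ?thesis using keys unfolding d_def by blast
  qed
  have "m \<notin> keys f" for m
  proof
    assume m: "m \<in> keys f"
    obtain n where n: "m = exponent_of_set (odd_support m) + (n + n)"
      "card (odd_support m) + 2 * exponent_sum n = 5"
      by (rule homogeneous_exponentE[OF f m refl])
    have "card (odd_support m) = 1 \<or> card (odd_support m) = 3 \<or> card (odd_support m) = 5"
      using n(2) by presburger
    then show False
    proof (elim disjE)
      assume "card (odd_support m) = 1"
      then obtain k where "odd_support m = {k}" by (auto simp: card_1_singleton_iff)
      then show False using single m by blast
    next
      assume "card (odd_support m) = 3"
      then show False using triple_part m by blast
    next
      assume 5: "card (odd_support m) = 5"
      then have "n = 0" using n(2) by (simp flip: exponent_sum_eq_0_iff)
      from octad_through_5[OF 5] obtain Q where Q: "Q \<in> octads" "odd_support m \<subseteq> Q" by blast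
      define T where "T = Q - odd_support m"
      have "card T = 3" "Q \<in> octads_through T" "Q - T = odd_support m"
        using Q 5 by (auto simp: T_def octads_def octads_through_def card_Diff_subset)
      then have "lookup f (exponent_of_set (odd_support m)) = 0" using triple_part by metis
      moreover have "m = exponent_of_set (odd_support m)" using n(1) \<open>n = 0\<close> by simp
      ultimately show False using m by (metis in_keys_iff)
    qed
  qed
  then show ?thesis by (auto intro!: poly_mapping_eqI simp: in_keys_iff)
qed

end


section \<open>The Leech lattice\<close>

definition int_vec :: "int ^ 'n \<Rightarrow> real ^ 'n" where
  "int_vec x = (\<chi> i. of_int (x $ i))"

text \<open>
  The lattice is parametrised by an integer \<open>m\<close> and an integer vector \<open>u\<close>, with \<open>x = m + 2 u\<close> in
  every coordinate. In this form closure under sums is evident, although \<open>m\<close> is only determined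
  modulo 2 by \<open>x\<close>.
\<close>

context golay_sets
begin

definition leech_param :: "int \<Rightarrow> int ^ 24 \<Rightarrow> bool" where
  "leech_param m u \<longleftrightarrow> {i. odd (u $ i)} \<in> D \<and> 4 dvd (\<Sum>i\<in>UNIV. u $ i) - 2 * m"

definition leech_lattice :: "(int ^ 24) set" where
  "leech_lattice = {(\<chi> i. m + 2 * u $ i) | m u. leech_param m u}"

lemma leech_lattice_add:
  assumes "x \<in> leech_lattice" "y \<in> leech_lattice"
  shows "x + y \<in> leech_lattice"
proof -
  obtain m u n w where x: "x = (\<chi> i. m + 2 * u $ i)" "leech_param m u"
    and y: "y = (\<chi> i. n + 2 * w $ i)" "leech_param n w"
    using assms by (auto simp: leech_lattice_def)
  have "{i. odd ((u + w) $ i)} = sym_diff {i. odd (u $ i)} {i. odd (w $ i)}" by auto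
  then have "{i. odd ((u + w) $ i)} \<in> D" using x(2) y(2) sym_diff_closed by (simp add: leech_param_def)
  moreover have "4 dvd ((\<Sum>i\<in>UNIV. u $ i) - 2 * m) + ((\<Sum>i\<in>UNIV. w $ i) - 2 * n)"
    using x(2) y(2) unfolding leech_param_def by (blast intro: dvd_add)
  then have "4 dvd (\<Sum>i\<in>UNIV. (u + w) $ i) - 2 * (m + n)"
    by (simp add: sum.distrib algebra_simps)
  moreover have "x + y = (\<chi> i. (m + n) + 2 * (u + w) $ i)"
    by (simp add: x(1) y(1) vec_eq_iff)
  ultimately show ?thesis unfolding leech_lattice_def leech_param_def by blast
qed

lemma leech_lattice_uminus:
  assumes "x \<in> leech_lattice"
  shows "- x \<in> leech_lattice"
proof -
  obtain m u where x: "x = (\<chi> i. m + 2 * u $ i)" "leech_param m u"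
    using assms by (auto simp: leech_lattice_def)
  have "4 dvd - ((\<Sum>i\<in>UNIV. u $ i) - 2 * m)"
    using x(2) unfolding leech_param_def by (simp only: dvd_minus_iff)
  then have "leech_param (- m) (- u)" using x(2) unfolding leech_param_def
    by (simp add: sum_negf algebra_simps)
  moreover have "- x = (\<chi> i. - m + 2 * (- u) $ i)" by (simp add: x(1) vec_eq_iff)
  ultimately show ?thesis unfolding leech_lattice_def by blast
qed

lemma square_mod_4: "(k :: int)\<^sup>2 mod 4 = (if odd k then 1 else 0)"
proof (cases "even k")
  case True
  then obtain l where "k = 2 * l" by blast
  then show ?thesis by (simp add: power_mult_distrib)
next
  case False
  then obtain l where "k = 2 * l + 1" by (auto elim: oddE)
  then have "k\<^sup>2 = 1 + 4 * (l\<^sup>2 + l)" by (simp add: power2_eq_square algebra_simps)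
  then have "k\<^sup>2 mod 4 = 1" by presburger
  then show ?thesis using False by simp
qed

lemma sum_squares_mod_4:
  "(\<Sum>i\<in>UNIV. (u $ i)\<^sup>2) mod 4 = int (card {i. odd (u $ i)}) mod 4" for u :: "int ^ 'n::finite"
proof -
  have "(\<Sum>i\<in>UNIV. (u $ i)\<^sup>2) mod 4 = (\<Sum>i\<in>UNIV. (u $ i)\<^sup>2 mod 4) mod 4" by (simp add: mod_sum_eq)
  also have "(\<Sum>i\<in>UNIV. (u $ i)\<^sup>2 mod 4) = int (card {i. odd (u $ i)})"
    unfolding square_mod_4 by (simp add: sum.If_cases)
  finally show ?thesis .
qed

lemma leech_norm_expand:
  "(\<Sum>i\<in>UNIV. ((\<chi> i. m + 2 * u $ i) $ i)\<^sup>2) =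
     24 * m\<^sup>2 + 4 * m * (\<Sum>i\<in>UNIV. u $ i) + 4 * (\<Sum>i\<in>UNIV. (u $ i)\<^sup>2)" for u :: "int ^ 24"
proof -
  have "(\<Sum>i\<in>UNIV. ((\<chi> i. m + 2 * u $ i) $ i)\<^sup>2) = (\<Sum>i\<in>UNIV. m\<^sup>2 + 4 * m * u $ i + 4 * (u $ i)\<^sup>2)"
    by (intro sum.cong) (auto simp: power2_eq_square algebra_simps)
  then show ?thesis by (simp add: sum.distrib sum_distrib_left)
qed

text \<open>
  In the expansion of the squared length, \<open>\<Sum>u\<^sub>i\<close> is \<open>2m\<close> modulo 4, and \<open>\<Sum>u\<^sub>i\<^sup>2\<close> is a multiple of 4 since
  the weights of the code are; what remains is \<open>24 m\<^sup>2 + 8 m\<^sup>2\<close> modulo 16.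
\<close>

lemma leech_norm_dvd_16:
  assumes "x \<in> leech_lattice"
  shows "16 dvd (\<Sum>i\<in>UNIV. (x $ i)\<^sup>2)"
proof -
  obtain m u where x: "x = (\<chi> i. m + 2 * u $ i)" "leech_param m u"
    using assms by (auto simp: leech_lattice_def)
  have "4 dvd (\<Sum>i\<in>UNIV. (u $ i)\<^sup>2)"
  proof -
    have "4 dvd card {i. odd (u $ i)}" using doubly_even x(2) by (simp add: leech_param_def)
    then have "int (card {i. odd (u $ i)}) mod 4 = 0" by presburger
    then show ?thesis using sum_squares_mod_4[of u] by (simp only: dvd_eq_mod_eq_0)
  qed
  then obtain a where a: "(\<Sum>i\<in>UNIV. (u $ i)\<^sup>2) = 4 * a" by blast
  obtain b where "(\<Sum>i\<in>UNIV. u $ i) - 2 * m = 4 * b"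
    using x(2) unfolding leech_param_def by (blast elim: dvdE)
  then have b: "(\<Sum>i\<in>UNIV. u $ i) = 4 * b + 2 * m" by linarith
  have "(\<Sum>i\<in>UNIV. (x $ i)\<^sup>2) = 16 * (2 * m\<^sup>2 + m * b + a)"
    unfolding x(1) leech_norm_expand a b by (simp add: power2_eq_square algebra_simps)
  then show ?thesis by simp
qed

text \<open>
  For odd \<open>m\<close> all coordinates are odd and the squared length is at least 24. For even \<open>m\<close>, write
  \<open>x = 2y\<close>; a vector \<open>y\<close> of squared length 4 has at most four odd coordinates, which form a codeword,
  so there are none. Then \<open>x = 4z\<close> with a unit vector \<open>z\<close>, whose coordinate sum has the wrong parity.
\<close>

lemma leech_norm_neq_16:
  assumes "x \<in> leech_lattice"
  shows "(\<Sum>i\<in>UNIV. (x $ i)\<^sup>2) \<noteq> 16"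
proof
  assume 16: "(\<Sum>i\<in>UNIV. (x $ i)\<^sup>2) = 16"
  obtain m u where x: "x = (\<chi> i. m + 2 * u $ i)" "leech_param m u"
    using assms by (auto simp: leech_lattice_def)
  show False
  proof (cases "even m")
    case False
    have "1 \<le> (x $ i)\<^sup>2" for i
    proof -
      have "x $ i = m + 2 * u $ i" by (simp add: x(1))
      then have "x $ i \<noteq> 0" using False by presburger
      then have "0 < (x $ i)\<^sup>2" by simp
      then show ?thesis by linarith
    qed
    then have "(\<Sum>i\<in>(UNIV :: 24 set). 1) \<le> (\<Sum>i\<in>UNIV. (x $ i)\<^sup>2)" by (rule sum_mono)
    then show False using 16 by simp
  next
    case True
    then obtain k where k: "m = 2 * k" by blast
    define y where "y i = k + u $ i" for i
    have xy: "x $ i = 2 * y i" for i by (simp add: x(1) k y_def)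
    then have y4: "(\<Sum>i\<in>UNIV. (y i)\<^sup>2) = 4"
      using 16 by (simp add: power_mult_distrib flip: sum_distrib_left)
    have oddD: "{i. odd (y i)} \<in> D"
    proof (cases "even k")
      case True
      then have "{i. odd (y i)} = {i. odd (u $ i)}" by (auto simp: y_def)
      then show ?thesis using x(2) by (simp add: leech_param_def)
    next
      case False
      then have "{i. odd (y i)} = sym_diff UNIV {i. odd (u $ i)}" by (auto simp: y_def)
      then show ?thesis using x(2) sym_diff_closed[OF UNIV_in] by (simp add: leech_param_def)
    qed
    have "int (card {i. odd (y i)}) = (\<Sum>i\<in>UNIV. if odd (y i) then 1 else 0)" by (simp add: sum.If_cases)
    also have "\<dots> \<le> (\<Sum>i\<in>UNIV. (y i)\<^sup>2)"
    proof (rule sum_mono)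
      fix i show "(if odd (y i) then 1 else 0) \<le> (y i)\<^sup>2"
      proof (cases "odd (y i)")
        case True
        then have "y i \<noteq> 0" by auto
        then have "0 < (y i)\<^sup>2" by simp
        then have "1 \<le> (y i)\<^sup>2" by linarith
        then show ?thesis using True by simp
      qed simp
    qed
    finally have "{i. odd (y i)} = {}" using y4 oddD by (intro card_less_8_imp_empty) auto
    then have ev: "even (y i)" for i by blast
    define z where "z i = y i div 2" for i
    have z: "y i = 2 * z i" for i using ev[of i] by (simp add: z_def)
    have z1: "(\<Sum>i\<in>UNIV. (z i)\<^sup>2) = 1"
      using y4 unfolding z by (simp add: power_mult_distrib flip: sum_distrib_left)
    have "u $ i = 2 * z i - k" for i using z[of i] by (simp add: y_def)
    then have "(\<Sum>i\<in>UNIV. u $ i) = 2 * (\<Sum>i\<in>UNIV. z i) - 24 * k"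
      by (simp add: sum_subtractf sum_distrib_left)
    then have "4 dvd 2 * (\<Sum>i\<in>UNIV. z i) - 24 * k - 2 * (2 * k)"
      using x(2) unfolding leech_param_def k by (simp only:)
    then have "even (\<Sum>i\<in>UNIV. z i)" by presburger
    moreover have "even (\<Sum>i\<in>UNIV. (z i)\<^sup>2 - z i)" by (intro dvd_sum) simp
    ultimately show False using z1 by (simp add: sum_subtractf)
  qed
qed

end


subsection \<open>The shortest vectors\<close>

locale golay_code = golay_sets "codeword_support ` C" for C :: "(bit ^ 24) set"
begin

lemma minimal_vector_in_leech_lattice:
  assumes "v \<in> leech_min_vectors C"
  shows "\<exists>x\<in>leech_lattice. v = int_vec x \<and> (\<Sum>i\<in>UNIV. (x $ i)\<^sup>2) = 32"
proof -
  have lattice: ?thesis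
    if "{i. odd (u i)} \<in> codeword_support ` C" "4 dvd (\<Sum>i\<in>UNIV. u i) - 2 * m"
      "\<And>i. v $ i = of_int (m + 2 * u i)" "(\<Sum>i\<in>UNIV. (m + 2 * u i)\<^sup>2) = 32"
    for m and u :: "24 \<Rightarrow> int"
  proof -
    have "leech_param m (\<chi> i. u i)" using that(1,2) by (simp add: leech_param_def)
    then have "(\<chi> i. m + 2 * (\<chi> i. u i) $ i) \<in> leech_lattice"
      unfolding leech_lattice_def by blast
    moreover have "v = int_vec (\<chi> i. m + 2 * (\<chi> i. u i) $ i)"
      using that(3) by (simp add: int_vec_def vec_eq_iff)
    ultimately show ?thesis using that(4) by (intro bexI) auto
  qed
  consider "v \<in> leech_shape2 C" | "v \<in> leech_shape3 C" | "v \<in> leech_shape4"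
    using assms by (auto simp: leech_min_vectors_def)
  then show ?thesis
  proof cases
    case 1
    then obtain w where w: "w \<in> C" "card (codeword_support w) = 8"
      "\<forall>i\<in>codeword_support w. v $ i \<in> {2, -2}" "\<forall>i. i \<notin> codeword_support w \<longrightarrow> v $ i = 0"
      "even (card {i. v $ i < 0})" by (auto simp: leech_shape2_def)
    let ?S = "codeword_support w"
    define u where "u i = (if i \<in> ?S then if v $ i < 0 then -1 else 1 else 0 :: int)" for i
    have val: "v $ i = of_int (0 + 2 * u i)" for i using w(3,4) by (auto simp: u_def)
    have neg: "{i. v $ i < 0} \<subseteq> ?S" using w(4) by force
    have "(\<Sum>i\<in>UNIV. u i) = (\<Sum>i\<in>UNIV. (if i \<in> ?S then 1 else 0) - 2 * (if v $ i < 0 then 1 else 0))"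
      using neg by (intro sum.cong) (auto simp: u_def)
    also have "\<dots> = 8 - 2 * int (card {i. v $ i < 0})"
      using w(2) by (simp add: sum_subtractf sum.If_cases flip: sum_distrib_left)
    finally have "4 dvd (\<Sum>i\<in>UNIV. u i) - 2 * 0" using w(5) by presburger
    moreover have "{i. odd (u i)} = ?S" by (auto simp: u_def)
    moreover have "(\<Sum>i\<in>UNIV. (0 + 2 * u i)\<^sup>2) = (\<Sum>i\<in>UNIV. if i \<in> ?S then 4 else 0)"
      by (intro sum.cong) (auto simp: u_def)
    then have "(\<Sum>i\<in>UNIV. (0 + 2 * u i)\<^sup>2) = 32" using w(2) by (simp add: sum.If_cases)
    ultimately show ?thesis using lattice[of u 0] val w(1) by simp
  next
    case 2
    then obtain k w where w: "w \<in> C" "v = (\<chi> j. if j = k then (if j \<in> codeword_support w then -3 else 3)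
            else (if j \<in> codeword_support w then 1 else -1))" by (auto simp: leech_shape3_def)
    let ?S = "codeword_support w"
    define u where "u i = (if i = k then if i \<in> ?S then -1 else 2 else if i \<in> ?S then 1 else 0 :: int)" for i
    have val: "v $ i = of_int (- 1 + 2 * u i)" for i by (simp add: u_def w(2))
    have "(\<Sum>i\<in>UNIV. u i) = (\<Sum>i\<in>UNIV. (if i \<in> ?S then 1 else 0) + (if i = k then if k \<in> ?S then -2 else 2 else 0))"
      by (intro sum.cong) (auto simp: u_def)
    also have "\<dots> = int (card ?S) + (if k \<in> ?S then -2 else 2)"
      by (simp add: sum.distrib sum.If_cases)
    finally have "(\<Sum>i\<in>UNIV. u i) = int (card ?S) + (if k \<in> ?S then -2 else 2)" .
    moreover have "4 dvd card ?S" using doubly_even w(1) by blast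
    ultimately have "4 dvd (\<Sum>i\<in>UNIV. u i) - 2 * - 1"
      by (cases "k \<in> ?S") (simp, presburger)+
    moreover have "{i. odd (u i)} = ?S" by (auto simp: u_def)
    moreover have "(\<Sum>i\<in>UNIV. (- 1 + 2 * u i)\<^sup>2) = (\<Sum>i\<in>UNIV. 1 + (if i = k then 8 else 0))"
      by (intro sum.cong) (auto simp: u_def)
    then have "(\<Sum>i\<in>UNIV. (- 1 + 2 * u i)\<^sup>2) = 32" by (simp add: sum.distrib)
    ultimately show ?thesis using lattice[of u "- 1"] val w(1) by simp
  next
    case 3
    then obtain k l where kl: "k \<noteq> l" "v $ k \<in> {4, -4}" "v $ l \<in> {4, -4}" "\<forall>i. i \<noteq> k \<and> i \<noteq> l \<longrightarrow> v $ i = 0"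
      by (auto simp: leech_shape4_def)
    define a where "a = (if v $ k < 0 then -2 else 2 :: int)"
    define b where "b = (if v $ l < 0 then -2 else 2 :: int)"
    define u where "u i = (if i = k then a else 0) + (if i = l then b else 0)" for i
    have val: "v $ i = of_int (0 + 2 * u i)" for i using kl by (auto simp: u_def a_def b_def)
    have "(\<Sum>i\<in>UNIV. u i) = a + b" by (simp add: u_def sum.distrib)
    then have "4 dvd (\<Sum>i\<in>UNIV. u i) - 2 * 0" by (simp add: a_def b_def)
    moreover have "{i. odd (u i)} = {}" by (auto simp: u_def a_def b_def)
    moreover have "(\<Sum>i\<in>UNIV. (0 + 2 * u i)\<^sup>2) = (\<Sum>i\<in>UNIV. (if i = k then 16 else 0) + (if i = l then 16 else 0))"
      using kl(1) by (intro sum.cong) (auto simp: u_def a_def b_def)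
    then have "(\<Sum>i\<in>UNIV. (0 + 2 * u i)\<^sup>2) = 32" by (simp add: sum.distrib)
    ultimately show ?thesis using lattice[of u 0] val empty_in by simp
  qed
qed

text \<open>
  The squared lengths of the sum and of the difference of two shortest vectors are non-negative
  multiples of 16 that differ from 16 itself.
\<close>

lemma inner_minimal_vectors:
  assumes "v \<in> leech_min_vectors C" "w \<in> leech_min_vectors C"
  shows "v \<bullet> w \<in> {32, 16, 8, 0, -8, -16, -32}"
    and "v \<bullet> w = 32 \<Longrightarrow> w = v" and "v \<bullet> w = - 32 \<Longrightarrow> w = - v"
proof -
  obtain x where x: "x \<in> leech_lattice" "v = int_vec x" "(\<Sum>i\<in>UNIV. (x $ i)\<^sup>2) = 32"
    using minimal_vector_in_leech_lattice[OF assms(1)] by blast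
  obtain y where y: "y \<in> leech_lattice" "w = int_vec y" "(\<Sum>i\<in>UNIV. (y $ i)\<^sup>2) = 32"
    using minimal_vector_in_leech_lattice[OF assms(2)] by blast
  define p where "p = (\<Sum>i\<in>UNIV. x $ i * y $ i)"
  have vw: "v \<bullet> w = of_int p" by (simp add: x(2) y(2) int_vec_def p_def inner_vec_def)
  have plus: "(\<Sum>i\<in>UNIV. ((x + y) $ i)\<^sup>2) = 64 + 2 * p"
  proof -
    have "(\<Sum>i\<in>UNIV. ((x + y) $ i)\<^sup>2) = (\<Sum>i\<in>UNIV. (x $ i)\<^sup>2 + (y $ i)\<^sup>2 + 2 * (x $ i * y $ i))"
      by (intro sum.cong) (auto simp: power2_eq_square algebra_simps)
    then show ?thesis using x(3) y(3) by (simp add: sum.distrib p_def flip: sum_distrib_left)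
  qed
  have minus: "(\<Sum>i\<in>UNIV. ((x + - y) $ i)\<^sup>2) = 64 - 2 * p"
  proof -
    have "(\<Sum>i\<in>UNIV. ((x + - y) $ i)\<^sup>2) = (\<Sum>i\<in>UNIV. (x $ i)\<^sup>2 + (y $ i)\<^sup>2 - 2 * (x $ i * y $ i))"
      by (intro sum.cong) (auto simp: power2_eq_square algebra_simps)
    then show ?thesis using x(3) y(3) by (simp add: sum.distrib sum_subtractf p_def flip: sum_distrib_left)
  qed
  have L: "x + y \<in> leech_lattice" "x + - y \<in> leech_lattice"
    by (rule leech_lattice_add[OF x(1) y(1)], rule leech_lattice_add[OF x(1) leech_lattice_uminus[OF y(1)]])
  have "16 dvd 64 + 2 * p" using leech_norm_dvd_16[OF L(1)] plus by simp
  then have "8 dvd p" by presburger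
  then obtain k where k: "p = 8 * k" by blast
  have "0 \<le> 64 + 2 * p" unfolding plus[symmetric] by (intro sum_nonneg) simp
  moreover have "0 \<le> 64 - 2 * p" unfolding minus[symmetric] by (intro sum_nonneg) simp
  moreover have "64 + 2 * p \<noteq> 16" "64 - 2 * p \<noteq> 16"
    using leech_norm_neq_16[OF L(1)] leech_norm_neq_16[OF L(2)] plus minus by auto
  ultimately have "k = 4 \<or> k = 2 \<or> k = 1 \<or> k = 0 \<or> k = - 1 \<or> k = - 2 \<or> k = - 4"
    unfolding k by presburger
  then show "v \<bullet> w \<in> {32, 16, 8, 0, -8, -16, -32}" unfolding vw k by auto
  show "w = v" if "v \<bullet> w = 32"
  proof -
    have "p = 32" using that vw by linarith
    then have "(\<Sum>i\<in>UNIV. ((x + - y) $ i)\<^sup>2) = 0" using minus by simp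
    then have "\<forall>i. x $ i = y $ i" by (simp add: sum_nonneg_eq_0_iff)
    then show ?thesis by (simp add: x(2) y(2) int_vec_def)
  qed
  show "w = - v" if "v \<bullet> w = - 32"
  proof -
    have "p = - 32" using that vw by linarith
    then have "(\<Sum>i\<in>UNIV. ((x + y) $ i)\<^sup>2) = 0" using plus by simp
    then have "\<forall>i. y $ i = - (x $ i)" by (simp add: sum_nonneg_eq_0_iff eq_neg_iff_add_eq_0 add.commute)
    then show ?thesis by (simp add: x(2) y(2) int_vec_def vec_eq_iff)
  qed
qed

lemma minimal_vector_norm: "v \<in> leech_min_vectors C \<Longrightarrow> v \<bullet> v = 32"
  using minimal_vector_in_leech_lattice[of v]
  by (auto simp: int_vec_def inner_vec_def power2_eq_square simp flip: of_int_mult of_int_sum)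

text \<open>
  For the converse, consider an integral vector \<open>x\<close> of squared length 32, with \<open>x = 2y\<close> if its
  coordinates are even and \<open>x = 2y - 1\<close> if they are odd. The octads meet the set of odd coordinates
  of \<open>y\<close> evenly, so it is a codeword by duality, and 32 is too small for anything but the three shapes.
\<close>

lemma even_case_is_minimal:
  fixes y :: "24 \<Rightarrow> int"
  assumes norm: "(\<Sum>i\<in>UNIV. (y i)\<^sup>2) = 8" and sum4: "4 dvd (\<Sum>i\<in>UNIV. y i)"
    and octad: "\<And>S. S \<in> codeword_support ` C \<Longrightarrow> card S = 8 \<Longrightarrow> even (\<Sum>i\<in>S. y i)"
  shows "(\<chi> i. 2 * of_int (y i)) \<in> leech_min_vectors C"
proof -
  define Q where "Q = {i. odd (y i)}"
  have "Q \<in> codeword_support ` C"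
  proof (rule dual)
    fix S assume "S \<in> codeword_support ` C" "card S = 8"
    then have "even (\<Sum>i\<in>S. y i)" by (rule octad)
    then have "even (card {i \<in> S. odd (y i)})" by (simp add: even_sum_iff)
    then show "even (card (S \<inter> Q))" by (simp add: Q_def Int_def)
  qed
  then obtain w where w: "w \<in> C" "codeword_support w = Q" by blast
  have sq: "(if i \<in> Q then 1 else 0) \<le> (y i)\<^sup>2" for i
  proof (cases "i \<in> Q")
    case True
    then have "y i \<noteq> 0" by (auto simp: Q_def)
    then have "0 < (y i)\<^sup>2" by simp
    then have "1 \<le> (y i)\<^sup>2" by linarith
    then show ?thesis by simp
  qed simp
  have cQ: "(\<Sum>i\<in>UNIV. if i \<in> Q then 1 else 0) = int (card Q)" by (simp add: sum.If_cases)
  have "int (card Q) \<le> 8" unfolding cQ[symmetric] norm[symmetric] by (rule sum_mono) (rule sq)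
  then have "card Q = 8 \<or> Q = {}"
    using card_less_8_imp_empty[OF \<open>Q \<in> _\<close>] by linarith
  then show ?thesis
  proof
    assume 1: "card Q = 8"
    have "(\<Sum>i\<in>UNIV. (y i)\<^sup>2 - (if i \<in> Q then 1 else 0)) = 0"
      unfolding sum_subtractf norm cQ using 1 by simp
    then have sq': "(y i)\<^sup>2 = (if i \<in> Q then 1 else 0)" for i
      by (subst (asm) sum_nonneg_eq_0_iff) (use sq in auto)
    have on: "y i = 1 \<or> y i = - 1" if "i \<in> Q" for i using sq'[of i] that by (simp add: power2_eq_1_iff)
    have off: "y i = 0" if "i \<notin> Q" for i using sq'[of i] that by simp
    have neg: "{i. y i < 0} \<subseteq> Q" using off by force
    have "(\<Sum>i\<in>UNIV. y i) = (\<Sum>i\<in>UNIV. (if i \<in> Q then 1 else 0) - 2 * (if y i < 0 then 1 else 0))"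
    proof (rule sum.cong[OF refl])
      fix i show "y i = (if i \<in> Q then 1 else 0) - 2 * (if y i < 0 then 1 else 0)"
        using on[of i] off[of i] by (cases "i \<in> Q") auto
    qed
    also have "\<dots> = 8 - 2 * int (card {i. y i < 0})"
      using 1 by (simp add: sum_subtractf sum.If_cases flip: sum_distrib_left)
    finally have "even (card {i. y i < 0})" using sum4 by presburger
    moreover have "{i. ((\<chi> i. 2 * of_int (y i)) :: real ^ 24) $ i < 0} = {i. y i < 0}" by auto
    moreover have "((\<chi> i. 2 * of_int (y i)) :: real ^ 24) $ i \<in> {2, - 2}" if "i \<in> Q" for i
      using on[OF that] by auto
    ultimately have "(\<chi> i. 2 * of_int (y i)) \<in> leech_shape2 C"
      unfolding leech_shape2_def using w 1 off by (auto intro!: bexI[of _ w])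
    then show ?thesis by (simp add: leech_min_vectors_def)
  next
    assume "Q = {}"
    then have ev: "even (y i)" for i by (auto simp: Q_def)
    define z where "z i = y i div 2" for i
    have z: "y i = 2 * z i" for i using ev[of i] by (simp add: z_def)
    have z2: "(\<Sum>i\<in>UNIV. (z i)\<^sup>2) = 2"
      using norm unfolding z by (simp add: power_mult_distrib flip: sum_distrib_left)
    have small: "z i = 0 \<or> z i = 1 \<or> z i = - 1" for i
    proof -
      have "(z i)\<^sup>2 \<le> (\<Sum>i\<in>UNIV. (z i)\<^sup>2)" by (rule member_le_sum) auto
      moreover have "2\<^sup>2 \<le> \<bar>z i\<bar>\<^sup>2" if "2 \<le> \<bar>z i\<bar>" using that by (intro power_mono) auto
      ultimately have "\<bar>z i\<bar> < 2" using z2 by fastforce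
      then show ?thesis by linarith
    qed
    have "(\<Sum>i\<in>UNIV. (z i)\<^sup>2) = (\<Sum>i\<in>UNIV. if z i \<noteq> 0 then 1 else 0)"
    proof (rule sum.cong[OF refl])
      fix i show "(z i)\<^sup>2 = (if z i \<noteq> 0 then 1 else 0)" using small[of i] by auto
    qed
    then have "int (card {i. z i \<noteq> 0}) = 2" using z2 by (simp add: sum.If_cases)
    then have "card {i. z i \<noteq> 0} = 2" by simp
    then obtain k l where kl: "{i. z i \<noteq> 0} = {k, l}" "k \<noteq> l" by (auto simp: card_2_iff)
    have val: "((\<chi> i. 2 * of_int (y i)) :: real ^ 24) $ i = 4 * of_int (z i)" for i by (simp add: z)
    have "z k \<noteq> 0" "z l \<noteq> 0" "\<And>i. i \<noteq> k \<Longrightarrow> i \<noteq> l \<Longrightarrow> z i = 0" using kl(1) by blast+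
    then have "(\<chi> i. 2 * of_int (y i)) \<in> leech_shape4"
      unfolding leech_shape4_def mem_Collect_eq using kl(2) small[of k] small[of l] val
      by - (rule exI[of _ k], rule exI[of _ l], auto)
    then show ?thesis by (simp add: leech_min_vectors_def)
  qed
qed

lemma odd_case_is_minimal:
  fixes x :: "24 \<Rightarrow> int"
  assumes norm: "(\<Sum>i\<in>UNIV. (x i)\<^sup>2) = 32" and odd: "\<And>i. odd (x i)"
    and octad: "\<And>S. S \<in> codeword_support ` C \<Longrightarrow> card S = 8 \<Longrightarrow> 4 dvd (\<Sum>i\<in>S. x i)"
  shows "(\<chi> i. of_int (x i)) \<in> leech_min_vectors C"
proof -
  define y where "y i = (x i + 1) div 2" for i
  have y: "x i = 2 * y i - 1" for i using odd[of i] unfolding y_def by presburger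
  define Q where "Q = {i. odd (y i)}"
  have "Q \<in> codeword_support ` C"
  proof (rule dual)
    fix S assume S: "S \<in> codeword_support ` C" "card S = 8"
    have "(\<Sum>i\<in>S. x i) = 2 * (\<Sum>i\<in>S. y i) - 8"
      using S(2) by (simp add: y sum_subtractf sum_distrib_left)
    then have "even (\<Sum>i\<in>S. y i)" using octad[OF S] by presburger
    then have "even (card {i \<in> S. odd (y i)})" by (simp add: even_sum_iff)
    then show "even (card (S \<inter> Q))" by (simp add: Q_def Int_def)
  qed
  then obtain w where w: "w \<in> C" "codeword_support w = Q" by blast
  have one: "0 \<le> (x i)\<^sup>2 - 1" for i
  proof -
    have "x i \<noteq> 0" using odd[of i] by auto
    then have "0 < (x i)\<^sup>2" by simp
    then show ?thesis by linarith
  qed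
  have total: "(\<Sum>i\<in>UNIV. (x i)\<^sup>2 - 1) = 8" by (simp add: sum_subtractf norm)
  have "\<exists>k. (x k)\<^sup>2 - 1 \<noteq> 0"
  proof (rule ccontr)
    assume "\<not> ?thesis"
    then have "(\<Sum>i\<in>UNIV. (x i)\<^sup>2 - 1) = 0" by simp
    then show False using total by simp
  qed
  then obtain k where k: "(x k)\<^sup>2 - 1 \<noteq> 0" by blast
  have k3: "3 \<le> \<bar>x k\<bar>"
  proof -
    have "x k \<noteq> 1" "x k \<noteq> - 1" using k by auto
    then show ?thesis using odd[of k] by presburger
  qed
  then have "3\<^sup>2 \<le> \<bar>x k\<bar>\<^sup>2" by (intro power_mono) auto
  then have ge: "8 \<le> (x k)\<^sup>2 - 1" by simp
  have split: "(\<Sum>i\<in>UNIV. (x i)\<^sup>2 - 1) = ((x k)\<^sup>2 - 1) + (\<Sum>i\<in>UNIV - {k}. (x i)\<^sup>2 - 1)"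
    by (rule sum.remove) auto
  moreover have "0 \<le> (\<Sum>i\<in>UNIV - {k}. (x i)\<^sup>2 - 1)" by (intro sum_nonneg one)
  ultimately have "(x k)\<^sup>2 = 3\<^sup>2" "(\<Sum>i\<in>UNIV - {k}. (x i)\<^sup>2 - 1) = 0" using ge total by auto
  then have xk: "x k = 3 \<or> x k = - 3" and "\<forall>i\<in>UNIV - {k}. (x i)\<^sup>2 - 1 = 0"
    using one by (simp_all only: power2_eq_iff) (simp add: sum_nonneg_eq_0_iff)
  then have xi: "x i = 1 \<or> x i = - 1" if "i \<noteq> k" for i using that by (auto simp: power2_eq_1_iff)
  have "(\<chi> i. of_int (x i)) = (\<chi> j. if j = k then (if j \<in> codeword_support w then -3 else 3 :: real)
            else (if j \<in> codeword_support w then 1 else -1))"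
  proof -
    have "of_int (x j) = (if j = k then (if j \<in> Q then -3 else 3 :: real) else (if j \<in> Q then 1 else -1))" for j
      using xk xi[of j] by (auto simp: Q_def y_def)
    then show ?thesis unfolding w(2) by (simp only:)
  qed
  then have "(\<chi> i. of_int (x i)) \<in> leech_shape3 C"
    unfolding leech_shape3_def using w(1) by blast
  then show ?thesis by (simp add: leech_min_vectors_def)
qed

end


definition complex_dot :: "real ^ 'n \<Rightarrow> complex ^ 'n::finite \<Rightarrow> complex" where
  "complex_dot a p = (\<Sum>j\<in>UNIV. complex_of_real (a $ j) * p $ j)"

lemma complex_dot_linear:
  "complex_dot (a + b) p = complex_dot a p + complex_dot b p"
  "complex_dot (r *\<^sub>R a) p = complex_of_real r * complex_dot a p"
  "complex_dot (- a) p = - complex_dot a p"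
  "complex_dot (a - b) p = complex_dot a p - complex_dot b p"
  "complex_dot 0 p = 0"
  by (simp_all add: complex_dot_def sum.distrib sum_subtractf sum_distrib_left sum_negf algebra_simps)

lemma complex_dot_right:
  "complex_dot a (p - q) = complex_dot a p - complex_dot a q"
  "complex_dot a (p + q) = complex_dot a p + complex_dot a q"
  "complex_dot a (z *s p) = z * complex_dot a p"
  by (simp_all add: complex_dot_def sum_subtractf sum.distrib sum_distrib_left algebra_simps)

lemma complex_dot_complex_vec: "complex_dot a (complex_vec b) = complex_of_real (a \<bullet> b)"
  by (simp add: complex_dot_def complex_vec_def inner_vec_def)

lemma complex_dot_axis: "complex_dot (axis j 1) p = p $ j"
proof -
  have "complex_dot (axis j 1) p = (\<Sum>i\<in>UNIV. if i = j then p $ j else 0)"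
    unfolding complex_dot_def by (intro sum.cong) (auto simp: axis_def)
  then show ?thesis by simp
qed

lemma UNIV_24_other: "\<exists>j. j \<noteq> (i :: 24)"
proof (rule ccontr)
  assume "\<not> ?thesis"
  then have "UNIV = {i}" by auto
  then have "card (UNIV :: 24 set) = 1" by (metis card_1_singleton_iff One_nat_def)
  then show False by simp
qed

context golay_code
begin

lemma two_nonzero_minimal:
  assumes "i \<noteq> j" "r \<in> {4, -4}" "s \<in> {4, -4}"
  shows "r *\<^sub>R axis i 1 + s *\<^sub>R axis j 1 \<in> leech_min_vectors C"
proof -
  have "r *\<^sub>R axis i 1 + s *\<^sub>R axis j 1 \<in> leech_shape4"
    unfolding leech_shape4_def mem_Collect_eq
    by (rule exI[of _ i], rule exI[of _ j]) (use assms in \<open>auto simp: axis_def\<close>)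
  then show ?thesis by (simp add: leech_min_vectors_def)
qed

text \<open>
  The vectors of the shape \<open>(\<plusminus>4, \<plusminus>4)\<close> force \<open>p\<close> to be integral with coordinates of equal parity,
  the octads impose the congruences that detect the code, and one vector of the shape
  \<open>(3, -1, \<dots>, -1)\<close> fixes the coordinate sum.
\<close>

theorem minimal_if_inner_products_integral:
  assumes inner: "\<And>a. a \<in> leech_min_vectors C \<Longrightarrow> \<exists>k::int. complex_dot a p = 8 * of_int k"
    and norm: "(\<Sum>i\<in>UNIV. (p $ i)\<^sup>2) = 32"
  shows "p \<in> complex_vec ` leech_min_vectors C"
proof -
  have pm: "\<exists>k l :: int. p $ i + p $ j = 2 * of_int k \<and> p $ i - p $ j = 2 * of_int l" if ij: "i \<noteq> j" for i j
  proof -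
    obtain k :: int where k: "complex_dot (4 *\<^sub>R axis i 1 + 4 *\<^sub>R axis j 1) p = 8 * of_int k"
      using inner[OF two_nonzero_minimal[OF ij]] by blast
    obtain l :: int where l: "complex_dot (4 *\<^sub>R axis i 1 + (-4) *\<^sub>R axis j 1) p = 8 * of_int l"
      using inner[OF two_nonzero_minimal[OF ij, of 4 "-4"]] by blast
    have "4 * (p $ i + p $ j) = 4 * (2 * of_int k)" "4 * (p $ i - p $ j) = 4 * (2 * of_int l)"
      using k l by (simp_all add: complex_dot_linear complex_dot_axis algebra_simps)
    then have "p $ i + p $ j = 2 * of_int k" "p $ i - p $ j = 2 * of_int l"
      by (simp_all only: mult_cancel_left) auto
    then show ?thesis by blast
  qed
  have "\<exists>k :: int. p $ i = of_int k" for i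
  proof -
    obtain j where "j \<noteq> i" using UNIV_24_other by blast
    with pm[of i j] obtain k l :: int where "p $ i + p $ j = 2 * of_int k" "p $ i - p $ j = 2 * of_int l"
      by auto
    then have "2 * p $ i = 2 * of_int (k + l)" by (simp add: algebra_simps)
    then have "p $ i = of_int (k + l)" by (simp only: mult_cancel_left) simp
    then show ?thesis by blast
  qed
  then obtain x :: "24 \<Rightarrow> int" where x: "\<And>i. p $ i = of_int (x i)" by metis
  have parity: "even (x i) \<longleftrightarrow> even (x j)" for i j
  proof (cases "i = j")
    case False
    with pm[of i j] obtain l :: int where "p $ i - p $ j = 2 * of_int l" by auto
    then have "(of_int (x i - x j) :: complex) = of_int (2 * l)" by (simp add: x)
    then have "x i - x j = 2 * l" by (simp only: of_int_eq_iff)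
    then show ?thesis by presburger
  qed simp
  have octad: "4 dvd (\<Sum>i\<in>S. x i)" if S: "S \<in> codeword_support ` C" "card S = 8" for S
  proof -
    define a :: "real ^ 24" where "a = (\<chi> i. if i \<in> S then 2 else 0)"
    have neg: "{i. a $ i < 0} = {}" by (auto simp: a_def)
    have "a \<in> leech_shape2 C" unfolding leech_shape2_def
      using S neg by (auto simp: a_def)
    then obtain k :: int where "complex_dot a p = 8 * of_int k"
      using inner by (auto simp: leech_min_vectors_def)
    moreover have "complex_dot a p = (\<Sum>i\<in>UNIV. if i \<in> S then 2 * of_int (x i) else 0)"
      unfolding complex_dot_def by (intro sum.cong) (auto simp: a_def x)
    ultimately have "(of_int (2 * (\<Sum>i\<in>S. x i)) :: complex) = of_int (8 * k)"
      by (simp add: sum.If_cases sum_distrib_left)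
    then have "2 * (\<Sum>i\<in>S. x i) = 8 * k" by (simp only: of_int_eq_iff)
    then show ?thesis by presburger
  qed
  have total: "8 dvd 4 * x i - (\<Sum>j\<in>UNIV. x j)" for i
  proof -
    define a :: "real ^ 24" where "a = (\<chi> j. if j = i then 3 else -1)"
    obtain w where "w \<in> C" "codeword_support w = {}" using empty_in by force
    then have "a \<in> leech_shape3 C" unfolding leech_shape3_def a_def by force
    then obtain k :: int where "complex_dot a p = 8 * of_int k"
      using inner by (auto simp: leech_min_vectors_def)
    moreover have "complex_dot a p = (\<Sum>j\<in>UNIV. (if j = i then 4 * of_int (x i) else 0) - of_int (x j))"
      unfolding complex_dot_def by (intro sum.cong) (auto simp: a_def x)
    ultimately have "(of_int (4 * x i - (\<Sum>j\<in>UNIV. x j)) :: complex) = of_int (8 * k)"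
      by (simp add: sum_subtractf)
    then have "4 * x i - (\<Sum>j\<in>UNIV. x j) = 8 * k" by (simp only: of_int_eq_iff)
    then show ?thesis by simp
  qed
  have "(of_int (\<Sum>i\<in>UNIV. (x i)\<^sup>2) :: complex) = of_int 32" using norm by (simp add: x)
  then have n: "(\<Sum>i\<in>UNIV. (x i)\<^sup>2) = 32" by (simp only: of_int_eq_iff)
  have "(\<chi> i. of_int (x i)) \<in> leech_min_vectors C"
  proof (cases "\<forall>i. even (x i)")
    case True
    define y where "y i = x i div 2" for i
    have y: "x i = 2 * y i" for i using True by (simp add: y_def)
    have "(\<Sum>i\<in>UNIV. (y i)\<^sup>2) = 8"
      using n unfolding y by (simp add: power_mult_distrib flip: sum_distrib_left)
    moreover have "4 dvd (\<Sum>i\<in>UNIV. y i)"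
    proof -
      have "8 dvd 4 * (2 * y 0) - 2 * (\<Sum>j\<in>UNIV. y j)" using total[of 0] unfolding y sum_distrib_left .
      then show ?thesis by presburger
    qed
    moreover have "even (\<Sum>i\<in>S. y i)" if "S \<in> codeword_support ` C" "card S = 8" for S
    proof -
      have "4 dvd 2 * (\<Sum>i\<in>S. y i)" using octad[OF that] unfolding y sum_distrib_left .
      then show ?thesis by presburger
    qed
    ultimately have "(\<chi> i. 2 * of_int (y i)) \<in> leech_min_vectors C" by (rule even_case_is_minimal)
    then show ?thesis by (simp add: y)
  next
    case False
    then have "odd (x i)" for i using parity by blast
    then show ?thesis using n octad by (intro odd_case_is_minimal)
  qed
  moreover have "p = complex_vec (\<chi> i. of_int (x i))" by (simp add: complex_vec_def x vec_eq_iff)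
  ultimately show ?thesis by blast
qed

lemma complex_vec_inject: "complex_vec a = complex_vec b \<longleftrightarrow> a = b" for a b :: "real ^ 'n"
  by (simp add: complex_vec_def vec_eq_iff)

lemma complex_vec_norm: "(\<Sum>i\<in>UNIV. (complex_vec a $ i)\<^sup>2) = complex_of_real (a \<bullet> a)" for a :: "real ^ 'n::finite"
  by (simp add: complex_vec_def inner_vec_def power2_eq_square)

text \<open>The conditions of \<open>minimal_if_inner_products_integral\<close> are invariant under negation.\<close>

lemma uminus_minimal:
  assumes a: "a \<in> leech_min_vectors C"
  shows "- a \<in> leech_min_vectors C"
proof -
  have "complex_vec (- a) \<in> complex_vec ` leech_min_vectors C"
  proof (rule minimal_if_inner_products_integral)
    fix b assume b: "b \<in> leech_min_vectors C"
    have "b \<bullet> a \<in> {8 * of_int 4, 8 * of_int 2, 8 * of_int 1, 8 * of_int 0, 8 * of_int (- 1), 8 * of_int (- 2), 8 * of_int (- 4)}"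
      using inner_minimal_vectors(1)[OF b a] by simp
    then obtain k :: int where k: "b \<bullet> a = 8 * of_int k" by blast
    have "complex_dot b (complex_vec (- a)) = 8 * of_int (- k)"
      unfolding complex_dot_complex_vec by (simp add: k)
    then show "\<exists>k::int. complex_dot b (complex_vec (- a)) = 8 * of_int k" by blast
  next
    show "(\<Sum>i\<in>UNIV. (complex_vec (- a) $ i)\<^sup>2) = 32"
      unfolding complex_vec_norm using minimal_vector_norm[OF a] by simp
  qed
  then show ?thesis by (auto simp: complex_vec_inject)
qed

lemma span_minimal_vectors: "span (leech_min_vectors C) = UNIV"
proof -
  have "axis i 1 \<in> span (leech_min_vectors C)" for i
  proof -
    obtain j where "j \<noteq> i" using UNIV_24_other by blast
    then have "4 *\<^sub>R axis i 1 + 4 *\<^sub>R axis j 1 \<in> leech_min_vectors C"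
      "4 *\<^sub>R axis i 1 + (- 4) *\<^sub>R axis j 1 \<in> leech_min_vectors C"
      using two_nonzero_minimal[of i j 4 4] two_nonzero_minimal[of i j 4 "- 4"] by auto
    then have "4 *\<^sub>R axis i 1 + 4 *\<^sub>R axis j 1 \<in> span (leech_min_vectors C)"
      "4 *\<^sub>R axis i 1 + (- 4) *\<^sub>R axis j 1 \<in> span (leech_min_vectors C)"
      by (blast intro: span_base)+
    from span_scale[OF span_add[OF this], of "1 / 8"] show ?thesis
      by (simp add: algebra_simps flip: scaleR_add_left)
  qed
  then have "Basis \<subseteq> span (leech_min_vectors C)" by (auto simp: Basis_vec_def)
  then have "span Basis \<subseteq> span (leech_min_vectors C)" by (rule span_minimal) simp
  then show ?thesis by auto
qed

end


section \<open>Polynomials of small degree vanishing on the shortest vectors\<close>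

lemma poly_eval_homogeneous_scale:
  assumes "homogeneous d f"
  shows "poly_eval (z *s p) f = z ^ d * poly_eval p f"
  using assms unfolding poly_eval_superset[OF finite_keys order_refl] homogeneous_def sum_distrib_left
  by (intro sum.cong refl) (simp add: monomial_value_scale mult_ac)

lemma homogeneous_quotient_zero:
  assumes "homogeneous d f" "poly_eval (z *s p) f = 0" "z \<noteq> (0 :: 'a::idom)"
  shows "poly_eval p f = 0"
  using assms by (simp add: poly_eval_homogeneous_scale)

context golay_code
begin

lemma quintic_vanishing_on_minimal_vectors_eq_0:
  assumes f: "homogeneous 5 f"
    and zero: "\<And>v. v \<in> leech_min_vectors C \<Longrightarrow> poly_eval (complex_vec v) f = 0"
  shows "f = 0"
proof (rule quintic_eq_0[OF f])
  fix i j :: 24 and S :: "24 set"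
  assume ij: "i \<noteq> j" "S \<subseteq> {i, j}"
  define v :: "real ^ 24" where "v = (\<chi> k. if k \<in> {i, j} then if k \<in> S then -4 else 4 else 0)"
  have "v \<in> leech_shape4" unfolding leech_shape4_def mem_Collect_eq
    by (rule exI[of _ i], rule exI[of _ j]) (use ij in \<open>auto simp: v_def\<close>)
  moreover have "4 *s flip_signs S (char_vec {i, j}) = complex_vec v"
    using ij(2) by (auto simp: vec_eq_iff v_def complex_vec_def flip_signs_def char_vec_def)
  ultimately have "poly_eval (4 *s flip_signs S (char_vec {i, j})) f = 0"
    using zero[of v] by (simp only: leech_min_vectors_def Un_iff simp_thms)
  then show "poly_eval (flip_signs S (char_vec {i, j})) f = 0"
    by (rule homogeneous_quotient_zero[OF f]) simp
next
  fix Q S assume Q: "Q \<in> octads" and S: "S \<subseteq> Q" "even (card S)"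
  define v :: "real ^ 24" where "v = (\<chi> k. if k \<in> Q then if k \<in> S then -2 else 2 else 0)"
  obtain w where w: "w \<in> C" "codeword_support w = Q" "card Q = 8" using Q by (auto simp: octads_def)
  have neg: "{k. v $ k < 0} = S"
  proof (rule set_eqI)
    fix k show "k \<in> {k. v $ k < 0} \<longleftrightarrow> k \<in> S" using S(1) by (auto simp: v_def)
  qed
  have on: "v $ k \<in> {2, - 2}" if "k \<in> Q" for k using that by (simp add: v_def)
  have off: "v $ k = 0" if "k \<notin> Q" for k using that by (simp add: v_def)
  have "v \<in> leech_shape2 C" unfolding leech_shape2_def mem_Collect_eq
  proof (rule bexI[OF _ w(1)], intro conjI ballI allI impI)
    show "card (codeword_support w) = 8" using w by simp
    show "even (card {k. v $ k < 0})" unfolding neg by (rule S(2))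
  qed (use on off w(2) in \<open>simp_all only:\<close>)
  moreover have "2 *s flip_signs S (char_vec Q) = complex_vec v"
    using S(1) by (auto simp: vec_eq_iff v_def complex_vec_def flip_signs_def char_vec_def)
  ultimately have "poly_eval (2 *s flip_signs S (char_vec Q)) f = 0"
    using zero[of v] by (simp only: leech_min_vectors_def Un_iff simp_thms)
  then show "poly_eval (flip_signs S (char_vec Q)) f = 0"
    by (rule homogeneous_quotient_zero[OF f]) simp
next
  fix i S assume "S \<in> codeword_support ` C"
  then obtain w where w: "w \<in> C" "S = codeword_support w" by blast
  define v :: "real ^ 24" where "v = (\<chi> j. if j = i then (if j \<in> codeword_support w then -3 else 3)
            else (if j \<in> codeword_support w then 1 else -1))"
  have "v \<in> leech_shape3 C" unfolding leech_shape3_def v_def using w(1) by blast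
  moreover have "flip_signs S (shape3_base i) = complex_vec v"
    by (auto simp: vec_eq_iff v_def complex_vec_def flip_signs_def shape3_base_def w(2))
  ultimately show "poly_eval (flip_signs S (shape3_base i)) f = 0"
    using zero[of v] by (simp only: leech_min_vectors_def Un_iff simp_thms)
qed

end

definition norm_form :: "(24, complex) mpoly" where
  "norm_form = Const (1 / 32) * (\<Sum>i\<in>UNIV. Var i ^ 2)"

lemma homogeneous_norm_form: "homogeneous 2 norm_form"
proof -
  have "homogeneous (0 + 1 * 2) norm_form"
    unfolding norm_form_def
    by (intro homogeneous_mult homogeneous_Const homogeneous_sum homogeneous_power homogeneous_Var)
  then show ?thesis by (simp add: numeral_2_eq_2)
qed

lemma Nm_dvd_norm_form: "Nm dvd norm_form - 1"
proof
  have "Const (1 / 32) * Const 32 = (1 :: (24, complex) mpoly)" by (simp flip: Const_mult)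
  then show "norm_form - 1 = Nm * Const (1 / 32)"
    by (simp add: norm_form_def Nm_def algebra_simps)
qed

lemma Nm_dvd_norm_form_power: "Nm dvd norm_form ^ k - 1"
proof -
  have "norm_form - 1 dvd norm_form ^ k - 1 ^ k"
    unfolding power_diff_sumr2 by simp
  then show ?thesis using Nm_dvd_norm_form dvd_trans by simp
qed

text \<open>
  Since \<open>norm_form\<close> has degree 2 and is 1 modulo \<open>Nm\<close>, its powers raise all terms to the same degree
  if their degrees have the same parity.
\<close>

lemma homogenise_mod_Nm:
  fixes f :: "(24, complex) mpoly"
  assumes f: "\<forall>m\<in>keys f. exponent_sum m \<le> d \<and> even (d - exponent_sum m)"
  shows "\<exists>g. homogeneous d g \<and> Nm dvd f - g \<and>
    (\<forall>p. poly_eval p Nm = 0 \<longrightarrow> poly_eval p g = poly_eval p f)"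
proof -
  let ?s = "\<lambda>m. single m (lookup f m)"
  define g where "g = (\<Sum>m\<in>keys f. ?s m * norm_form ^ ((d - exponent_sum m) div 2))"
  have "homogeneous d (?s m * norm_form ^ ((d - exponent_sum m) div 2))" if m: "m \<in> keys f" for m
  proof -
    have "homogeneous (exponent_sum m + 2 * ((d - exponent_sum m) div 2))
        (?s m * norm_form ^ ((d - exponent_sum m) div 2))"
      by (intro homogeneous_mult homogeneous_single homogeneous_power homogeneous_norm_form)
    moreover have "exponent_sum m + 2 * ((d - exponent_sum m) div 2) = d" using f m by auto
    ultimately show ?thesis by simp
  qed
  then have "homogeneous d g" unfolding g_def by (rule homogeneous_sum)
  moreover have dvd: "Nm dvd f - g"
  proof -
    have "f - g = (\<Sum>m\<in>keys f. ?s m - ?s m * norm_form ^ ((d - exponent_sum m) div 2))"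
      unfolding g_def sum_subtractf poly_mapping_sum_singles[symmetric] ..
    also have "\<dots> = (\<Sum>m\<in>keys f. - ?s m * (norm_form ^ ((d - exponent_sum m) div 2) - 1))"
      by (intro sum.cong refl) (simp add: algebra_simps)
    also have "Nm dvd \<dots>" by (intro dvd_sum dvd_mult Nm_dvd_norm_form_power)
    finally show ?thesis .
  qed
  moreover have "poly_eval p g = poly_eval p f" if "poly_eval p Nm = 0" for p
  proof -
    obtain h where "f - g = Nm * h" using dvd by blast
    then have "poly_eval p (f - g) = 0" using that by simp
    then show ?thesis by simp
  qed
  ultimately show ?thesis by blast
qed

lemma poly_eval_Nm: "poly_eval p Nm = (\<Sum>i\<in>UNIV. (p $ i)\<^sup>2) - 32"
  by (simp add: Nm_def)

lemma poly_eval_minus_vec: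
  assumes "\<And>m. m \<in> keys f \<Longrightarrow> even (exponent_sum m) \<longleftrightarrow> b"
  shows "poly_eval (- p) f = (if b then poly_eval p f else - poly_eval p f)"
proof -
  have "- p = (-1) *s p" by (simp add: vec_eq_iff)
  then have "poly_eval (- p) f = (\<Sum>m\<in>keys f. (if b then 1 else -1) * (lookup f m * monomial_value p m))"
    unfolding poly_eval_superset[OF finite_keys order_refl]
    using assms by (intro sum.cong refl) (auto simp: monomial_value_scale)
  also have "\<dots> = (if b then 1 else -1) * poly_eval p f"
    unfolding poly_eval_superset[OF finite_keys order_refl] sum_distrib_left ..
  finally show ?thesis by simp
qed

context golay_code
begin

lemma poly_eval_Nm_minimal: "v \<in> leech_min_vectors C \<Longrightarrow> poly_eval (complex_vec v) Nm = 0"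
  by (simp add: poly_eval_Nm complex_vec_norm minimal_vector_norm)

text \<open>
  The set of shortest vectors is antipodal, so the even and the odd part of \<open>f\<close> vanish on it
  separately. Modulo \<open>Nm\<close> they are congruent to forms of degree 4 and 5, and a quartic becomes a
  quintic after multiplication by a variable.
\<close>

theorem Nm_dvd_of_degree_le_5:
  assumes deg: "total_degree f \<le> 5"
    and zero: "\<And>v. v \<in> leech_min_vectors C \<Longrightarrow> poly_eval (complex_vec v) f = 0"
  shows "Nm dvd f"
proof -
  let ?s = "\<lambda>m. single m (lookup f m)"
  define part where "part b = (\<Sum>m\<in>{m \<in> keys f. even (exponent_sum m) = b}. ?s m)" for b
  have look: "lookup (part b) m = (if even (exponent_sum m) = b then lookup f m else 0)" for b m
    by (auto simp: part_def lookup_sum lookup_single when_def in_keys_iff)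
  have keys: "m \<in> keys f" "even (exponent_sum m) = b" if "m \<in> keys (part b)" for m b
    using that by (auto simp: in_keys_iff look split: if_splits)
  have f: "f = part True + part False"
    by (rule poly_mapping_eqI) (simp add: lookup_add look)
  have part0: "poly_eval (complex_vec v) (part b) = 0" if v: "v \<in> leech_min_vectors C" for v b
  proof -
    have "complex_vec (- v) = - complex_vec v" by (simp add: complex_vec_def vec_eq_iff)
    then have "poly_eval (- complex_vec v) f = 0" using zero[OF uminus_minimal[OF v]] by simp
    then have 1: "poly_eval (- complex_vec v) (part True) + poly_eval (- complex_vec v) (part False) = 0"
      unfolding poly_eval_add[symmetric] f[symmetric] .
    have 2: "poly_eval (complex_vec v) (part True) + poly_eval (complex_vec v) (part False) = 0"
      using zero[OF v] unfolding poly_eval_add[symmetric] f[symmetric] .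
    have "poly_eval (- complex_vec v) (part True) = poly_eval (complex_vec v) (part True)"
      by (subst poly_eval_minus_vec[of "part True" True]) (use keys in auto)
    moreover have "poly_eval (- complex_vec v) (part False) = - poly_eval (complex_vec v) (part False)"
      by (subst poly_eval_minus_vec[of "part False" False]) (use keys in auto)
    ultimately have "poly_eval (complex_vec v) (part True) = poly_eval (complex_vec v) (part False)"
      using 1 by simp
    then show ?thesis using 2 by (cases b) auto
  qed
  have deg5: "exponent_sum m \<le> 5" if "m \<in> keys f" for m
    using deg that by (simp add: total_degree_le_iff)
  have "\<forall>m\<in>keys (part False). exponent_sum m \<le> 5 \<and> even (5 - exponent_sum m)"
  proof
    fix m assume m: "m \<in> keys (part False)"
    show "exponent_sum m \<le> 5 \<and> even (5 - exponent_sum m)" using keys[OF m] deg5 by auto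
  qed
  from homogenise_mod_Nm[OF this] obtain g5 where g5: "homogeneous 5 g5" "Nm dvd part False - g5"
    "\<And>p. poly_eval p Nm = 0 \<Longrightarrow> poly_eval p g5 = poly_eval p (part False)"
    by blast
  have "g5 = 0"
    using g5(3) part0 poly_eval_Nm_minimal by (intro quintic_vanishing_on_minimal_vectors_eq_0 g5(1)) simp
  have "\<forall>m\<in>keys (part True). exponent_sum m \<le> 4 \<and> even (4 - exponent_sum m)"
  proof
    fix m assume m: "m \<in> keys (part True)"
    have "exponent_sum m \<noteq> 5" "exponent_sum m \<le> 5" using keys[OF m] deg5 by auto
    then show "exponent_sum m \<le> 4 \<and> even (4 - exponent_sum m)" using keys[OF m] by auto
  qed
  from homogenise_mod_Nm[OF this] obtain g4 where g4: "homogeneous 4 g4" "Nm dvd part True - g4"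
    "\<And>p. poly_eval p Nm = 0 \<Longrightarrow> poly_eval p g4 = poly_eval p (part True)"
    by blast
  have "homogeneous 5 (Var 0 * g4)" using homogeneous_mult[OF homogeneous_Var[of 0] g4(1)] by simp
  then have "Var 0 * g4 = 0"
    using g4(3) part0 poly_eval_Nm_minimal by (intro quintic_vanishing_on_minimal_vectors_eq_0) auto
  moreover have "(Var 0 :: (24, complex) mpoly) \<noteq> 0"
  proof
    assume "(Var 0 :: (24, complex) mpoly) = 0"
    then have "poly_eval (1 :: complex ^ 24) (Var 0) = 0" by simp
    then show False by simp
  qed
  ultimately have "g4 = 0" by simp
  have "Nm dvd part True" "Nm dvd part False" using g4(2) g5(2) \<open>g4 = 0\<close> \<open>g5 = 0\<close> by simp_all
  then show ?thesis unfolding f by (rule dvd_add)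
qed

end


section \<open>The ideal of the shortest vectors\<close>

lemma poly_eval_linear_form [simp]: "poly_eval p (linear_form a) = complex_dot a p"
  by (simp add: linear_form_def complex_dot_def)

lemma linear_form_add: "linear_form (a + b) = linear_form a + linear_form b"
  by (simp add: linear_form_def Const_add sum.distrib distrib_right)

lemma linear_form_scaleR: "linear_form (r *\<^sub>R a) = Const (complex_of_real r) * linear_form a"
  by (simp add: linear_form_def Const_mult sum_distrib_left mult.assoc)

lemma linear_form_0 [simp]: "linear_form 0 = 0"
  by (simp add: linear_form_def)

lemma linear_form_axis: "linear_form (axis j 1) = Var j"
proof -
  have "linear_form (axis j 1) = (\<Sum>i\<in>UNIV. if i = j then Var j else 0)"
    unfolding linear_form_def by (intro sum.cong) (auto simp: axis_def)
  then show ?thesis by simp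
qed

definition omega_product :: "complex \<Rightarrow> complex" where
  "omega_product z = (\<Prod>h = 1..5. z - complex_of_real (omega h))"

lemma prod_1_5: "(\<Prod>h = 1..5. f h) = f 1 * f 2 * f 3 * f 4 * (f (5::nat) :: 'a::comm_monoid_mult)"
proof -
  have "{1..5} = {1, 2, 3, 4, 5 :: nat}" by auto
  then show ?thesis by (simp add: mult_ac)
qed

lemma omega_product_eq_0_iff: "omega_product z = 0 \<longleftrightarrow> z \<in> {16, 8, 0, -8, -16}"
  unfolding omega_product_def prod_1_5 by (auto simp: omega_def eq_neg_iff_add_eq_0)

lemma poly_eval_S_poly:
  "poly_eval p (S_poly a b) = complex_dot b p * omega_product (complex_dot a p)"
  by (simp add: S_poly_def omega_product_def)

lemma orthogonal_basis_insertD: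
  fixes a b :: "'a::euclidean_space"
  assumes basis: "orthogonal_basis (insert a X)" and card: "card X < DIM('a)" and b: "b \<in> X"
  shows "orthogonal a b" "b \<noteq> 0"
proof -
  have ind: "independent (insert a X)" and sp: "span (insert a X) = UNIV"
    and orth: "pairwise orthogonal (insert a X)"
    using basis unfolding orthogonal_basis_def by blast+
  have "dim (span (insert a X)) = DIM('a)" unfolding sp by (rule dim_UNIV)
  then have "card (insert a X) = DIM('a)" using dim_eq_card_independent[OF ind] by (simp only: dim_span)
  then have "a \<notin> X" using card insert_absorb[of a X] by (metis less_irrefl)
  then have "a \<noteq> b" using b by blast
  then show "orthogonal a b" using pairwiseD[OF orth] b by blast
  show "b \<noteq> 0" using ind dependent_zero b by blast
qed

locale leech_generators = golay_code C for C +
  fixes R :: "(real ^ 24) set" and c :: "real ^ 24 \<Rightarrow> nat \<Rightarrow> real ^ 24"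
  assumes reps: "antipodal_representatives (leech_min_vectors C) R"
    and basis: "\<And>a. a \<in> R \<Longrightarrow> orthogonal_basis (insert a (c a ` {1..23}))"
begin

lemma R_minimal: "a \<in> R \<Longrightarrow> a \<in> leech_min_vectors C"
  using reps by (auto simp: antipodal_representatives_def)

lemma minimal_cases:
  assumes "v \<in> leech_min_vectors C"
  obtains a where "a \<in> R" "v = a \<or> v = - a"
proof -
  have "\<exists>!b. b \<in> R \<and> (b = v \<or> b = - v)"
    using reps assms unfolding antipodal_representatives_def by (elim conjE) (rule bspec)
  then obtain b where b: "b \<in> R" "b = v \<or> b = - v" by blast
  have "v = b \<or> v = - b" using b(2) by (elim disjE) simp_all
  then show ?thesis using that[OF b(1)] by blast
qed

lemma basis_vectors:
  assumes "a \<in> R" "i \<in> {1..23}"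
  shows "a \<bullet> c a i = 0" "c a i \<noteq> 0"
proof -
  have card: "card (c a ` {1..23}) < DIM(real ^ 24)"
    using card_image_le[of "{1..23::nat}" "c a"] by simp
  have "c a i \<in> c a ` {1..23}" using assms(2) by blast
  from orthogonal_basis_insertD[OF basis[OF assms(1)] card this]
  show "a \<bullet> c a i = 0" "c a i \<noteq> 0" by (simp_all add: orthogonal_def)
qed

lemma span_basis: "a \<in> R \<Longrightarrow> span (insert a (c a ` {1..23})) = UNIV"
  using basis by (auto simp: orthogonal_basis_def)

lemma basis_induct [consumes 1, case_names zero step]:
  assumes "a \<in> R" "P 0" "\<And>r x y. (x = a \<or> (\<exists>i\<in>{1..23}. x = c a i)) \<Longrightarrow> P y \<Longrightarrow> P (r *\<^sub>R x + y)"
  shows "P b"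
proof -
  have "b \<in> span (insert a (c a ` {1..23}))" using span_basis[OF assms(1)] by simp
  then show ?thesis by (induction rule: span_induct_alt) (use assms in auto)
qed

lemma R_nonempty: "R \<noteq> {}"
proof -
  have "4 *\<^sub>R axis 0 1 + 4 *\<^sub>R axis 1 1 \<in> leech_min_vectors C" by (intro two_nonzero_minimal) auto
  then show ?thesis using minimal_cases by blast
qed

lemma Nm_in_generators: "Nm \<in> generators R c"
  by (simp add: generators_def)

lemma S_poly_in_generators: "a \<in> R \<Longrightarrow> i \<in> {1..23} \<Longrightarrow> S_poly a (c a i) \<in> generators R c"
  unfolding generators_def by blast

lemma zero_set_generators_iff:
  "p \<in> zero_set (generators R c) \<longleftrightarrow> poly_eval p Nm = 0 \<and>
    (\<forall>a\<in>R. \<forall>i\<in>{1..23}. complex_dot (c a i) p * omega_product (complex_dot a p) = 0)"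
proof
  assume p: "p \<in> zero_set (generators R c)"
  then have z: "poly_eval p f = 0" if "f \<in> generators R c" for f using that by (simp add: zero_set_def)
  show "poly_eval p Nm = 0 \<and>
    (\<forall>a\<in>R. \<forall>i\<in>{1..23}. complex_dot (c a i) p * omega_product (complex_dot a p) = 0)"
    using z[OF Nm_in_generators] z[OF S_poly_in_generators] by (simp only: poly_eval_S_poly) blast
next
  assume p: "poly_eval p Nm = 0 \<and>
    (\<forall>a\<in>R. \<forall>i\<in>{1..23}. complex_dot (c a i) p * omega_product (complex_dot a p) = 0)"
  have "poly_eval p f = 0" if f: "f \<in> generators R c" for f
  proof (cases "f = Nm")
    case False
    then obtain a i where "f = S_poly a (c a i)" "a \<in> R" "i \<in> {1..23}"
      using f unfolding generators_def by blast
    then show ?thesis using p by (simp only: poly_eval_S_poly)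
  qed (use p in simp)
  then show "p \<in> zero_set (generators R c)" by (simp add: zero_set_def)
qed

lemma minimal_in_zero_set:
  assumes v: "v \<in> leech_min_vectors C"
  shows "complex_vec v \<in> zero_set (generators R c)"
  unfolding zero_set_generators_iff
proof (intro conjI ballI)
  show "poly_eval (complex_vec v) Nm = 0" by (rule poly_eval_Nm_minimal[OF v])
  fix a i assume a: "a \<in> R" and i: "i \<in> {1..23::nat}"
  show "complex_dot (c a i) (complex_vec v) *
      omega_product (complex_dot a (complex_vec v)) = 0"
  proof (cases "a \<bullet> v = 32 \<or> a \<bullet> v = - 32")
    case True
    then have "v = a \<or> v = - a" using inner_minimal_vectors[OF R_minimal[OF a] v] by auto
    then have "c a i \<bullet> v = 0" using basis_vectors(1)[OF a i] by (auto simp: inner_commute)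
    then show ?thesis by (simp add: complex_dot_complex_vec)
  next
    case False
    then have "a \<bullet> v \<in> {16, 8, 0, -8, -16}" using inner_minimal_vectors(1)[OF R_minimal[OF a] v] by auto
    then have "complex_of_real (a \<bullet> v) \<in> {16, 8, 0, -8, -16}" by auto
    then show ?thesis unfolding complex_dot_complex_vec using omega_product_eq_0_iff by simp
  qed
qed

text \<open>
  If \<open>a \<cdot> p\<close> is none of the numbers \<open>\<omega>\<^sub>h\<close> for some \<open>a\<close>, then \<open>p\<close> is orthogonal to all \<open>c\<^sub>i(a)\<close> and
  hence a multiple of \<open>a\<close>. Otherwise all inner products of \<open>p\<close> with shortest vectors are integral.
\<close>

theorem zero_set_generators: "zero_set (generators R c) = complex_vec ` leech_min_vectors C"
proof
  show "complex_vec ` leech_min_vectors C \<subseteq> zero_set (generators R c)"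
    using minimal_in_zero_set by blast
  show "zero_set (generators R c) \<subseteq> complex_vec ` leech_min_vectors C"
  proof
    fix p assume p: "p \<in> zero_set (generators R c)"
    then have norm: "(\<Sum>i\<in>UNIV. (p $ i)\<^sup>2) = 32"
      by (simp add: zero_set_generators_iff poly_eval_Nm)
    show "p \<in> complex_vec ` leech_min_vectors C"
    proof (cases "\<exists>a\<in>R. complex_dot a p \<notin> {16, 8, 0, -8, -16}")
      case True
      then obtain a where a: "a \<in> R" "complex_dot a p \<notin> {16, 8, 0, -8, -16}" by blast
      then have c0: "complex_dot (c a i) p = 0" if "i \<in> {1..23}" for i
        using p that omega_product_eq_0_iff[of "complex_dot a p"] unfolding zero_set_generators_iff
        by (metis mult_eq_0_iff)
      define z where "z = complex_dot a p / 32"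
      have "complex_dot b p = z * complex_of_real (a \<bullet> b)" for b
        using a(1)
      proof (induction b rule: basis_induct)
        case (step r x y)
        have "complex_dot x p = z * complex_of_real (a \<bullet> x)"
          using step.hyps(1) c0 basis_vectors(1)[OF a(1)] minimal_vector_norm[OF R_minimal[OF a(1)]]
          by (auto simp: z_def)
        then show ?case using step.IH by (simp add: complex_dot_linear inner_add_right algebra_simps)
      qed (simp add: complex_dot_linear)
      then have "p $ j = z * complex_of_real (a $ j)" for j
        using complex_dot_axis[of j p] by (simp add: inner_axis)
      then have pz: "p = z *s complex_vec a" by (simp add: vec_eq_iff complex_vec_def)
      have "z\<^sup>2 * 32 = 32"
        using norm complex_vec_norm[of a] minimal_vector_norm[OF R_minimal[OF a(1)]]
        unfolding pz by (simp add: power_mult_distrib flip: sum_distrib_left)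
      then have "z = 1 \<or> z = - 1" by (simp add: power2_eq_1_iff)
      then have "p = complex_vec a \<or> p = complex_vec (- a)"
        unfolding pz by (auto simp: complex_vec_def vec_eq_iff)
      then show ?thesis using R_minimal[OF a(1)] uminus_minimal by blast
    next
      case False
      show ?thesis
      proof (rule minimal_if_inner_products_integral[OF _ norm])
        fix v assume "v \<in> leech_min_vectors C"
        then obtain a where a: "a \<in> R" "v = a \<or> v = - a" by (rule minimal_cases)
        have "complex_dot a p \<in> {8 * of_int 2, 8 * of_int 1, 8 * of_int 0, 8 * of_int (- 1), 8 * of_int (- 2)}"
          using False a(1) by auto
        then obtain k :: int where "complex_dot a p = 8 * of_int k" by blast
        then have "complex_dot v p = 8 * of_int k \<or> complex_dot v p = 8 * of_int (- k)"
          using a(2) by (auto simp: complex_dot_linear)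
        then show "\<exists>k::int. complex_dot v p = 8 * of_int k" by blast
      qed
    qed
  qed
qed

text \<open>
  At \<open>p = \<plusminus>a\<close> the gradient of \<open>Nm\<close> is \<open>2p\<close> and the gradient of \<open>S\<^sub>a\<^sub>,\<^sub>i\<close> is a non-zero multiple of
  \<open>c\<^sub>i(a)\<close>, because the factor \<open>c\<^sub>i(a) \<cdot> Y\<close> vanishes at \<open>p\<close> and the other factors do not.
\<close>

lemma jacobian_row_Nm: "jacobian_row p Nm = 2 *s p"
proof -
  have "poly_eval p (partial_deriv j Nm) = 2 * p $ j" for j
  proof (rule poly_eval_partial_deriv_eqI)
    have val: "poly_eval (p + t *s axis j 1) Nm = poly_eval p Nm + 2 * t * p $ j + t\<^sup>2" for t
    proof -
      have "(\<Sum>i\<in>UNIV. ((p + t *s axis j 1) $ i)\<^sup>2) =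
          (\<Sum>i\<in>UNIV. (p $ i)\<^sup>2 + (if i = j then 2 * t * p $ j + t\<^sup>2 else 0))"
        by (intro sum.cong) (auto simp: axis_def power2_eq_square algebra_simps)
      then show ?thesis by (simp add: poly_eval_Nm sum.distrib)
    qed
    show "((\<lambda>t. poly_eval (p + t *s axis j 1) Nm) has_field_derivative 2 * p $ j) (at 0)"
      unfolding val by (auto intro!: derivative_eq_intros)
  qed
  then show ?thesis by (simp add: jacobian_row_def vec_eq_iff)
qed

lemma jacobian_row_S_poly:
  assumes "complex_dot b p = 0"
  shows "jacobian_row p (S_poly a b) =
    omega_product (complex_dot a p) *s complex_vec b"
proof -
  let ?K = "\<lambda>(t :: complex) j. omega_product (complex_dot a p + t * complex_of_real (a $ j))"
  have "poly_eval p (partial_deriv j (S_poly a b)) = ?K 0 j * complex_of_real (b $ j)" for j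
  proof (rule poly_eval_partial_deriv_eqI)
    have dot: "complex_dot x (p + t *s axis j 1) = complex_dot x p + t * complex_of_real (x $ j)" for x :: "real ^ 24" and t
    proof -
      have "complex_dot x (axis j 1) = (\<Sum>i\<in>UNIV. if i = j then complex_of_real (x $ j) else 0)"
        unfolding complex_dot_def by (intro sum.cong) (auto simp: axis_def)
      then show ?thesis by (simp add: complex_dot_right)
    qed
    have "\<exists>D. ((\<lambda>t. ?K t j) has_field_derivative D) (at 0)"
      unfolding omega_product_def prod_1_5 by (rule exI) (rule derivative_eq_intros refl)+
    then obtain D where "((\<lambda>t. ?K t j) has_field_derivative D) (at 0)" by blast
    from DERIV_mult[OF DERIV_cmult_right[OF DERIV_ident, of "complex_of_real (b $ j)"] this]
    show "((\<lambda>t. poly_eval (p + t *s axis j 1) (S_poly a b)) has_field_derivative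
        ?K 0 j * complex_of_real (b $ j)) (at 0)"
      unfolding poly_eval_S_poly dot by (simp add: assms mult_ac)
  qed
  then show ?thesis by (simp add: jacobian_row_def vec_eq_iff complex_vec_def)
qed

theorem zeros_simple:
  assumes p: "p \<in> zero_set (ideal_generated (generators R c))"
  shows "simple_zero (generators R c) p"
proof -
  obtain v where v: "v \<in> leech_min_vectors C" "p = complex_vec v"
    using p unfolding zero_set_ideal_generated zero_set_generators by blast
  then obtain a where a: "a \<in> R" "v = a \<or> v = - a" using minimal_cases by blast
  let ?W = "vec.span (jacobian_row p ` generators R c)"
  let ?K = "omega_product (complex_dot a p)"
  have pa: "complex_vec a = (1 / 2) *s jacobian_row p Nm \<or> complex_vec a = (- 1 / 2) *s jacobian_row p Nm"
    using a(2) by (auto simp: jacobian_row_Nm v(2) complex_vec_def vec_eq_iff)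
  moreover have "jacobian_row p Nm \<in> ?W"
    by (intro vec.span_base imageI Nm_in_generators)
  ultimately have aW: "complex_vec a \<in> ?W" by (metis vec.span_scale)
  have "complex_dot a p = 32 \<or> complex_dot a p = - 32"
    using a(2) minimal_vector_norm[OF R_minimal[OF a(1)]] by (auto simp: v(2) complex_dot_complex_vec)
  then have K: "?K \<noteq> 0" using omega_product_eq_0_iff[of "complex_dot a p"] by auto
  have cW: "complex_vec (c a i) \<in> ?W" if i: "i \<in> {1..23}" for i
  proof -
    have "complex_dot (c a i) p = 0"
      using basis_vectors(1)[OF a(1) i] a(2) by (auto simp: v(2) complex_dot_complex_vec inner_commute)
    then have "jacobian_row p (S_poly a (c a i)) = ?K *s complex_vec (c a i)" by (rule jacobian_row_S_poly)
    then have "complex_vec (c a i) = (1 / ?K) *s jacobian_row p (S_poly a (c a i))" using K by simp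
    moreover have "jacobian_row p (S_poly a (c a i)) \<in> ?W"
      using a(1) i by (intro vec.span_base imageI S_poly_in_generators)
    ultimately show ?thesis by (metis vec.span_scale)
  qed
  have all: "complex_vec b \<in> ?W" for b
    using a(1)
  proof (induction b rule: basis_induct)
    case zero
    have "complex_vec 0 = (0 :: complex ^ 24)" by (simp add: complex_vec_def vec_eq_iff)
    then show ?case by (simp add: vec.span_zero)
  next
    case (step r x y)
    have "complex_vec x \<in> ?W" using step.hyps(1) aW cW by auto
    moreover have "complex_vec (r *\<^sub>R x + y) = complex_of_real r *s complex_vec x + complex_vec y"
      by (simp add: complex_vec_def vec_eq_iff)
    ultimately show ?case using step.IH by (simp add: vec.span_add vec.span_scale)
  qed
  have "q \<in> ?W" for q
  proof -
    have "q = (\<Sum>j\<in>UNIV. q $ j *s complex_vec (axis j 1))"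
      by (simp add: vec_eq_iff complex_vec_def axis_def if_distrib[of "\<lambda>z. _ * z"] if_distrib[of complex_of_real] cong: if_cong)
    also have "\<dots> \<in> ?W" by (intro vec.span_sum vec.span_scale all)
    finally show ?thesis .
  qed
  then have "?W = UNIV" by blast
  then have "vec.dim (jacobian_row p ` generators R c) = CARD(24)"
    using vec.dim_span[of "jacobian_row p ` generators R c"] by (simp add: card_cart_basis)
  then show ?thesis using p by (simp add: simple_zero_def)
qed

text \<open>
  Each form \<open>a \<cdot> Y\<close> satisfies an equation of degree 7 with simple roots modulo the ideal. Indeed
  \<open>(b - (a \<bullet> b / 32) a) \<cdot> Y\<close>, multiplied by \<open>\<Prod>\<^sub>h (a \<cdot> Y - \<omega>\<^sub>h)\<close>, lies in the ideal for all \<open>b\<close>, since it does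
  so for the basis; then take the unit vectors for \<open>b\<close> and sum squares.
\<close>

lemma linear_form_annihilator:
  assumes a: "a \<in> R"
  shows "(\<Prod>r\<in>{32, 16, 8, 0, -8, -16, -32}. linear_form a - Const r) \<in> ideal_generated (generators R c)"
proof -
  let ?J = "ideal_generated (generators R c)" and ?l = "linear_form a"
  define P where "P = (\<Prod>h = 1..5. ?l - Const (complex_of_real (omega h)))"
  let ?E = "P * ((\<Sum>j\<in>UNIV. Var j ^ 2) - Const (1 / 32) * ?l ^ 2)"
  have aa: "a \<bullet> a = 32" by (rule minimal_vector_norm[OF R_minimal[OF a]])
  have P: "P * (linear_form b - Const (complex_of_real (a \<bullet> b / 32)) * ?l) \<in> ?J" for b
    using a
  proof (induction b rule: basis_induct)
    case zero
    show ?case by (simp add: ideal_generated_0)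
  next
    case (step r x y)
    have x: "P * (linear_form x - Const (complex_of_real (a \<bullet> x / 32)) * ?l) \<in> ?J"
    proof (cases "x = a")
      case True
      then show ?thesis by (simp add: aa ideal_generated_0)
    next
      case False
      then obtain i where i: "i \<in> {1..23}" "x = c a i" using step.hyps(1) by blast
      then have "S_poly a x \<in> ?J" using a by (simp only: ideal_generated_base S_poly_in_generators)
      then show ?thesis using basis_vectors(1)[OF a i(1)] i(2) by (simp add: S_poly_def P_def mult.commute)
    qed
    have "P * (linear_form (r *\<^sub>R x + y) - Const (complex_of_real (a \<bullet> (r *\<^sub>R x + y) / 32)) * ?l) =
        Const (complex_of_real r) * (P * (linear_form x - Const (complex_of_real (a \<bullet> x / 32)) * ?l))
        + P * (linear_form y - Const (complex_of_real (a \<bullet> y / 32)) * ?l)"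
    proof -
      have "complex_of_real (a \<bullet> (r *\<^sub>R x + y) / 32) =
          complex_of_real r * complex_of_real (a \<bullet> x / 32) + complex_of_real (a \<bullet> y / 32)"
        by (simp add: inner_add_right add_divide_distrib)
      then show ?thesis
        by (simp only: linear_form_add linear_form_scaleR Const_add Const_mult) (simp add: algebra_simps)
    qed
    then show ?case using x step.IH by (simp only: ideal_generated_add ideal_generated_mult)
  qed
  have sq: "P * (Var j ^ 2 - Const (complex_of_real ((a $ j)\<^sup>2 / 1024)) * ?l ^ 2) \<in> ?J" for j
  proof -
    let ?k = "Const (complex_of_real (a $ j / 32)) :: (24, complex) mpoly"
    have "P * (Var j - ?k * ?l) \<in> ?J" using P[of "axis j 1"] by (simp add: linear_form_axis inner_axis)
    then have "(Var j + ?k * ?l) * (P * (Var j - ?k * ?l)) \<in> ?J" by (rule ideal_generated_mult)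
    moreover have "Const (complex_of_real ((a $ j)\<^sup>2 / 1024)) = ?k * ?k"
      by (simp add: power2_eq_square flip: Const_mult)
    ultimately show ?thesis by (simp add: power2_eq_square algebra_simps)
  qed
  have "(\<Sum>j\<in>UNIV. P * (Var j ^ 2 - Const (complex_of_real ((a $ j)\<^sup>2 / 1024)) * ?l ^ 2)) \<in> ?J"
    by (intro ideal_generated_sum sq)
  also have "(\<Sum>j\<in>UNIV. P * (Var j ^ 2 - Const (complex_of_real ((a $ j)\<^sup>2 / 1024)) * ?l ^ 2)) =
      P * ((\<Sum>j\<in>UNIV. Var j ^ 2) - Const (complex_of_real (\<Sum>j\<in>UNIV. (a $ j)\<^sup>2 / 1024)) * ?l ^ 2)"
    by (simp add: sum_subtractf Const_sum sum_distrib_right flip: sum_distrib_left)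
  also have "(\<Sum>j\<in>UNIV. (a $ j)\<^sup>2 / 1024) = 1 / 32"
    using aa by (simp add: inner_vec_def power2_eq_square flip: sum_divide_distrib)
  finally have "?E \<in> ?J" by simp
  moreover have "P * Nm \<in> ?J" by (intro ideal_generated_mult ideal_generated_base Nm_in_generators)
  ultimately have "?E - P * Nm \<in> ?J"
    by (rule ideal_generated_diff)
  \<comment> \<open>Multiplied by \<open>- 32\<close>, the difference \<open>32 - l\<^sup>2 / 32\<close> is \<open>(l - 32) (l + 32)\<close>.\<close>
  then have "Const (- 32) * (?E - P * Nm) \<in> ?J"
    by (rule ideal_generated_mult)
  also have "Const (- 32) * (?E - P * Nm) =
      P * (Const (- 32) * Const 32 - Const (- 32) * Const (1 / 32) * ?l ^ 2)"
    by (simp add: Nm_def algebra_simps)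
  also have "\<dots> = P * (?l - Const 32) * (?l - Const (- 32))"
  proof -
    have "Const (- 32) * Const (1 / 32) = (- 1 :: (24, complex) mpoly)"
      by (simp add: Const_uminus flip: Const_mult)
    then show ?thesis by (simp add: Const_uminus power2_eq_square algebra_simps)
  qed
  also have "\<dots> = (\<Prod>r\<in>{32, 16, 8, 0, -8, -16, -32}. ?l - Const r)"
    unfolding P_def prod_1_5 by (simp add: omega_def mult_ac)
  finally show ?thesis .
qed

text \<open>
  The forms of a basis of shortest vectors serve as coordinates, which take only seven values modulo
  the ideal by \<open>linear_form_annihilator\<close>. Any choice of real values for them is attained at a point.
\<close>

theorem ideal_eq_vanishing_ideal:
  "ideal_generated (generators R c) = vanishing_ideal (complex_vec ` leech_min_vectors C)"
proof
  let ?J = "ideal_generated (generators R c)"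
  have zs: "zero_set ?J = complex_vec ` leech_min_vectors C"
    by (simp add: zero_set_ideal_generated zero_set_generators)
  show "?J \<subseteq> vanishing_ideal (complex_vec ` leech_min_vectors C)"
    unfolding zs[symmetric] vanishing_ideal_def zero_set_def by blast
  show "vanishing_ideal (complex_vec ` leech_min_vectors C) \<subseteq> ?J"
  proof
    fix f assume f: "f \<in> vanishing_ideal (complex_vec ` leech_min_vectors C)"
    obtain B where B: "B \<subseteq> R" "independent B" "R \<subseteq> span B"
      using maximal_independent_subset[of R] by blast
    have "leech_min_vectors C \<subseteq> span B"
    proof
      fix v assume "v \<in> leech_min_vectors C"
      then obtain a where "a \<in> R" "v = a \<or> v = - a" by (rule minimal_cases)
      then show "v \<in> span B" using B(3) by (auto intro: span_neg)
    qed
    then have spanB: "span B = UNIV"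
      using span_minimal_vectors span_minimal[of "leech_min_vectors C" "span B"] by auto
    have finB: "finite B" using B(2) by (rule independent_imp_finite)
    show "f \<in> ?J"
    proof (rule vanishing_on_zero_set_imp_in_ideal[OF finB, where W = "{32, 16, 8, 0, -8, -16, -32}" and t = linear_form])
      show "(\<Prod>r\<in>{32, 16, 8, 0, -8, -16, -32}. linear_form b - Const r) \<in> ?J" if "b \<in> B" for b
        using that B(1) by (intro linear_form_annihilator) auto
      show "poly_eval p f = 0" if "p \<in> zero_set ?J" for p
        using that f unfolding zs vanishing_ideal_def by blast
      fix g :: "real ^ 24 \<Rightarrow> complex" assume g: "g \<in> B \<rightarrow>\<^sub>E {32, 16, 8, 0, -8, -16, -32}"
      have real: "g b = complex_of_real (Re (g b))" if "b \<in> B" for b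
      proof -
        have "g b \<in> {32, 16, 8, 0, -8, -16, -32}" using g that by blast
        then show ?thesis by auto
      qed
      obtain h where h: "linear h" "\<And>b. b \<in> B \<Longrightarrow> h b = Re (g b)"
        using linear_independent_extend[OF B(2), of "\<lambda>b. Re (g b)"] by blast
      let ?K = "ideal_generated ((\<lambda>b. linear_form b - Const (g b)) ` B)"
      have "linear_form x - Const (complex_of_real (h x)) \<in> ?K" if "x \<in> span B" for x
        using that
      proof (induction rule: span_induct_alt)
        case base
        show ?case by (simp add: linear_0[OF h(1)] ideal_generated_0)
      next
        case (step r x y)
        have "linear_form x - Const (complex_of_real (h x)) = linear_form x - Const (g x)"
          using real[OF step.hyps(1)] h(2)[OF step.hyps(1)] by simp
        then have "linear_form x - Const (complex_of_real (h x)) \<in> ?K"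
          using step.hyps(1) by (intro ideal_generated_base) auto
        moreover have "linear_form (r *\<^sub>R x + y) - Const (complex_of_real (h (r *\<^sub>R x + y))) =
            Const (complex_of_real r) * (linear_form x - Const (complex_of_real (h x)))
            + (linear_form y - Const (complex_of_real (h y)))"
          by (simp add: linear_form_add linear_form_scaleR linear_add[OF h(1)] linear_scale[OF h(1)]
              Const_add Const_mult algebra_simps)
        ultimately show ?case using step.IH by (simp only: ideal_generated_add ideal_generated_mult)
      qed
      from this[of "axis _ 1"] spanB
      have "Var j - Const ((\<chi> j. complex_of_real (h (axis j 1))) $ j) \<in> ?K" for j
        by (simp add: linear_form_axis)
      then show "\<exists>p. \<forall>j. Var j - Const (p $ j) \<in> ?K" by blast
    qed auto
  qed
qed


subsection \<open>Degrees\<close>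

lemma total_degree_linear_form_le: "total_degree (linear_form a) \<le> 1"
  unfolding linear_form_def
proof (rule total_degree_sum_le)
  fix j
  show "total_degree (Const (complex_of_real (a $ j)) * Var j) \<le> 1"
    using total_degree_mult_le[of "Const (complex_of_real (a $ j))" "Var j"] total_degree_Var_le[of j, where 'b = complex]
    by (simp only: total_degree_Const)
qed

lemma total_degree_S_poly_le: "total_degree (S_poly a b) \<le> 6"
proof -
  have d: "total_degree (linear_form a - Const z) \<le> 1" for z
    by (intro total_degree_diff_le total_degree_linear_form_le) simp
  have "total_degree (\<Prod>h\<in>A. linear_form a - Const (complex_of_real (omega h))) \<le> card A" if "finite A" for A
    using that
  proof (induction A rule: finite_induct)
    case empty
    show ?case using total_degree_Const[of 1] by simp
  next
    case (insert h A)
    let ?p = "\<Prod>h\<in>A. linear_form a - Const (complex_of_real (omega h))"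
    have "total_degree ((linear_form a - Const (complex_of_real (omega h))) * ?p) \<le> 1 + card A"
      using total_degree_mult_le[of "linear_form a - Const (complex_of_real (omega h))" ?p] insert.IH
        d[of "complex_of_real (omega h)"] by linarith
    then show ?case using insert.hyps by simp
  qed
  from this[of "{1..5}"] show ?thesis
    using total_degree_mult_le[of "linear_form b" "\<Prod>h = 1..5. linear_form a - Const (complex_of_real (omega h))"]
      total_degree_linear_form_le[of b] unfolding S_poly_def by simp
qed

lemma total_degree_Nm_le: "total_degree Nm \<le> 2"
  unfolding Nm_def
proof (intro total_degree_diff_le total_degree_sum_le)
  fix i :: 24
  show "total_degree (Var i ^ 2 :: (24, complex) mpoly) \<le> 2"
    using total_degree_mult_le[of "Var i :: (24, complex) mpoly" "Var i"] total_degree_Var_le[of i, where 'b = complex]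
    unfolding power2_eq_square by linarith
qed simp

lemma generators_degree: "f \<in> generators R c \<Longrightarrow> total_degree f \<le> 6"
  using total_degree_Nm_le total_degree_S_poly_le by (auto simp: generators_def)

text \<open>
  On the sphere \<open>Nm = 0\<close> in the plane of \<open>a\<close> and \<open>c\<^sub>i(a)\<close> there are points with \<open>a \<cdot> p = 96 / 5\<close>, where
  \<open>S\<^sub>a\<^sub>,\<^sub>i\<close> does not vanish.
\<close>

lemma S_poly_nontrivial:
  assumes a: "a \<in> R" and i: "i \<in> {1..23}"
  shows "\<not> trivial_poly (S_poly a (c a i))"
proof
  assume "trivial_poly (S_poly a (c a i))"
  then obtain q where q: "S_poly a (c a i) = Nm * q" by (auto simp: trivial_poly_def)
  let ?b = "c a i"
  have ab: "a \<bullet> ?b = 0" "?b \<noteq> 0" using basis_vectors[OF a i] by auto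
  have aa: "a \<bullet> a = 32" by (rule minimal_vector_norm[OF R_minimal[OF a]])
  define s where "s = sqrt (512 / 25 / (?b \<bullet> ?b))"
  have bb: "?b \<bullet> ?b > 0" using ab(2) by simp
  have ba: "?b \<bullet> a = 0" using ab(1) by (simp only: inner_commute)
  have pos: "0 < 512 / 25 / (?b \<bullet> ?b)" by (rule divide_pos_pos[OF _ bb]) simp
  have s2: "s\<^sup>2 = 512 / 25 / (?b \<bullet> ?b)"
    unfolding s_def by (rule real_sqrt_pow2[OF less_imp_le[OF pos]])
  have s0: "s > 0" unfolding s_def by (rule real_sqrt_gt_zero[OF pos])
  have s: "s\<^sup>2 * (?b \<bullet> ?b) = 512 / 25" unfolding s2 using bb by simp
  define p where "p = (3 / 5) *\<^sub>R a + s *\<^sub>R ?b"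
  have "p \<bullet> p = (9 / 25) * 32 + s\<^sup>2 * (?b \<bullet> ?b)"
    by (simp add: p_def inner_add_left inner_add_right ab(1) ba aa power2_eq_square)
  then have "p \<bullet> p = 32" unfolding s by simp
  then have "poly_eval (complex_vec p) Nm = 0" by (simp add: poly_eval_Nm complex_vec_norm)
  then have "poly_eval (complex_vec p) (S_poly a ?b) = 0" by (simp add: q)
  moreover have "complex_dot ?b (complex_vec p) \<noteq> 0"
    using s0 bb ba by (simp add: complex_dot_complex_vec p_def inner_add_right)
  moreover have "complex_dot a (complex_vec p) = 96 / 5"
    by (simp add: complex_dot_complex_vec p_def inner_add_right ab(1) aa)
  then have "omega_product (complex_dot a (complex_vec p)) \<noteq> 0"
    using omega_product_eq_0_iff[of "96 / 5"] by (simp only:) simp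
  ultimately show False by (simp add: poly_eval_S_poly)
qed

end

theorem theorem4p1:
  fixes C :: "(bit ^ 24) set"
    and R :: "(real ^ 24) set"
    and c :: "real ^ 24 \<Rightarrow> nat \<Rightarrow> real ^ 24"
  assumes "extended_golay_code C"
    and "antipodal_representatives (leech_min_vectors C) R"
    and "\<And>a. a \<in> R \<Longrightarrow> orthogonal_basis (insert a (c a ` {1..23}))"
  shows "zero_set (ideal_generated (generators R c)) = complex_vec ` leech_min_vectors C
    \<and> (\<forall>p \<in> zero_set (ideal_generated (generators R c)). simple_zero (generators R c) p)
    \<and> is_radical (ideal_generated (generators R c))
    \<and> (\<exists>f \<in> vanishing_ideal (complex_vec ` leech_min_vectors C).
         \<not> trivial_poly f \<and> total_degree f = 6)
    \<and> (\<forall>f \<in> vanishing_ideal (complex_vec ` leech_min_vectors C).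
         \<not> trivial_poly f \<longrightarrow> 6 \<le> total_degree f)
    \<and> (\<exists>B. vanishing_ideal (complex_vec ` leech_min_vectors C) = ideal_generated B
         \<and> (\<forall>f \<in> B. total_degree f \<le> 6))"
proof -
  interpret golay_sets "codeword_support ` C"
    by (rule golay_sets_of_extended_golay_code) (rule assms(1))
  interpret leech_generators C R c
    by unfold_locales (rule assms(2), rule assms(3))
  let ?V = "vanishing_ideal (complex_vec ` leech_min_vectors C)"
  have small: "6 \<le> total_degree f" if "f \<in> ?V" "\<not> trivial_poly f" for f
  proof (rule ccontr)
    assume "\<not> 6 \<le> total_degree f"
    then have "total_degree f \<le> 5" by simp
    moreover have "poly_eval (complex_vec v) f = 0" if "v \<in> leech_min_vectors C" for v
      using \<open>f \<in> ?V\<close> that by (auto simp: vanishing_ideal_def)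
    ultimately have "Nm dvd f" by (rule Nm_dvd_of_degree_le_5)
    then show False using that(2) by (simp add: trivial_poly_def)
  qed
  obtain a where a: "a \<in> R" using R_nonempty by blast
  have "S_poly a (c a 1) \<in> generators R c" using a by (rule S_poly_in_generators) simp
  then have S: "S_poly a (c a 1) \<in> ?V"
    unfolding ideal_eq_vanishing_ideal[symmetric] by (rule ideal_generated_base)
  have "\<not> trivial_poly (S_poly a (c a 1))" by (rule S_poly_nontrivial[OF a]) simp
  moreover from this have "total_degree (S_poly a (c a 1)) = 6"
    using small[OF S] total_degree_S_poly_le[of a "c a 1"] by simp
  ultimately have six: "\<exists>f\<in>?V. \<not> trivial_poly f \<and> total_degree f = 6" using S by blast
  have rad: "is_radical (ideal_generated (generators R c))"
    unfolding ideal_eq_vanishing_ideal by (rule vanishing_ideal_is_radical)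
  have gens: "\<exists>B. ?V = ideal_generated B \<and> (\<forall>f\<in>B. total_degree f \<le> 6)"
    by (rule exI[of _ "generators R c"]) (use generators_degree in \<open>simp add: ideal_eq_vanishing_ideal\<close>)
  have zeros: "zero_set (ideal_generated (generators R c)) = complex_vec ` leech_min_vectors C"
    unfolding zero_set_ideal_generated by (rule zero_set_generators)
  show ?thesis
    by (intro conjI ballI impI) (fact zeros, erule zeros_simple, fact rad, fact six, erule (1) small, fact gens)
qed

end
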